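(* Assume $0\le\alpha<1/2$ and $\phi>0$. Then, as $n\to\infty$, $$\frac{S_n-\mathbb{E}[S_n]}{\sqrt{\frac{\phi}{1-2\alpha}\,n}}\xrightarrow{d}N(0,1),$$ and $$\limsup_{n\to\infty}\pm\frac{S_n-\mathbb{E}[S_n]}{\sqrt{2\frac{\phi}{1-2\alpha}\,n\,\log\log\!\left(\frac{\phi\,\Gamma(\alpha+1)^2}{1-2\alpha}\,n^{1-2\alpha}\right)}}=1\quad\text{almost surely}.$$
   Context: Fix $p,q,r\ge 0$ with $p+q+r=1$ and $\theta\in[0,1)$. Let $(X_n)_{n\ge1}$ be random variables with values in $\{-1,0,+1\}$ such that $\mathbb{P}(X_1=+1)=p$, $\mathbb{P}(X_1=-1)=q$, $\mathbb{P}(X_1=0)=r$. Let $\mathcal F_n=\sigma(X_1,\dots,X_n)$. For $n\ge1$ let $n_+,n_-,n_0$ denote the number of indices $i\in\{1,\dots,n\}$ with $X_i=+1$, $X_i=-1$, $X_i=0$ respectively. The conditional law of $X_{n+1}$ is $\mathbb{P}(X_{n+1}=+1\mid\mathcal F_n)=\theta\big(\tfrac{n_+}{n}p+\tfrac{n_-}{n}q\big)+(1-\theta)p$, $\mathbb{P}(X_{n+1}=-1\mid\mathcal F_n)=\theta\big(\tfrac{n_-}{n}p+\tfrac{n_+}{n}q\big)+(1-\theta)q$, $\mathbb{P}(X_{n+1}=0\mid\mathcal F_n)=\theta(p+q)\tfrac{n_0}{n}+r$. Set $S_0=0$, $S_n=\sum_{i=1}^n X_i$. Notation: $\alpha=(p-q)\theta$,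 $\omega=(p-q)(1-\theta)$, $\tau=(1-\theta)(p+q)$, $\gamma=(p+q)\theta$, $\phi=\frac{\tau}{1-\gamma}-\left(\frac{\omega}{1-\alpha}\right)^2$. *)

theory Defs
  imports "HOL-Probability.Probability"
begin

definition cnt :: "real list \<Rightarrow> real \<Rightarrow> real" where
  "cnt xs v = real (length (filter (\<lambda>y. y = v) xs))"

definition psum :: "(nat \<Rightarrow> 'a \<Rightarrow> real) \<Rightarrow> nat \<Rightarrow> 'a \<Rightarrow> real" where
  "psum X n \<omega> = (\<Sum>i\<in>{1..n}. X i \<omega>)"

definition path_event :: "'a measure \<Rightarrow> (nat \<Rightarrow> 'a \<Rightarrow> real) \<Rightarrow> real list \<Rightarrow> 'a set" where
  "path_event M X xs = {\<omega>\<in>space M. \<forall>i<length xs. X (Suc i) \<omega> = xs ! i}"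

end

theory Submission
  imports Defs "HOL-Real_Asymp.Real_Asymp"
begin

text \<open>
  With \<open>a\<^sub>n = \<Prod>1\<le>k<n. k / (k + \<alpha>) \<sim> \<Gamma>(\<alpha> + 1) n\<^sup>-\<^sup>\<alpha>\<close>, the process \<open>a\<^sub>n (S\<^sub>n - E S\<^sub>n)\<close> is a
  martingale with bounded increments. An exponential-moment law of large numbers for \<open>S\<^sub>n / n\<close> and for
  the proportion of nonzero steps shows that its predictable variance is almost surely asymptotic to
  \<open>\<phi> \<Sum>i\<le>n. a\<^sub>i\<^sup>2 \<sim> \<phi> \<Gamma>(\<alpha> + 1)\<^sup>2 n\<^bsup>1-2\<alpha>\<^esup> / (1 - 2\<alpha>)\<close>; moreover \<open>\<phi> > 0\<close> bounds the conditional
  variances below, so this variance grows at a deterministic rate. The central limit theorem follows by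
  comparing the characteristic function with the exponential compensated by the predictable variance.
  The law of the iterated logarithm follows from a maximal inequality for exponential supermartingales
  (upper half), and from Kolmogorov's lower exponential bound on blocks stopped when the variance reaches
  a prescribed level, together with a conditional Borel--Cantelli lemma (lower half).

  Since the steps take finitely many values, conditional expectations given the past are finite sums
  over one-step extensions of the path, a path being the list of its steps.
\<close>

section \<open>Processes with finitely many values\<close>

text \<open>The predictable variance is random and its asymptotics hold only almost surely, whereas
  the block argument and the dominated convergence want deterministic control. What rescues both is
  that each step is, with weight 1 - \<theta>, a fresh copy of the first one: every conditional
  variance is at least 1 - \<theta> times the variance \<open>p + q - (p - q)^2\<close> of the first
  step. This is positive unless that step is deterministic, in which case \<phi> would vanish, given
  \<alpha> \<ge> 0. Hence the variance lies on every path between two fixed multiples of one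
  deterministic clock, and block ends can be named in advance. The exact asymptotics enter only at
  the end, when the random variance is replaced by its deterministic equivalent.

  Exponential moments, rather than second moments, are used for the averages because their tails are
  summable over all times at once. The limits are fixed points: the conditional mean and second
  moment of a step are affine functions, with slopes \<alpha> and \<gamma> below 1, of the averages
  so far.\<close>

locale path_process = prob_space M for M :: "'a measure" +
  fixes X :: "nat \<Rightarrow> 'a \<Rightarrow> real" and D :: "real set" and trans :: "real list \<Rightarrow> real \<Rightarrow> real"
  assumes finite_D: "finite D"
    and measurable_X [measurable]: "\<And>i. X i \<in> borel_measurable M"
    and X_in_D: "\<And>i x. x \<in> space M \<Longrightarrow> X (Suc i) x \<in> D"
    and trans_nonneg: "\<And>xs v. set xs \<subseteq> D \<Longrightarrow> v \<in> D \<Longrightarrow> 0 \<le> trans xs v"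
    and trans_sum: "\<And>xs. set xs \<subseteq> D \<Longrightarrow> (\<Sum>v\<in>D. trans xs v) = 1"
    and prob_trans: "\<And>xs v. set xs \<subseteq> D \<Longrightarrow> v \<in> D \<Longrightarrow>
      prob (path_event M X xs \<inter> {x \<in> space M. X (Suc (length xs)) x = v})
        = prob (path_event M X xs) * trans xs v"
begin

definition history :: "nat \<Rightarrow> 'a \<Rightarrow> real list" where
  "history n x = map (\<lambda>i. X (Suc i) x) [0..<n]"

lemma length_history [simp]: "length (history n x) = n"
  by (simp add: history_def)

lemma history_0 [simp]: "history 0 x = []"
  by (simp add: history_def)

lemma history_Suc: "history (Suc n) x = history n x @ [X (Suc n) x]"
  by (simp add: history_def)

lemma take_history: "j \<le> n \<Longrightarrow> take j (history n x) = history j x"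
  by (simp add: history_def take_map)

lemma set_history: "x \<in> space M \<Longrightarrow> set (history n x) \<subseteq> D"
  using X_in_D by (auto simp: history_def)

lemma path_event_eq: "path_event M X xs = {x \<in> space M. history (length xs) x = xs}"
proof -
  have "(\<forall>i<length xs. X (Suc i) x = xs ! i) \<longleftrightarrow> history (length xs) x = xs" for x
    unfolding history_def list_eq_iff_nth_eq[of _ xs] by simp
  then show ?thesis unfolding path_event_def by simp
qed

lemma history_measurable: "history n \<in> measurable M (count_space UNIV)"
proof -
  let ?L = "{xs. set xs \<subseteq> D \<and> length xs = n}"
  have fin: "finite ?L" using finite_lists_length_eq[OF finite_D] .
  have s: "{x \<in> space M. history n x = xs} \<in> events" for xs
  proof -
    have "{x \<in> space M. history n x = xs} = {x \<in> space M. length xs = n \<and> (\<forall>i<n. X (Suc i) x = xs ! i)}"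
      unfolding history_def list_eq_iff_nth_eq[of _ xs] by auto
    also have "\<dots> \<in> events" by measurable
    finally show ?thesis .
  qed
  show "history n \<in> measurable M (count_space UNIV)"
  proof (rule measurableI)
    fix A :: "real list set"
    have "history n -` A \<inter> space M = (\<Union>xs\<in>A \<inter> ?L. {x \<in> space M. history n x = xs})"
      using set_history by auto
    also have "\<dots> \<in> events" using fin s by (intro sets.finite_UN) auto
    finally show "history n -` A \<inter> space M \<in> events" .
  qed auto
qed

lemma measurable_of_history: "(\<lambda>x. h (history n x)) \<in> measurable M N"
  if "\<And>xs. h xs \<in> space N" for h :: "real list \<Rightarrow> 'b"
  by (rule measurable_compose[OF history_measurable]) (use that in auto)

lemma borel_measurable_of_history:
  "(\<lambda>x. h (history n x)) \<in> borel_measurable M" for h :: "real list \<Rightarrow> 'b::topological_space"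
  by (rule measurable_of_history) auto

lemma event_of_history: "{x \<in> space M. P (history n x)} \<in> events"
proof -
  have "{x \<in> space M. P (history n x)} = history n -` {xs. P xs} \<inter> space M" by auto
  then show ?thesis using measurable_sets[OF history_measurable, of "{xs. P xs}" n] by simp
qed

lemma finite_paths: "finite {xs. set xs \<subseteq> D \<and> length xs = n}"
  using finite_lists_length_eq[OF finite_D] .

text \<open>A function of the first \<open>n\<close> steps is a finite combination of indicators of
  path events, so every \<open>h\<close> is integrable and its integral is a finite sum.\<close>

lemma
  fixes h :: "real list \<Rightarrow> 'b::{banach, second_countable_topology}"
  shows integrable_history: "integrable M (\<lambda>x. h (history n x))"
    and integral_history: "(\<integral>x. h (history n x) \<partial>M)
      = (\<Sum>xs | set xs \<subseteq> D \<and> length xs = n. prob (path_event M X xs) *\<^sub>R h xs)"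
proof -
  let ?L = "{xs. set xs \<subseteq> D \<and> length xs = n}"
  let ?f = "\<lambda>x. \<Sum>xs\<in>?L. indicat_real {y \<in> space M. history n y = xs} x *\<^sub>R h xs"
  have eq: "h (history n x) = ?f x" if "x \<in> space M" for x
  proof -
    have "?f x = (\<Sum>xs\<in>?L. if xs = history n x then h xs else 0)"
      using that by (intro sum.cong) (auto simp: indicator_def)
    also have "\<dots> = h (history n x)"
      using that set_history[OF that] by (simp add: sum.delta[OF finite_paths])
    finally show ?thesis by simp
  qed
  have int: "integrable M (\<lambda>x. indicat_real {y \<in> space M. history n y = xs} x *\<^sub>R h xs)" for xs
    by (intro integrable_scaleR_left integrable_real_indicator) (auto simp: emeasure_eq_measure event_of_history[of "\<lambda>ys. ys = xs"])
  show "integrable M (\<lambda>x. h (history n x))"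
    by (subst Bochner_Integration.integrable_cong[OF refl eq]) (use int in auto)
  have "(\<integral>x. h (history n x) \<partial>M) = (\<integral>x. ?f x \<partial>M)"
    by (rule Bochner_Integration.integral_cong) (use eq in auto)
  also have "\<dots> = (\<Sum>xs\<in>?L. \<integral>x. indicat_real {y \<in> space M. history n y = xs} x *\<^sub>R h xs \<partial>M)"
    by (rule Bochner_Integration.integral_sum) (rule int)
  also have "\<dots> = (\<Sum>xs\<in>?L. prob {y \<in> space M. history n y = xs} *\<^sub>R h xs)"
    by (intro sum.cong refl) (simp add: emeasure_eq_measure event_of_history[of "\<lambda>ys. ys = _"] Int_def conj_commute)
  also have "\<dots> = (\<Sum>xs\<in>?L. prob (path_event M X xs) *\<^sub>R h xs)"
    by (intro sum.cong refl) (auto simp: path_event_eq)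
  finally show "(\<integral>x. h (history n x) \<partial>M) = (\<Sum>xs\<in>?L. prob (path_event M X xs) *\<^sub>R h xs)" .
qed

section \<open>Transition operator and stopped expectations\<close>

definition step :: "(real list \<Rightarrow> 'b::real_vector) \<Rightarrow> real list \<Rightarrow> 'b" where
  "step h xs = (\<Sum>v\<in>D. trans xs v *\<^sub>R h (xs @ [v]))"

text \<open>Tower property: a path of length \<open>Suc n\<close> splits uniquely into its first
  \<open>n\<close> steps and its last one, so \<open>step h xs\<close> is the conditional
  expectation of \<open>h\<close> after one more step. Values in a Banach space are allowed for the
  sake of characteristic functions.\<close>

lemma integral_step:
  fixes h :: "real list \<Rightarrow> 'b::{banach, second_countable_topology}"
  shows "(\<integral>x. h (history (Suc n) x) \<partial>M) = (\<integral>x. step h (history n x) \<partial>M)"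
proof -
  let ?L = "\<lambda>n. {xs. set xs \<subseteq> D \<and> length xs = n}"
  have pe: "prob (path_event M X (xs @ [v])) = prob (path_event M X xs) * trans xs v"
    if "set xs \<subseteq> D" "v \<in> D" for xs v
  proof -
    have "path_event M X (xs @ [v]) = path_event M X xs \<inter> {x \<in> space M. X (Suc (length xs)) x = v}"
      by (auto simp: path_event_def nth_append less_Suc_eq)
    then show ?thesis using prob_trans[OF that] by simp
  qed
  have "(\<integral>x. h (history (Suc n) x) \<partial>M) = (\<Sum>ys\<in>?L (Suc n). prob (path_event M X ys) *\<^sub>R h ys)"
    by (rule integral_history)
  also have "\<dots> = (\<Sum>(xs, v)\<in>?L n \<times> D. prob (path_event M X (xs @ [v])) *\<^sub>R h (xs @ [v]))"
  proof (rule sum.reindex_bij_witness[of _ "\<lambda>(xs, v). xs @ [v]" "\<lambda>ys. (butlast ys, last ys)"])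
    fix a assume a: "a \<in> ?L (Suc n)"
    then have "a \<noteq> []" by auto
    then obtain b w where "a = b @ [w]" by (metis append_butlast_last_id)
    with a show "(case (butlast a, last a) of (xs, v) \<Rightarrow> xs @ [v]) = a"
      "(butlast a, last a) \<in> ?L n \<times> D"
      "(case (butlast a, last a) of (xs, v) \<Rightarrow> prob (path_event M X (xs @ [v])) *\<^sub>R h (xs @ [v]))
        = prob (path_event M X a) *\<^sub>R h a"
      by auto
  qed auto
  also have "\<dots> = (\<Sum>xs\<in>?L n. \<Sum>v\<in>D. prob (path_event M X (xs @ [v])) *\<^sub>R h (xs @ [v]))"
    by (simp add: sum.cartesian_product)
  also have "\<dots> = (\<Sum>xs\<in>?L n. prob (path_event M X xs) *\<^sub>R step h xs)"
    by (intro sum.cong refl) (auto simp: step_def scaleR_sum_right pe intro!: sum.cong)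
  also have "\<dots> = (\<integral>x. step h (history n x) \<partial>M)"
    by (rule integral_history[symmetric])
  finally show ?thesis .
qed

lemma step_mono:
  fixes h h' :: "real list \<Rightarrow> real"
  assumes "set xs \<subseteq> D" "\<And>v. v \<in> D \<Longrightarrow> h (xs @ [v]) \<le> h' (xs @ [v])"
  shows "step h xs \<le> step h' xs"
  unfolding step_def by (intro sum_mono scaleR_left_mono assms trans_nonneg)

lemma step_cong:
  assumes "\<And>v. v \<in> D \<Longrightarrow> h (xs @ [v]) = h' (xs @ [v])"
  shows "step h xs = step h' xs"
  unfolding step_def using assms by (auto intro!: sum.cong)

lemma step_add: "step (\<lambda>ys. h ys + h' ys) xs = step h xs + step h' xs"
  by (simp add: step_def scaleR_right_distrib sum.distrib)

lemma step_mult: "step (\<lambda>ys. c * h ys) xs = c * step h xs" for c :: "'b::real_algebra"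
  by (simp add: step_def sum_distrib_left)

lemma step_const: "set xs \<subseteq> D \<Longrightarrow> step (\<lambda>_. c) xs = c"
  by (simp add: step_def trans_sum flip: scaleR_left.sum)

text \<open>\<^term>\<open>stopped S m h xs\<close> is the conditional expectation, given that the path starts with
  \<^term>\<open>xs\<close>, of \<^term>\<open>h\<close> evaluated when the path first enters \<^term>\<open>S\<close>, or after
  \<^term>\<open>m\<close> further steps.\<close>

primrec stopped :: "(real list \<Rightarrow> bool) \<Rightarrow> nat \<Rightarrow> (real list \<Rightarrow> 'b::real_vector) \<Rightarrow> real list \<Rightarrow> 'b"
where
  "stopped S 0 h = h"
| "stopped S (Suc m) h = (\<lambda>xs. if S xs then h xs else step (stopped S m h) xs)"

abbreviation iterate :: "nat \<Rightarrow> (real list \<Rightarrow> 'b::real_vector) \<Rightarrow> real list \<Rightarrow> 'b" where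
  "iterate \<equiv> stopped (\<lambda>_. False)"

lemma integral_iterate:
  fixes h :: "real list \<Rightarrow> 'b::{banach, second_countable_topology}"
  shows "(\<integral>x. h (history (n + m) x) \<partial>M) = (\<integral>x. iterate m h (history n x) \<partial>M)"
proof (induction m arbitrary: n)
  case (Suc m)
  show ?case using Suc[of "Suc n"] integral_step[of "iterate m h" n] by simp
qed simp

text \<open>\<open>I\<close> is an invariant preserved as long as the path is not stopped, so
  \<open>h\<close> and \<open>h'\<close> are compared only at endpoints that can be reached. A bound
  on the overshoot of a stopping level enters in this way.\<close>

lemma stopped_mono:
  fixes h h' :: "real list \<Rightarrow> real"
  assumes "I xs" and "\<And>ys. I ys \<Longrightarrow> set ys \<subseteq> D"
    and "\<And>ys v. I ys \<Longrightarrow> \<not> S ys \<Longrightarrow> v \<in> D \<Longrightarrow> I (ys @ [v])"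
    and "\<And>ys. I ys \<Longrightarrow> S ys \<or> length ys = length xs + m \<Longrightarrow> h ys \<le> h' ys"
  shows "stopped S m h xs \<le> stopped S m h' xs"
  using assms(1,4)
proof (induction m arbitrary: xs)
  case (Suc m)
  show ?case
  proof (cases "S xs")
    case False
    have "stopped S m h (xs @ [v]) \<le> stopped S m h' (xs @ [v])" if "v \<in> D" for v
      using Suc.prems that False assms(3) by (intro Suc.IH) auto
    with False show ?thesis using Suc.prems assms(2) by (auto intro!: step_mono)
  qed (use Suc.prems in auto)
qed auto

lemma stopped_cong:
  fixes h h' :: "real list \<Rightarrow> real"
  assumes "I xs" and "\<And>ys. I ys \<Longrightarrow> set ys \<subseteq> D"
    and "\<And>ys v. I ys \<Longrightarrow> \<not> S ys \<Longrightarrow> v \<in> D \<Longrightarrow> I (ys @ [v])"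
    and "\<And>ys. I ys \<Longrightarrow> S ys \<or> length ys = length xs + m \<Longrightarrow> h ys = h' ys"
  shows "stopped S m h xs = stopped S m h' xs"
  by (rule antisym; rule stopped_mono[where I = I])
    (use assms(1,2,3) assms(4)[THEN eq_refl] assms(4)[THEN eq_refl[OF sym]] in blast)+

lemma stopped_add: "stopped S m (\<lambda>ys. h ys + h' ys) xs = stopped S m h xs + stopped S m h' xs"
proof (induction m arbitrary: xs)
  case (Suc m)
  then have "stopped S m (\<lambda>ys. h ys + h' ys) = (\<lambda>ys. stopped S m h ys + stopped S m h' ys)"
    by blast
  then show ?case by (simp add: step_add)
qed simp

lemma stopped_mult: "stopped S m (\<lambda>ys. c * h ys) xs = c * stopped S m h xs"
  for c :: "'b::real_algebra"
proof (induction m arbitrary: xs)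
  case (Suc m)
  then have "stopped S m (\<lambda>ys. c * h ys) = (\<lambda>ys. c * stopped S m h ys)"
    by blast
  then show ?case by (simp add: step_mult)
qed simp

lemma stopped_const: "set xs \<subseteq> D \<Longrightarrow> stopped S m (\<lambda>_. c) xs = c"
proof (induction m arbitrary: xs)
  case (Suc m)
  have "step (stopped S m (\<lambda>_. c)) xs = step (\<lambda>_. c) xs"
    by (rule step_cong) (use Suc in auto)
  then show ?case using Suc.prems by (simp add: step_const)
qed simp

lemma stopped_supermartingale:
  fixes G :: "real list \<Rightarrow> real"
  assumes "\<And>ys. set ys \<subseteq> D \<Longrightarrow> \<not> S ys \<Longrightarrow> step G ys \<le> G ys" "set xs \<subseteq> D"
  shows "stopped S m G xs \<le> G xs"
  using assms(2)
proof (induction m arbitrary: xs)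
  case (Suc m)
  have "step (stopped S m G) xs \<le> step G xs"
    by (rule step_mono) (use Suc in auto)
  then show ?case using assms(1)[of xs] Suc.prems by auto
qed simp

lemma stopped_submartingale:
  fixes G :: "real list \<Rightarrow> real"
  assumes "\<And>ys. set ys \<subseteq> D \<Longrightarrow> \<not> S ys \<Longrightarrow> G ys \<le> step G ys" "set xs \<subseteq> D"
  shows "G xs \<le> stopped S m G xs"
  using assms(2)
proof (induction m arbitrary: xs)
  case (Suc m)
  have "step G xs \<le> step (stopped S m G) xs"
    by (rule step_mono) (use Suc in auto)
  then show ?case using assms(1)[of xs] Suc.prems by auto
qed simp

text \<open>Both sides are the conditional probability that \<open>H\<close> occurs within
  \<open>m\<close> steps: the left one runs to the horizon and looks back over the prefixes, the
  right one halts at the first occurrence. After an occurrence the left integrand is constantly 1,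
  which matches the halted value.\<close>

lemma iterate_hit_eq_stopped:
  assumes "set xs \<subseteq> D"
  shows "iterate m (\<lambda>ys. of_bool (\<exists>j\<le>length ys. length xs \<le> j \<and> H (take j ys)) :: real) xs
    = stopped H m (\<lambda>ys. of_bool (H ys)) xs"
  using assms
proof (induction m arbitrary: xs)
  case 0
  show ?case by (auto simp: le_antisym)
next
  case (Suc m)
  let ?I = "\<lambda>ys. set ys \<subseteq> D \<and> length xs \<le> length ys \<and> take (length xs) ys = xs"
  let ?h = "\<lambda>xs ys. of_bool (\<exists>j\<le>length ys. length xs \<le> j \<and> H (take j ys)) :: real"
  show ?case
  proof (cases "H xs")
    case True
    have "iterate (Suc m) (?h xs) xs = iterate (Suc m) (\<lambda>_. 1) xs"
      by (rule stopped_cong[where I = ?I]) (use Suc.prems True in \<open>auto intro!: exI[of _ "length xs"]\<close>)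
    then show ?thesis using True stopped_const[OF Suc.prems, of "\<lambda>_. False" "Suc m" "1::real"] by simp
  next
    case False
    have "iterate m (?h xs) (xs @ [v]) = stopped H m (\<lambda>ys. of_bool (H ys)) (xs @ [v])" if v: "v \<in> D" for v
    proof -
      \<comment> \<open>As \<open>H xs\<close> fails, the prefix \<open>xs\<close> drops out of the
        search, and the induction hypothesis applies from \<open>xs @ [v]\<close>.\<close>
      have "?h xs ys = ?h (xs @ [v]) ys" if "take (length xs) ys = xs" "length xs < length ys" for ys
      proof -
        have "(length xs \<le> j \<and> H (take j ys)) = (length (xs @ [v]) \<le> j \<and> H (take j ys))" for j
          using False that by (cases "j = length xs") auto
        then show ?thesis by presburger
      qed
      note eq = this
      have "iterate m (?h xs) (xs @ [v]) = iterate m (?h (xs @ [v])) (xs @ [v])"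
      proof (rule stopped_cong[where I = "\<lambda>ys. set ys \<subseteq> D \<and> length xs < length ys \<and> take (length xs) ys = xs"])
        fix ys assume "set ys \<subseteq> D \<and> length xs < length ys \<and> take (length xs) ys = xs"
        then show "?h xs ys = ?h (xs @ [v]) ys" by (intro eq) auto
      qed (use Suc.prems v in auto)
      also have "\<dots> = stopped H m (\<lambda>ys. of_bool (H ys)) (xs @ [v])"
        by (rule Suc.IH) (use Suc.prems v in auto)
      finally show ?thesis .
    qed
    with False show ?thesis by (auto intro!: step_cong)
  qed
qed

section \<open>The maximal inequality for supermartingales\<close>

lemma integral_of_bool: "(\<integral>x. of_bool (P (history n x)) \<partial>M) = prob {x \<in> space M. P (history n x)}"
proof -
  have "(\<integral>x. of_bool (P (history n x)) \<partial>M) = (\<integral>x. indicat_real {x \<in> space M. P (history n x)} x \<partial>M)"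
    by (rule Bochner_Integration.integral_cong) auto
  also have "\<dots> = prob {x \<in> space M. P (history n x)}"
    by (simp add: Int_def conj_commute)
  finally show ?thesis .
qed

text \<open>Stop when \<open>G\<close> first reaches \<open>u\<close>. At the stopped path the
  indicator of \<open>u \<le> G\<close> is at most \<open>G / u\<close>, whether the level or the
  horizon came first, and optional stopping bounds the mean of \<open>G\<close> by its initial
  value.\<close>

lemma maximal_ineq_finite:
  fixes G :: "real list \<Rightarrow> real"
  assumes nonneg: "\<And>ys. set ys \<subseteq> D \<Longrightarrow> 0 \<le> G ys"
    and super: "\<And>ys. set ys \<subseteq> D \<Longrightarrow> step G ys \<le> G ys" and u: "u > 0"
  shows "prob {x \<in> space M. \<exists>j\<le>n. u \<le> G (history j x)} \<le> G [] / u"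
proof -
  let ?H = "\<lambda>ys. u \<le> G ys"
  have "prob {x \<in> space M. \<exists>j\<le>n. u \<le> G (history j x)}
      = prob {x \<in> space M. \<exists>j\<le>length (history n x). u \<le> G (take j (history n x))}"
    by (rule arg_cong[where f = prob]) (auto simp: take_history)
  also have "\<dots> = (\<integral>x. of_bool (\<exists>j\<le>length (history n x). ?H (take j (history n x))) \<partial>M)"
    by (rule integral_of_bool[symmetric])
  also have "\<dots> = iterate n (\<lambda>ys. of_bool (\<exists>j\<le>length ys. ?H (take j ys))) []"
    using integral_iterate[of "\<lambda>ys. of_bool (\<exists>j\<le>length ys. ?H (take j ys)) :: real" 0 n]
    by (simp add: prob_space)
  also have "\<dots> = stopped ?H n (\<lambda>ys. of_bool (?H ys)) []"
    using iterate_hit_eq_stopped[of "[]" n ?H] by simp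
  also have "\<dots> \<le> stopped ?H n (\<lambda>ys. (1 / u) * G ys) []"
    by (rule stopped_mono[where I = "\<lambda>ys. set ys \<subseteq> D"]) (use u nonneg in auto)
  also have "\<dots> = (1 / u) * stopped ?H n G []" by (rule stopped_mult)
  also have "\<dots> \<le> (1 / u) * G []"
    using u by (intro mult_left_mono stopped_supermartingale super) auto
  finally show ?thesis by simp
qed

lemma maximal_ineq:
  fixes G :: "real list \<Rightarrow> real"
  assumes "\<And>ys. set ys \<subseteq> D \<Longrightarrow> 0 \<le> G ys"
    and "\<And>ys. set ys \<subseteq> D \<Longrightarrow> step G ys \<le> G ys" and "u > 0"
  shows "prob {x \<in> space M. \<exists>j. u \<le> G (history j x)} \<le> G [] / u"
proof -
  let ?A = "\<lambda>n. {x \<in> space M. \<exists>j\<le>n. u \<le> G (history j x)}"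
  have m: "{x \<in> space M. u \<le> G (history j x)} \<in> events" for j by (rule event_of_history)
  have A: "?A n = (\<Union>j\<in>{..n}. {x \<in> space M. u \<le> G (history j x)})" for n by auto
  have "(\<lambda>n. prob (?A n)) \<longlonglongrightarrow> prob (\<Union>n. ?A n)"
  proof (rule finite_Lim_measure_incseq)
    show "range ?A \<subseteq> events" unfolding A using m by auto
    show "incseq ?A" by (rule incseq_SucI) (auto intro: le_SucI)
  qed
  moreover have "(\<Union>n. ?A n) = {x \<in> space M. \<exists>j. u \<le> G (history j x)}" by auto
  ultimately have lim: "(\<lambda>n. prob (?A n)) \<longlonglongrightarrow> prob {x \<in> space M. \<exists>j. u \<le> G (history j x)}"
    by simp
  have le: "prob (?A n) \<le> G [] / u" for n
    by (rule maximal_ineq_finite; fact assms)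
  show ?thesis
    by (rule LIMSEQ_le_const2[OF lim exI[of _ 0]]) (use le in blast)
qed

end

section \<open>A law of large numbers for reinforced sums\<close>

text \<open>Averaging over a centred variable removes the linear term and leaves a sub-Gaussian
  bound for all values of the exponential parameter, not only for small ones.\<close>

lemma exp_le_id_plus_exp_square: "exp x \<le> x + exp (x\<^sup>2)" for x :: real
proof -
  have sq: "1 + x\<^sup>2 \<le> exp (x\<^sup>2)" by (rule exp_ge_add_one_self)
  consider "x < -1" | "-1 \<le> x" "x < 0" | "0 \<le> x" "x \<le> 1" | "1 < x" by linarith
  then show ?thesis
  proof cases
    case 1
    then have "-x * 1 \<le> -x * -x" by (intro mult_left_mono) auto
    then have "-x \<le> x\<^sup>2" by (simp add: power2_eq_square)
    moreover have "exp x \<le> 1" using 1 by simp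
    ultimately show ?thesis using sq by linarith
  next
    case 2
    have pos: "0 < 1 - x + x\<^sup>2 / 2" using 2 by (simp add: add_pos_nonneg)
    have "1 - x + x\<^sup>2 / 2 \<le> exp (-x)" using exp_lower_Taylor_quadratic[of "-x"] 2 by simp
    then have "1 / exp (-x) \<le> 1 / (1 - x + x\<^sup>2 / 2)" using pos by (intro frac_le) auto
    then have "exp x \<le> 1 / (1 - x + x\<^sup>2 / 2)" by (simp add: exp_minus inverse_eq_divide)
    also have "\<dots> \<le> 1 + x + x\<^sup>2"
    proof -
      have "(1 + x + x\<^sup>2) * (1 - x + x\<^sup>2 / 2) = 1 + x\<^sup>2 / 2 * (1 - x + x\<^sup>2)"
        by (simp add: power2_eq_square field_simps)
      moreover have "0 \<le> x\<^sup>2 / 2 * (1 - x + x\<^sup>2)" using 2 by (intro mult_nonneg_nonneg) auto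
      ultimately show ?thesis using pos by (simp add: pos_divide_le_eq)
    qed
    finally show ?thesis using sq by linarith
  next
    case 3
    then show ?thesis using exp_bound[of x] sq by linarith
  next
    case 4
    then have "x * 1 \<le> x * x" by (intro mult_left_mono) auto
    then have "exp x \<le> exp (x\<^sup>2)" by (simp add: power2_eq_square)
    then show ?thesis using 4 by linarith
  qed
qed

lemma summable_exp_neg_powr:
  fixes c s :: real
  assumes "c > 0" "s > 0"
  shows "summable (\<lambda>n. exp (- c * real n powr s))"
proof (rule summable_comparison_test_bigo)
  show "summable (\<lambda>n. norm (real n powr -2))" by (simp add: summable_real_powr_iff)
  show "(\<lambda>n. exp (- c * real n powr s)) \<in> O(\<lambda>n. real n powr -2)"
    using assms by real_asymp
qed

lemma one_minus_powr_ge: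
  fixes x s :: real
  assumes "0 \<le> x" "x \<le> 1/2" "0 \<le> s"
  shows "1 - 2 * s * x \<le> (1 - x) powr s"
proof -
  have "x * x \<le> x * (1/2)" using assms by (intro mult_left_mono) auto
  then have "- 2 * x \<le> ln (1 - x)"
    using ln_one_minus_pos_lower_bound[of x] assms by (simp add: power2_eq_square)
  then have "s * (- 2 * x) \<le> s * ln (1 - x)" using assms by (intro mult_left_mono) auto
  then have "exp (s * (- 2 * x)) \<le> (1 - x) powr s" using assms by (simp add: powr_def)
  moreover have "1 + s * (- 2 * x) \<le> exp (s * (- 2 * x))" by (rule exp_ge_add_one_self)
  ultimately show ?thesis by (simp add: algebra_simps)
qed

text \<open>\<open>v n\<close> will be the variance proxy of a deviation that is multiplied by
  \<open>1 + \<beta> / n\<close> at each step and then receives bounded noise. Any exponent below 2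
  is enough for a law of large numbers; giving up half of the gap \<delta> lets one bound cover all
  \<beta> below 1, including 1/2, where the true growth carries a logarithm.\<close>

lemma reinforced_variance_le:
  fixes \<beta> :: real and v :: "nat \<Rightarrow> real"
  assumes \<beta>: "0 \<le> \<beta>" "\<beta> < 1" and v1: "v 1 = 1"
    and v_Suc: "\<And>n. n \<ge> 1 \<Longrightarrow> v (Suc n) = (1 + \<beta> / n)\<^sup>2 * v n + 1" and n: "n \<ge> 1"
  defines "\<delta> \<equiv> 1 - \<beta>"
  shows "v n \<le> 2 / \<delta> * real n powr (2 - \<delta> / 2)"
  using n
proof (induction n rule: dec_induct)
  case base
  then show ?case using \<beta> v1 by (simp add: \<delta>_def)
next
  case (step n)
  define x where "x = 1 / (real n + 1)"
  define s where "s = \<delta> / 2"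
  have d: "0 < \<delta>" "\<delta> \<le> 1" using \<beta> by (auto simp: \<delta>_def)
  have n: "real n \<ge> 1" using step.hyps by simp
  then have x: "0 < x" "x \<le> 1/2" and nx: "real n = (1 - x) * (real n + 1)"
    by (auto simp: x_def field_simps)
  have "1 - \<delta> * x = (n + \<beta>) / (n + 1)" "1 - x = n / (n + 1)"
    using n by (simp_all add: x_def \<delta>_def field_simps)
  then have "(1 - \<delta> * x) / (1 - x) = (n + \<beta>) / n" using n by simp
  then have eq: "1 + \<beta> / n = (1 - \<delta> * x) / (1 - x)"
    using n by (simp add: add_divide_distrib)
  have pw: "real n powr (2 - s) = (1 - x) powr (2 - s) * (real n + 1) powr (2 - s)"
    using x n by (subst nx) (simp add: powr_mult)
  have pw2: "(1 - x)\<^sup>2 = (1 - x) powr (2 - s) * (1 - x) powr s"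
    using x by (simp flip: powr_add add: powr_realpow)
  define P where "P = 2 / \<delta> * (real n + 1) powr (2 - s)"
  have P: "P \<ge> 0" using d by (simp add: P_def)
  have "v n \<le> 2 / \<delta> * real n powr (2 - s)" using step.IH by (simp add: s_def)
  then have "v (Suc n) \<le> (1 + \<beta> / n)\<^sup>2 * (2 / \<delta> * real n powr (2 - s)) + 1"
    unfolding v_Suc[OF step.hyps(1)] by (intro add_right_mono mult_left_mono) auto
  also have "(1 + \<beta> / n)\<^sup>2 * (2 / \<delta> * real n powr (2 - s)) = P * ((1 - \<delta> * x)\<^sup>2 / (1 - x) powr s)"
    unfolding eq power_divide pw pw2 P_def using x by (simp add: field_simps)
  finally have 1: "v (Suc n) \<le> P * ((1 - \<delta> * x)\<^sup>2 / (1 - x) powr s) + 1" .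
  have dx: "\<delta> * x \<le> 1 * (1/2)" using x d by (intro mult_mono) auto
  \<comment> \<open>One factor \<open>1 - \<delta> * x\<close> pays for the exponent
    \<open>s\<close>; the other remains, and its gain \<open>P * (\<delta> * x)\<close>, which is at
    least 2, absorbs the added 1.\<close>
  have "1 - \<delta> * x \<le> (1 - x) powr s"
    using one_minus_powr_ge[of x s] x d by (simp add: s_def)
  then have "(1 - \<delta> * x) * (1 - \<delta> * x) \<le> (1 - \<delta> * x) * (1 - x) powr s"
    using dx by (intro mult_left_mono) auto
  then have "(1 - \<delta> * x)\<^sup>2 / (1 - x) powr s \<le> 1 - \<delta> * x"
    using x by (simp add: pos_divide_le_eq power2_eq_square)
  then have 2: "P * ((1 - \<delta> * x)\<^sup>2 / (1 - x) powr s) \<le> P * (1 - \<delta> * x)"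
    using P by (rule mult_left_mono)
  have "(real n + 1) powr (2 - s) = (real n + 1) powr (1 - s) * (real n + 1)"
    using powr_add[of "real n + 1" "1 - s" 1] n by simp
  then have "P * (\<delta> * x) = 2 * (real n + 1) powr (1 - s)"
    using n d by (simp add: x_def P_def)
  moreover have "1 \<le> (real n + 1) powr (1 - s)" using n d by (intro ge_one_powr_ge_zero) (auto simp: s_def)
  ultimately have "P * (1 - \<delta> * x) + 1 \<le> P" by (simp add: algebra_simps)
  with 1 2 have "v (Suc n) \<le> P" by linarith
  then show ?case by (simp add: P_def s_def add.commute)
qed

section \<open>Exponential moments and almost sure convergence of averages\<close>

context path_process
begin

lemma AE_eventually_not:
  assumes "\<And>n::nat. {x \<in> space M. P n x} \<in> events" "summable (\<lambda>n. prob {x \<in> space M. P n x})"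
  shows "AE x in M. \<forall>\<^sub>F n in sequentially. \<not> P n x"
proof -
  have "AE x in M. \<forall>\<^sub>F n in sequentially. x \<in> space M - {x \<in> space M. P n x}"
    by (rule borel_cantelli_AE1) (use assms in \<open>auto simp: emeasure_eq_measure\<close>)
  then show ?thesis by (rule AE_mp) (auto elim!: eventually_mono)
qed

lemma integral_history_mono:
  fixes h h' :: "real list \<Rightarrow> real"
  assumes "\<And>xs. set xs \<subseteq> D \<Longrightarrow> length xs = n \<Longrightarrow> h xs \<le> h' xs"
  shows "(\<integral>x. h (history n x) \<partial>M) \<le> (\<integral>x. h' (history n x) \<partial>M)"
  by (intro integral_mono_AE integrable_history) (auto intro!: AE_I2 assms set_history)

lemma chernoff:
  fixes \<mu> :: real
  assumes "\<mu> \<ge> 0"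
  shows "prob {x \<in> space M. a \<le> Z (history n x)}
    \<le> exp (- \<mu> * a) * (\<integral>x. exp (\<mu> * Z (history n x)) \<partial>M)"
proof -
  have "prob {x \<in> space M. a \<le> Z (history n x)} = (\<integral>x. of_bool (a \<le> Z (history n x)) \<partial>M)"
    by (rule integral_of_bool[symmetric])
  also have "\<dots> \<le> (\<integral>x. exp (- \<mu> * a) * exp (\<mu> * Z (history n x)) \<partial>M)"
    by (rule integral_history_mono) (use assms in \<open>auto simp: mult_left_mono simp flip: exp_add\<close>)
  finally show ?thesis by simp
qed

lemma sum_trans_exp_le:
  assumes xs: "set xs \<subseteq> D" and d: "\<And>v. v \<in> D \<Longrightarrow> \<bar>d v\<bar> \<le> c" "(\<Sum>v\<in>D. trans xs v * d v) = 0"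
  shows "(\<Sum>v\<in>D. trans xs v * exp (\<mu> * d v)) \<le> exp (\<mu>\<^sup>2 * c\<^sup>2)"
proof -
  have "(\<Sum>v\<in>D. trans xs v * exp (\<mu> * d v))
      \<le> (\<Sum>v\<in>D. trans xs v * (\<mu> * d v + exp (\<mu>\<^sup>2 * c\<^sup>2)))"
  proof (intro sum_mono mult_left_mono)
    fix v assume v: "v \<in> D"
    have "(d v)\<^sup>2 \<le> c\<^sup>2" using d(1)[OF v] by (simp add: abs_le_square_iff[symmetric])
    then have "exp ((\<mu> * d v)\<^sup>2) \<le> exp (\<mu>\<^sup>2 * c\<^sup>2)" by (simp add: power_mult_distrib mult_left_mono)
    then show "exp (\<mu> * d v) \<le> \<mu> * d v + exp (\<mu>\<^sup>2 * c\<^sup>2)"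
      using exp_le_id_plus_exp_square[of "\<mu> * d v"] by linarith
  qed (use xs trans_nonneg in auto)
  also have "\<dots> = \<mu> * (\<Sum>v\<in>D. trans xs v * d v) + exp (\<mu>\<^sup>2 * c\<^sup>2) * (\<Sum>v\<in>D. trans xs v)"
    by (simp add: distrib_left sum.distrib sum_distrib_left sum_distrib_right algebra_simps)
  finally show ?thesis using d(2) trans_sum[OF xs] by simp
qed

text \<open>With \<open>k\<close> the fixed point of the affine drift, the deviation
  \<open>Z\<close> from \<open>k * n\<close> is multiplied by \<open>1 + \<beta> / n\<close> and
  receives centred noise bounded by 2. One step thus turns the exponential moment at \<mu> into the
  one at \<open>\<mu> * (1 + \<beta> / n)\<close>, so the induction has to treat all \<mu>
  simultaneously. The resulting tails are of order \<open>exp (- const * n powr s)\<close>, summable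
  over all \<open>n\<close>.\<close>

lemma reinforced_lln:
  fixes W :: "real list \<Rightarrow> real" and f :: "real \<Rightarrow> real"
  assumes W: "\<And>xs v. set xs \<subseteq> D \<Longrightarrow> v \<in> D \<Longrightarrow> W (xs @ [v]) = W xs + f v"
    and f: "\<And>v. v \<in> D \<Longrightarrow> \<bar>f v\<bar> \<le> 1" and \<beta>: "0 \<le> \<beta>" "\<beta> < 1"
    and mean: "\<And>xs. set xs \<subseteq> D \<Longrightarrow> xs \<noteq> [] \<Longrightarrow>
      (\<Sum>v\<in>D. trans xs v * f v) = \<beta> * W xs / length xs + \<kappa>"
  shows "AE x in M. (\<lambda>n. W (history n x) / n) \<longlonglongrightarrow> \<kappa> / (1 - \<beta>)"
proof -
  define k where "k = \<kappa> / (1 - \<beta>)"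
  have "k * (1 - \<beta>) = \<kappa>" using \<beta> by (simp add: k_def)
  then have k: "k = \<kappa> + \<beta> * k" by (simp add: algebra_simps)
  define Z where "Z xs = W xs - k * length xs" for xs
  define v where "v = rec_nat 0 (\<lambda>n y. (1 + \<beta> / real n)\<^sup>2 * y + 1)"
  have v1: "v 1 = 1" and v_Suc: "v (Suc n) = (1 + \<beta> / real n)\<^sup>2 * v n + 1" for n
    by (simp_all add: v_def)
  define s where "s = (1 - \<beta>) / 2"
  define A where "A = 2 / (1 - \<beta>)"
  have sA: "s > 0" "A > 0" using \<beta> by (auto simp: s_def A_def)
  have vA: "v n \<le> A * real n powr (2 - s)" if "n \<ge> 1" for n
    using reinforced_variance_le[OF \<beta> v1 v_Suc that] by (simp add: s_def A_def)
  \<comment> \<open>The drift formula concerns nonempty paths, so the induction starts at length 1,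
    where \<open>C\<close> bounds the absolute value of \<open>Z\<close> directly.\<close>
  define C where "C = \<bar>W []\<bar> + 1 + \<bar>k\<bar>"
  have mgf: "(\<integral>x. exp (\<mu> * Z (history n x)) \<partial>M) \<le> exp (C\<^sup>2) * exp (4 * \<mu>\<^sup>2 * v n)"
    if "n \<ge> 1" for n \<mu>
    using that
  proof (induction n arbitrary: \<mu> rule: dec_induct)
    case base
    have "(\<integral>x. exp (\<mu> * Z (history 1 x)) \<partial>M) \<le> (\<integral>x. exp (C\<^sup>2) * exp (4 * \<mu>\<^sup>2) \<partial>M)"
    proof (rule integral_history_mono[of 1 _ "\<lambda>_. exp (C\<^sup>2) * exp (4 * \<mu>\<^sup>2)"])
      fix xs assume xs: "set xs \<subseteq> D" "length xs = 1"
      then obtain w where w: "xs = [] @ [w]" "w \<in> D" by (cases xs) auto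
      have "\<bar>Z xs\<bar> \<le> C" using W[of "[]" w] f[of w] w by (auto simp: Z_def C_def)
      then have "\<mu> * Z xs \<le> \<bar>\<mu>\<bar> * C"
        using mult_left_mono[of "\<bar>Z xs\<bar>" C "\<bar>\<mu>\<bar>"] abs_ge_self[of "\<mu> * Z xs"] by (simp add: abs_mult)
      also have "\<dots> \<le> C\<^sup>2 + 4 * \<mu>\<^sup>2"
        using sum_squares_bound[of "\<bar>\<mu>\<bar>" C] zero_le_power2[of C] zero_le_power2[of \<mu>]
        unfolding power2_abs by linarith
      finally show "exp (\<mu> * Z xs) \<le> exp (C\<^sup>2) * exp (4 * \<mu>\<^sup>2)" by (simp flip: exp_add)
    qed
    then show ?case by (simp add: v1[simplified] prob_space)
  next
    case (step n)
    have "(\<integral>x. exp (\<mu> * Z (history (Suc n) x)) \<partial>M)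
        = (\<integral>x. step (\<lambda>ys. exp (\<mu> * Z ys)) (history n x) \<partial>M)"
      by (rule integral_step)
    also have "\<dots> \<le> (\<integral>x. exp (4 * \<mu>\<^sup>2) * exp (\<mu> * (1 + \<beta> / n) * Z (history n x)) \<partial>M)"
    proof (rule integral_history_mono)
      fix xs assume xs: "set xs \<subseteq> D" "length xs = n"
      define m where "m = \<beta> * W xs / n + \<kappa>"
      have m: "(\<Sum>v\<in>D. trans xs v * f v) = m"
        using mean[OF xs(1)] xs(2) step.hyps(1) by (force simp: m_def)
      have "\<bar>m\<bar> \<le> (\<Sum>v\<in>D. trans xs v * 1)"
        unfolding m[symmetric] using xs f trans_nonneg
        by (intro order.trans[OF sum_abs] sum_mono) (auto simp: abs_mult intro!: mult_left_le)
      then have m1: "\<bar>m\<bar> \<le> 1" using trans_sum xs by simp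
      have Z: "Z (xs @ [w]) = (1 + \<beta> / n) * Z xs + (f w - m)" if "w \<in> D" for w
      proof -
        have "\<beta> / n * (k * n) = \<beta> * k" using step.hyps by simp
        then have "(1 + \<beta> / n) * Z xs = W xs - k * n + \<beta> * W xs / n - \<beta> * k"
          using xs by (simp add: Z_def algebra_simps)
        then show ?thesis using W[of xs w] xs that k by (simp add: Z_def m_def algebra_simps)
      qed
      have "step (\<lambda>ys. exp (\<mu> * Z ys)) xs
          = exp (\<mu> * (1 + \<beta> / n) * Z xs) * (\<Sum>w\<in>D. trans xs w * exp (\<mu> * (f w - m)))"
        unfolding step_def sum_distrib_left
        by (intro sum.cong refl) (simp add: Z mult.assoc distrib_left exp_add)
      also have "\<dots> \<le> exp (\<mu> * (1 + \<beta> / n) * Z xs) * exp (\<mu>\<^sup>2 * 2\<^sup>2)"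
      proof (intro mult_left_mono sum_trans_exp_le)
        show "\<bar>f w - m\<bar> \<le> 2" if "w \<in> D" for w using f[OF that] m1 by linarith
        show "(\<Sum>w\<in>D. trans xs w * (f w - m)) = 0"
          using trans_sum xs m by (simp add: right_diff_distrib sum_subtractf flip: sum_distrib_right)
      qed (use xs in auto)
      finally show "step (\<lambda>ys. exp (\<mu> * Z ys)) xs
          \<le> exp (4 * \<mu>\<^sup>2) * exp (\<mu> * (1 + \<beta> / n) * Z xs)"
        by (simp add: mult_ac)
    qed
    also have "\<dots> = exp (4 * \<mu>\<^sup>2) * (\<integral>x. exp (\<mu> * (1 + \<beta> / n) * Z (history n x)) \<partial>M)"
      by simp
    also have "\<dots> \<le> exp (4 * \<mu>\<^sup>2) * (exp (C\<^sup>2) * exp (4 * (\<mu> * (1 + \<beta> / n))\<^sup>2 * v n))"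
      by (intro mult_left_mono step.IH) auto
    also have "\<dots> = exp (C\<^sup>2) * exp (4 * \<mu>\<^sup>2 * v (Suc n))"
    proof -
      have "4 * \<mu>\<^sup>2 + 4 * (\<mu> * (1 + \<beta> / n))\<^sup>2 * v n = 4 * \<mu>\<^sup>2 * v (Suc n)"
        unfolding v_Suc power_mult_distrib by (simp add: distrib_left)
      then show ?thesis by (metis exp_add mult.left_commute)
    qed
    finally show ?case .
  qed
  have tail: "prob {x \<in> space M. \<epsilon> * real n \<le> \<bar>Z (history n x)\<bar>}
      \<le> 2 * exp (C\<^sup>2) * exp (- (\<epsilon>\<^sup>2 / (16 * A)) * real n powr s)" if n: "n \<ge> 1" and e: "\<epsilon> > 0" for n \<epsilon>
  proof -
    \<comment> \<open>Minimiser of the Chernoff exponent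
      \<open>4 * \<mu>^2 * A * n powr (2 - s) - \<mu> * \<epsilon> * n\<close>.\<close>
    define \<mu> where "\<mu> = \<epsilon> * real n powr (s - 1) / (8 * A)"
    have l0: "\<mu> \<ge> 0" using e sA by (simp add: \<mu>_def)
    have p2: "(real n powr (s - 1))\<^sup>2 * real n powr (2 - s) = real n powr s"
      using n by (simp add: power2_eq_square flip: powr_add)
    have "4 * \<mu>\<^sup>2 * v n \<le> 4 * \<mu>\<^sup>2 * (A * real n powr (2 - s))"
      by (intro mult_left_mono vA n) auto
    also have "\<dots> = \<epsilon>\<^sup>2 / (16 * A) * ((real n powr (s - 1))\<^sup>2 * real n powr (2 - s))"
      using sA by (simp add: \<mu>_def power2_eq_square field_simps)
    finally have q1: "4 * \<mu>\<^sup>2 * v n \<le> \<epsilon>\<^sup>2 / (16 * A) * real n powr s" by (simp only: p2)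
    have "real n powr (s - 1) * real n = real n powr s"
      using n powr_add[of "real n" "s - 1" 1] by simp
    then have q2: "\<mu> * (\<epsilon> * n) = 2 * (\<epsilon>\<^sup>2 / (16 * A) * real n powr s)"
      using sA by (simp add: \<mu>_def power2_eq_square field_simps)
    have one: "prob {x \<in> space M. \<epsilon> * real n \<le> Y (history n x)}
        \<le> exp (C\<^sup>2) * exp (- (\<epsilon>\<^sup>2 / (16 * A)) * real n powr s)"
      if Y: "\<And>\<mu>. (\<integral>x. exp (\<mu> * Y (history n x)) \<partial>M) \<le> exp (C\<^sup>2) * exp (4 * \<mu>\<^sup>2 * v n)" for Y
    proof -
      have "prob {x \<in> space M. \<epsilon> * real n \<le> Y (history n x)}
          \<le> exp (- \<mu> * (\<epsilon> * n)) * (exp (C\<^sup>2) * exp (4 * \<mu>\<^sup>2 * v n))"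
        by (rule order.trans[OF chernoff[OF l0]]) (intro mult_left_mono Y, simp)
      also have "\<dots> = exp (C\<^sup>2) * exp (4 * \<mu>\<^sup>2 * v n - \<mu> * (\<epsilon> * n))"
        by (simp add: exp_diff exp_minus field_simps)
      also have "\<dots> \<le> exp (C\<^sup>2) * exp (- (\<epsilon>\<^sup>2 / (16 * A)) * real n powr s)"
      proof -
        have "4 * \<mu>\<^sup>2 * v n - \<mu> * (\<epsilon> * n) \<le> - (\<epsilon>\<^sup>2 / (16 * A)) * real n powr s"
          unfolding q2 using q1 by linarith
        then show ?thesis by simp
      qed
      finally show ?thesis .
    qed
    have "{x \<in> space M. \<epsilon> * real n \<le> \<bar>Z (history n x)\<bar>}
        = {x \<in> space M. \<epsilon> * real n \<le> Z (history n x)} \<union> {x \<in> space M. \<epsilon> * real n \<le> - Z (history n x)}"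
      by auto
    then have "prob {x \<in> space M. \<epsilon> * real n \<le> \<bar>Z (history n x)\<bar>}
        \<le> prob {x \<in> space M. \<epsilon> * real n \<le> Z (history n x)}
          + prob {x \<in> space M. \<epsilon> * real n \<le> - Z (history n x)}"
      by (simp only:) (rule measure_Un_le;
        rule event_of_history[of "\<lambda>ys. \<epsilon> * real n \<le> Z ys"] event_of_history[of "\<lambda>ys. \<epsilon> * real n \<le> - Z ys"])
    moreover have "prob {x \<in> space M. \<epsilon> * real n \<le> Z (history n x)}
        \<le> exp (C\<^sup>2) * exp (- (\<epsilon>\<^sup>2 / (16 * A)) * real n powr s)"
      by (rule one) (rule mgf[OF n])
    moreover have "prob {x \<in> space M. \<epsilon> * real n \<le> - Z (history n x)}
        \<le> exp (C\<^sup>2) * exp (- (\<epsilon>\<^sup>2 / (16 * A)) * real n powr s)"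
    proof (rule one[of "\<lambda>ys. - Z ys"])
      show "(\<integral>x. exp (\<mu> * - Z (history n x)) \<partial>M) \<le> exp (C\<^sup>2) * exp (4 * \<mu>\<^sup>2 * v n)" for \<mu>
        using mgf[OF n, of "- \<mu>"] by simp
    qed
    ultimately show ?thesis by linarith
  qed
  have ev: "AE x in M. \<forall>\<^sub>F n in sequentially. \<not> \<epsilon> * real n \<le> \<bar>Z (history n x)\<bar>" if "\<epsilon> > 0" for \<epsilon>
  proof (rule AE_eventually_not)
    show "summable (\<lambda>n. prob {x \<in> space M. \<epsilon> * real n \<le> \<bar>Z (history n x)\<bar>})"
    proof (rule summable_comparison_test_ev)
      show "\<forall>\<^sub>F n in sequentially. norm (prob {x \<in> space M. \<epsilon> * real n \<le> \<bar>Z (history n x)\<bar>})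
          \<le> 2 * exp (C\<^sup>2) * exp (- (\<epsilon>\<^sup>2 / (16 * A)) * real n powr s)"
        using eventually_ge_at_top[of 1] by eventually_elim (use tail that in auto)
      show "summable (\<lambda>n. 2 * exp (C\<^sup>2) * exp (- (\<epsilon>\<^sup>2 / (16 * A)) * real n powr s))"
        by (intro summable_mult summable_exp_neg_powr) (use that sA in auto)
    qed
  qed (rule event_of_history)
  have "AE x in M. \<forall>k. \<forall>\<^sub>F n in sequentially. \<not> inverse (real (Suc k)) * real n \<le> \<bar>Z (history n x)\<bar>"
    unfolding AE_all_countable by (intro allI ev) simp
  then show ?thesis unfolding k_def[symmetric]
  proof (rule AE_mp, intro AE_I2 impI)
    fix x assume *: "\<forall>k. \<forall>\<^sub>F n in sequentially. \<not> inverse (real (Suc k)) * real n \<le> \<bar>Z (history n x)\<bar>"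
    have "(\<lambda>n. Z (history n x) / n) \<longlonglongrightarrow> 0"
    proof (rule tendstoI)
      fix e :: real assume "e > 0"
      then obtain k where k: "inverse (real (Suc k)) < e" using reals_Archimedean by blast
      from * have "\<forall>\<^sub>F n in sequentially. \<not> inverse (real (Suc k)) * real n \<le> \<bar>Z (history n x)\<bar>" by blast
      then show "\<forall>\<^sub>F n in sequentially. dist (Z (history n x) / n) 0 < e"
        using eventually_gt_at_top[of 0]
      proof eventually_elim
        case (elim n)
        then have "\<bar>Z (history n x)\<bar> / n < inverse (real (Suc k))"
          by (simp add: pos_divide_less_eq del: of_nat_Suc)
        then show ?case using k by simp
      qed
    qed
    then have lim: "(\<lambda>n. Z (history n x) / n + k) \<longlonglongrightarrow> k"
      using tendsto_add[of _ 0 sequentially "\<lambda>_. k" k] by simp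
    have "\<forall>\<^sub>F n in sequentially. Z (history n x) / n + k = W (history n x) / n"
      using eventually_gt_at_top[of 0] by eventually_elim (simp add: Z_def diff_divide_distrib)
    then show "(\<lambda>n. W (history n x) / n) \<longlonglongrightarrow> k"
      by (rule Lim_transform_eventually[OF lim])
  qed
qed

end

section \<open>Exponential moments of martingales\<close>

lemma exp_taylor2:
  fixes x :: real
  assumes "\<bar>x\<bar> \<le> 1"
  shows "\<bar>exp x - (1 + x + x\<^sup>2 / 2)\<bar> \<le> \<bar>x\<bar> ^ 3 / 2"
proof -
  obtain t where t: "\<bar>t\<bar> \<le> \<bar>x\<bar>" "exp x = (\<Sum>m<3. x ^ m / fact m) + exp t / fact 3 * x ^ 3"
    using Maclaurin_exp_le[of x 3] by blast
  have "exp t \<le> exp 1" using t(1) assms by simp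
  then have e: "exp t \<le> 3" using exp_le by linarith
  have "exp x - (1 + x + x\<^sup>2 / 2) = exp t / 6 * x ^ 3"
    unfolding t(2) by (simp add: eval_nat_numeral)
  then have "\<bar>exp x - (1 + x + x\<^sup>2 / 2)\<bar> = exp t / 6 * \<bar>x\<bar> ^ 3"
    by (simp only: abs_mult power_abs) simp
  also have "\<dots> \<le> 3 / 6 * \<bar>x\<bar> ^ 3" using e by (intro mult_right_mono) auto
  finally show ?thesis by simp
qed

text \<open>For arguments of size at most \<open>e\<close> the cubic remainder is at most
  \<open>e\<close> times the quadratic term; it merely perturbs the variance by a factor
  \<open>1 + e\<close> or \<open>1 - e\<close>.\<close>

lemma exp_quadratic_bounds:
  fixes x e :: real
  assumes "\<bar>x\<bar> \<le> e" "e \<le> 1"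
  shows "exp x \<le> 1 + x + (1 + e) * (x\<^sup>2 / 2)" "1 + x + (1 - e) * (x\<^sup>2 / 2) \<le> exp x"
proof -
  have "\<bar>x\<bar> ^ 3 = \<bar>x\<bar> * x\<^sup>2" by (simp add: eval_nat_numeral)
  also have "\<dots> \<le> e * x\<^sup>2" using assms by (intro mult_right_mono) auto
  finally have "\<bar>exp x - (1 + x + x\<^sup>2 / 2)\<bar> \<le> e * x\<^sup>2 / 2"
    using exp_taylor2[of x] assms by linarith
  then have "exp x - (1 + x + x\<^sup>2 / 2) \<le> e * x\<^sup>2 / 2" "- (e * x\<^sup>2 / 2) \<le> exp x - (1 + x + x\<^sup>2 / 2)"
    unfolding abs_le_iff by (auto simp only: minus_le_iff)
  moreover have "a \<le> 1 + x + (b + d) / 2" if "a - (1 + x + b / 2) \<le> d / 2" for a b d :: real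
    using that by argo
  moreover have "1 + x + (b - d) / 2 \<le> a" if "- (d / 2) \<le> a - (1 + x + b / 2)" for a b d :: real
    using that by argo
  ultimately show "exp x \<le> 1 + x + (1 + e) * (x\<^sup>2 / 2)" "1 + x + (1 - e) * (x\<^sup>2 / 2) \<le> exp x"
    by (simp_all only: distrib_right left_diff_distrib mult_1 times_divide_eq_right
      add_divide_distrib[symmetric] diff_divide_distrib[symmetric])
qed

text \<open>The iterated-logarithm normalisation in intrinsic time: the argument is an accumulated
  variance, not a number of steps.\<close>

definition lil_scale :: "real \<Rightarrow> real" where
  "lil_scale t = sqrt (2 * t * ln (ln t))"

lemma ln_ln_mono:
  fixes x y :: real
  assumes "exp 1 \<le> x" "x \<le> y"
  shows "0 \<le> ln (ln x)" "ln (ln x) \<le> ln (ln y)"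
proof -
  have "0 < x" using assms(1) exp_gt_zero[of "1::real"] by linarith
  then have "1 \<le> ln x" "ln x \<le> ln y" using assms by (auto simp: ln_ge_iff)
  then show "0 \<le> ln (ln x)" "ln (ln x) \<le> ln (ln y)" by auto
qed

lemma lil_scale_mono:
  assumes "exp 1 \<le> x" "x \<le> y"
  shows "lil_scale x \<le> lil_scale y"
proof -
  have "0 < x" using assms(1) exp_gt_zero[of "1::real"] by linarith
  then show ?thesis
    using ln_ln_mono[OF assms] assms unfolding lil_scale_def
    by (intro real_sqrt_le_mono mult_mono) auto
qed

lemma ex_power_between:
  fixes \<rho> y :: real
  assumes "\<rho> > 1" "\<rho> ^ K \<le> y"
  obtains k where "k \<ge> K" "\<rho> ^ k \<le> y" "y < \<rho> ^ Suc k"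
proof -
  define N where "N = (LEAST n. y < \<rho> ^ n)"
  have ex: "\<exists>n. y < \<rho> ^ n" using real_arch_pow[OF assms(1)] .
  have N: "y < \<rho> ^ N" unfolding N_def using ex by (rule LeastI_ex)
  have "\<rho> ^ K < \<rho> ^ N" using N assms by linarith
  then have "K < N" using assms(1) power_less_imp_less_exp by blast
  then obtain k where k: "N = Suc k" "K \<le> k" by (cases N) auto
  have "\<not> y < \<rho> ^ k" using k not_less_Least[of k "\<lambda>n. y < \<rho> ^ n"] by (simp add: N_def)
  then show ?thesis using that[of k] k N by auto
qed

section \<open>Hitting times, conditioning and a Borel-Cantelli lemma\<close>

context path_process
begin

lemma stopped_nonneg:
  fixes h :: "real list \<Rightarrow> real"
  assumes "set xs \<subseteq> D" "\<And>ys. 0 \<le> h ys"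
  shows "0 \<le> stopped S m h xs"
  using stopped_mono[where I = "\<lambda>ys. set ys \<subseteq> D" and h = "\<lambda>_. 0" and h' = h and xs = xs and S = S and m = m]
    stopped_const[OF assms(1), of S m "0::real"] assms by auto

lemma stopped_le_one:
  fixes h :: "real list \<Rightarrow> real"
  assumes "set xs \<subseteq> D" "\<And>ys. h ys \<le> 1"
  shows "stopped S m h xs \<le> 1"
  using stopped_mono[where I = "\<lambda>ys. set ys \<subseteq> D" and h = h and h' = "\<lambda>_. 1" and xs = xs and S = S and m = m]
    stopped_const[OF assms(1), of S m "1::real"] assms by auto

text \<open>If \<open>H\<close> holds at the path where \<open>S\<close> stops, or at the horizon,
  then \<open>H\<close> has been hit by then; halting at \<open>H\<close> instead can only raise the
  probability.\<close>

lemma stopped_le_hit: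
  assumes "set xs \<subseteq> D"
  shows "stopped S m (\<lambda>ys. of_bool (H ys) :: real) xs \<le> stopped H m (\<lambda>ys. of_bool (H ys)) xs"
  using assms
proof (induction m arbitrary: xs)
  case (Suc m)
  let ?h = "\<lambda>ys. of_bool (H ys) :: real"
  show ?case
  proof (cases "H xs")
    case True
    then show ?thesis using stopped_le_one[of xs ?h S "Suc m"] Suc.prems by simp
  next
    case H: False
    show ?thesis
    proof (cases "S xs")
      case True
      then show ?thesis using H stopped_nonneg[of xs ?h H "Suc m"] Suc.prems by simp
    next
      case False
      then show ?thesis using H Suc by (auto intro!: step_mono)
    qed
  qed
qed simp

text \<open>Taking out what is known: every path reached from \<open>xs\<close> has
  \<open>xs\<close> as its first \<open>n\<close> steps.\<close>

lemma iterate_mult_take: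
  fixes g h :: "real list \<Rightarrow> real"
  assumes "set xs \<subseteq> D" "length xs = n"
  shows "iterate m (\<lambda>ys. g (take n ys) * h ys) xs = g xs * iterate m h xs"
proof -
  have "iterate m (\<lambda>ys. g (take n ys) * h ys) xs = iterate m (\<lambda>ys. g xs * h ys) xs"
    by (rule stopped_cong[where I = "\<lambda>ys. set ys \<subseteq> D \<and> n \<le> length ys \<and> take n ys = xs"])
      (use assms in auto)
  then show ?thesis by (simp add: stopped_mult)
qed

text \<open>A conditional second Borel--Cantelli lemma, with conditional probabilities bounded below
  uniformly over all pasts.\<close>

lemma AE_frequently_block:
  fixes R :: "nat \<Rightarrow> real list \<Rightarrow> bool" and n :: "nat \<Rightarrow> nat" and q :: "nat \<Rightarrow> real"
  assumes mono: "mono n" and q0: "\<And>k. k \<ge> K \<Longrightarrow> 0 \<le> q k" and q: "\<not> summable q"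
    and R: "\<And>k xs. k \<ge> K \<Longrightarrow> set xs \<subseteq> D \<Longrightarrow> length xs = n k \<Longrightarrow>
      q k \<le> iterate (n (Suc k) - n k) (\<lambda>ys. of_bool (R k ys)) xs"
  shows "AE x in M. \<exists>\<^sub>F k in sequentially. R k (history (n (Suc k)) x)"
proof -
  have one: "AE x in M. \<exists>k\<ge>K'. R k (history (n (Suc k)) x)" if K': "K' \<ge> K" for K'
  proof -
    \<comment> \<open>No success in the first \<open>N\<close> blocks from \<open>K'\<close> on. The
      ends of these blocks are prefixes of one path, so this is a condition on a single
      history.\<close>
    define F where "F N ys \<longleftrightarrow> (\<forall>k. K' \<le> k \<and> k < K' + N \<longrightarrow> \<not> R k (take (n (Suc k)) ys))" for N ys
    have P: "prob {x \<in> space M. F N (history (n (K' + N)) x)} \<le> exp (- (\<Sum>k<N. q (K' + k)))" for N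
    proof (induction N)
      case 0
      then show ?case by (simp add: F_def)
    next
      case (Suc N)
      let ?a = "n (K' + N)" and ?b = "n (K' + Suc N)"
      let ?m = "?b - ?a"
      have ab: "?a + ?m = ?b" using monoD[OF mono, of "K' + N" "K' + Suc N"] by simp
      have Fs: "(of_bool (F (Suc N) ys) :: real)
          = of_bool (F N (take ?a ys)) * (1 - of_bool (R (K' + N) ys))" if "length ys = ?b" for ys
      proof -
        have "take (n (Suc k)) (take ?a ys) = take (n (Suc k)) ys" if "k < K' + N" for k
          using that monoD[OF mono, of "Suc k" "K' + N"] by (simp add: min_absorb1)
        then have "F N (take ?a ys) = F N ys" by (auto simp: F_def)
        moreover have "F (Suc N) ys \<longleftrightarrow> F N ys \<and> \<not> R (K' + N) (take (n (Suc (K' + N))) ys)"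
          unfolding F_def by (auto simp: less_Suc_eq)
        moreover have "take (n (Suc (K' + N))) ys = ys" using that by simp
        ultimately show ?thesis by auto
      qed
      have "prob {x \<in> space M. F (Suc N) (history ?b x)} = (\<integral>x. of_bool (F (Suc N) (history ?b x)) \<partial>M)"
        by (rule integral_of_bool[symmetric])
      also have "\<dots> = (\<integral>x. of_bool (F N (take ?a (history (?a + ?m) x))) * (1 - of_bool (R (K' + N) (history (?a + ?m) x))) \<partial>M)"
        unfolding ab by (simp add: Fs)
      also have "\<dots> = (\<integral>x. iterate ?m (\<lambda>ys. of_bool (F N (take ?a ys)) * (1 - of_bool (R (K' + N) ys))) (history ?a x) \<partial>M)"
        by (rule integral_iterate)
      also have "\<dots> \<le> (\<integral>x. exp (- q (K' + N)) * of_bool (F N (history ?a x)) \<partial>M)"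
      proof (rule integral_history_mono)
        fix xs assume xs: "set xs \<subseteq> D" "length xs = ?a"
        have "iterate ?m (\<lambda>ys. 1 + (-1) * of_bool (R (K' + N) ys)) xs
            = 1 - iterate ?m (\<lambda>ys. of_bool (R (K' + N) ys) :: real) xs"
          unfolding stopped_add stopped_mult stopped_const[OF xs(1)] by simp
        also have "\<dots> \<le> 1 - q (K' + N)" using R[of "K' + N" xs] K' xs by simp
        also have "\<dots> \<le> exp (- q (K' + N))" using exp_ge_add_one_self[of "- q (K' + N)"] by simp
        finally have "iterate ?m (\<lambda>ys. 1 - of_bool (R (K' + N) ys)) xs \<le> exp (- q (K' + N))" by simp
        then have "of_bool (F N xs) * iterate ?m (\<lambda>ys. 1 - of_bool (R (K' + N) ys)) xs
            \<le> of_bool (F N xs) * exp (- q (K' + N))"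
          by (rule mult_left_mono) simp
        then show "iterate ?m (\<lambda>ys. of_bool (F N (take ?a ys)) * (1 - of_bool (R (K' + N) ys))) xs
            \<le> exp (- q (K' + N)) * of_bool (F N xs)"
          using iterate_mult_take[OF xs, of ?m "\<lambda>ys. of_bool (F N ys)" "\<lambda>ys. 1 - of_bool (R (K' + N) ys)"]
          by (simp add: mult.commute)
      qed
      also have "\<dots> = exp (- q (K' + N)) * prob {x \<in> space M. F N (history ?a x)}"
        using integral_of_bool[of "F N" ?a] by simp
      also have "\<dots> \<le> exp (- q (K' + N)) * exp (- (\<Sum>k<N. q (K' + k)))"
        by (intro mult_left_mono Suc.IH) auto
      finally show ?case by (simp add: algebra_simps flip: exp_add)
    qed
    have ev: "{x \<in> space M. R k (history (n (Suc k)) x)} \<in> events" for k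
      by (rule event_of_history)
    let ?B = "{x \<in> space M. \<forall>k\<ge>K'. \<not> R k (history (n (Suc k)) x)}"
    have "?B = space M - (\<Union>k\<in>{K'..}. {x \<in> space M. R k (history (n (Suc k)) x)})" by auto
    also have "\<dots> \<in> events" using ev by (intro sets.Diff sets.countable_UN) auto
    finally have B: "?B \<in> events" .
    have BN: "prob ?B \<le> exp (- (\<Sum>k<N. q (K' + k)))" for N
    proof -
      have "?B \<subseteq> {x \<in> space M. F N (history (n (K' + N)) x)}"
      proof safe
        fix x assume x: "\<forall>k\<ge>K'. \<not> R k (history (n (Suc k)) x)"
        have "take (n (Suc k)) (history (n (K' + N)) x) = history (n (Suc k)) x" if "k < K' + N" for k
          using that monoD[OF mono, of "Suc k" "K' + N"] by (simp add: take_history)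
        then show "F N (history (n (K' + N)) x)" using x by (auto simp: F_def)
      qed
      then have "prob ?B \<le> prob {x \<in> space M. F N (history (n (K' + N)) x)}"
        by (intro finite_measure_mono event_of_history)
      then show ?thesis using P[of N] by linarith
    qed
    \<comment> \<open>A positive value of \<open>prob ?B\<close> would bound all partial sums of
      \<open>q\<close>, against its divergence.\<close>
    have "prob ?B \<le> 0"
    proof (rule ccontr)
      assume "\<not> prob ?B \<le> 0"
      then have pos: "prob ?B > 0" by simp
      have bd: "(\<Sum>k<N. q (K' + k)) \<le> - ln (prob ?B)" for N
      proof -
        have "ln (prob ?B) \<le> ln (exp (- (\<Sum>k<N. q (K' + k))))"
          using BN[of N] pos by (intro ln_mono) auto
        then show ?thesis by simp
      qed
      have "summable (\<lambda>k. q (K' + k))"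
        by (rule bounded_imp_summable[where B = "- ln (prob ?B)"])
          (use q0 K' bd[of "Suc _"] in \<open>auto simp flip: lessThan_Suc_atMost\<close>)
      then have "summable q" using summable_iff_shift[of q K'] by (simp add: add.commute)
      with q show False by simp
    qed
    then have "prob ?B = 0" using measure_nonneg[of M ?B] by linarith
    then have "AE x in M. x \<notin> ?B" using prob_eq_0[OF B] by simp
    then show ?thesis by (rule AE_mp) auto
  qed
  have "AE x in M. \<forall>i. \<exists>k\<ge>K + i. R k (history (n (Suc k)) x)"
    unfolding AE_all_countable by (intro allI one) simp
  then show ?thesis
  proof (rule AE_mp, intro AE_I2 impI)
    fix x assume x: "\<forall>i. \<exists>k\<ge>K + i. R k (history (n (Suc k)) x)"
    show "\<exists>\<^sub>F k in sequentially. R k (history (n (Suc k)) x)"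
      unfolding frequently_sequentially using x by (meson add_leD2)
  qed
qed

end

section \<open>Martingales with bounded increments and their exponentials\<close>

locale path_martingale = path_process +
  fixes mart qvar :: "real list \<Rightarrow> real" and c :: real
  assumes c_nonneg: "0 \<le> c"
    and mart_Nil: "mart [] = 0" and qvar_Nil: "qvar [] = 0"
    and incr_bound: "\<And>xs v. set xs \<subseteq> D \<Longrightarrow> v \<in> D \<Longrightarrow> \<bar>mart (xs @ [v]) - mart xs\<bar> \<le> c"
    and incr_mean: "\<And>xs. set xs \<subseteq> D \<Longrightarrow> (\<Sum>v\<in>D. trans xs v * (mart (xs @ [v]) - mart xs)) = 0"
    and qvar_snoc: "\<And>xs v. set xs \<subseteq> D \<Longrightarrow> v \<in> D \<Longrightarrow>
      qvar (xs @ [v]) = qvar xs + (\<Sum>w\<in>D. trans xs w * (mart (xs @ [w]) - mart xs)\<^sup>2)"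
begin

text \<open>The conditional variance of the next increment. It is determined by \<open>xs\<close>
  alone, which makes \<open>qvar\<close> the predictable quadratic variation.\<close>

definition cvar :: "real list \<Rightarrow> real" where
  "cvar xs = (\<Sum>w\<in>D. trans xs w * (mart (xs @ [w]) - mart xs)\<^sup>2)"

lemma qvar_snoc': "set xs \<subseteq> D \<Longrightarrow> v \<in> D \<Longrightarrow> qvar (xs @ [v]) = qvar xs + cvar xs"
  by (simp add: qvar_snoc cvar_def)

lemma sq_incr_le: "set xs \<subseteq> D \<Longrightarrow> v \<in> D \<Longrightarrow> (mart (xs @ [v]) - mart xs)\<^sup>2 \<le> c\<^sup>2"
  using incr_bound[of xs v] c_nonneg by (simp add: abs_le_square_iff[symmetric])

lemma cvar_bounds:
  assumes "set xs \<subseteq> D"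
  shows "0 \<le> cvar xs" "cvar xs \<le> c\<^sup>2"
proof -
  show "0 \<le> cvar xs" unfolding cvar_def using assms trans_nonneg by (auto intro!: sum_nonneg)
  have "cvar xs \<le> (\<Sum>w\<in>D. trans xs w * c\<^sup>2)"
    unfolding cvar_def by (intro sum_mono mult_left_mono sq_incr_le trans_nonneg assms)
  then show "cvar xs \<le> c\<^sup>2" using trans_sum[OF assms] by (simp flip: sum_distrib_right)
qed

lemma step_exp_mart:
  assumes xs: "set xs \<subseteq> D"
  shows "step (\<lambda>ys. exp (t * mart ys - s * qvar ys)) xs
    = exp (t * mart xs - s * qvar xs) * (exp (- s * cvar xs)
      * (\<Sum>v\<in>D. trans xs v * exp (t * (mart (xs @ [v]) - mart xs))))"
  unfolding step_def sum_distrib_left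
proof (rule sum.cong[OF refl])
  fix v assume v: "v \<in> D"
  have "t * mart (xs @ [v]) - s * qvar (xs @ [v])
      = (t * mart xs - s * qvar xs) + (- s * cvar xs + t * (mart (xs @ [v]) - mart xs))"
    using qvar_snoc'[OF xs v] by (simp add: algebra_simps)
  then show "trans xs v *\<^sub>R exp (t * mart (xs @ [v]) - s * qvar (xs @ [v]))
    = exp (t * mart xs - s * qvar xs) * (exp (- s * cvar xs)
      * (trans xs v * exp (t * (mart (xs @ [v]) - mart xs))))"
    by (simp only: exp_add real_scaleR_def mult_ac)
qed

lemma sum_trans_quadratic:
  assumes xs: "set xs \<subseteq> D"
  shows "(\<Sum>v\<in>D. trans xs v * (1 + t * (mart (xs @ [v]) - mart xs) + a * ((t * (mart (xs @ [v]) - mart xs))\<^sup>2 / 2)))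
    = 1 + a * (t\<^sup>2 / 2 * cvar xs)"
proof -
  have "(\<Sum>v\<in>D. trans xs v * (1 + t * (mart (xs @ [v]) - mart xs) + a * ((t * (mart (xs @ [v]) - mart xs))\<^sup>2 / 2)))
    = (\<Sum>v\<in>D. trans xs v) + t * (\<Sum>v\<in>D. trans xs v * (mart (xs @ [v]) - mart xs)) + a * (t\<^sup>2 / 2 * cvar xs)"
    unfolding cvar_def sum_distrib_left sum.distrib[symmetric]
    by (intro sum.cong refl) (simp add: power_mult_distrib distrib_left)
  then show ?thesis using trans_sum[OF xs] incr_mean[OF xs] by simp
qed

lemma incr_scaled_le:
  assumes "set xs \<subseteq> D" "v \<in> D" "\<bar>t\<bar> * c \<le> e"
  shows "\<bar>t * (mart (xs @ [v]) - mart xs)\<bar> \<le> e"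
  using mult_left_mono[OF incr_bound[OF assms(1,2)], of "\<bar>t\<bar>"] assms(3) by (simp add: abs_mult)

text \<open>The factor \<open>1 + e\<close> in the compensator pays for the cubic Taylor term, so
  the supermartingale property is exact, with no error left to sum.\<close>

lemma step_exp_upper:
  assumes xs: "set xs \<subseteq> D" and e: "\<bar>t\<bar> * c \<le> e" "e \<le> 1"
  shows "step (\<lambda>ys. exp (t * mart ys - (1 + e) * t\<^sup>2 / 2 * qvar ys)) xs
    \<le> exp (t * mart xs - (1 + e) * t\<^sup>2 / 2 * qvar xs)"
proof -
  have "(\<Sum>v\<in>D. trans xs v * exp (t * (mart (xs @ [v]) - mart xs)))
    \<le> 1 + (1 + e) * (t\<^sup>2 / 2 * cvar xs)"
    unfolding sum_trans_quadratic[OF xs, symmetric]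
    by (intro sum_mono mult_left_mono exp_quadratic_bounds incr_scaled_le trans_nonneg xs e)
  also have "\<dots> \<le> exp ((1 + e) * (t\<^sup>2 / 2 * cvar xs))" by (rule exp_ge_add_one_self)
  finally have "exp (- ((1 + e) * t\<^sup>2 / 2) * cvar xs) * (\<Sum>v\<in>D. trans xs v * exp (t * (mart (xs @ [v]) - mart xs)))
      \<le> exp (- ((1 + e) * t\<^sup>2 / 2) * cvar xs) * exp ((1 + e) * (t\<^sup>2 / 2 * cvar xs))"
    by (intro mult_left_mono) auto
  also have "\<dots> = 1" by (simp flip: exp_add)
  finally show ?thesis unfolding step_exp_mart[OF xs] by (simp add: mult_left_le)
qed

text \<open>There are two losses of \<open>e\<close>: one for the cubic Taylor term, one for passing
  from \<open>1 + (1 - e) * y\<close> back to an exponential. The second relies on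
  \<open>y \<le> e\<close>, a consequence of the increment bound.\<close>

lemma step_exp_lower:
  assumes xs: "set xs \<subseteq> D" and e: "\<bar>t\<bar> * c \<le> e" "e \<le> 1/2"
  shows "exp (t * mart xs - (1 - 2 * e) * t\<^sup>2 / 2 * qvar xs)
    \<le> step (\<lambda>ys. exp (t * mart ys - (1 - 2 * e) * t\<^sup>2 / 2 * qvar ys)) xs"
proof -
  have e0: "e \<ge> 0" using e(1) c_nonneg by (smt (verit) mult_nonneg_nonneg abs_ge_zero)
  define y where "y = t\<^sup>2 / 2 * cvar xs"
  have y0: "y \<ge> 0" using cvar_bounds[OF xs] by (simp add: y_def)
  have "y \<le> t\<^sup>2 / 2 * c\<^sup>2" unfolding y_def using cvar_bounds[OF xs] by (intro mult_left_mono) auto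
  also have "\<dots> = (\<bar>t\<bar> * c)\<^sup>2 / 2" by (simp add: power_mult_distrib)
  also have "\<dots> \<le> e\<^sup>2 / 2" using e c_nonneg by (intro divide_right_mono power_mono) auto
  also have "\<dots> \<le> e" using mult_left_mono[of e 1 e] e e0 by (simp add: power2_eq_square)
  finally have ye: "y \<le> e" .
  define z where "z = (1 - 2 * e) * y"
  have z: "0 \<le> z" "z \<le> y" using y0 e e0 by (auto simp: z_def mult_left_le_one_le)
  have "exp z \<le> 1 + z + z\<^sup>2" using z ye e by (intro exp_bound) auto
  also have "z\<^sup>2 \<le> e * y" unfolding power2_eq_square using z ye by (intro mult_mono) auto
  finally have "exp z \<le> 1 + (1 - e) * y" by (simp add: z_def algebra_simps)
  also have "\<dots> \<le> (\<Sum>v\<in>D. trans xs v * exp (t * (mart (xs @ [v]) - mart xs)))"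
    unfolding y_def sum_trans_quadratic[OF xs, symmetric]
    by (intro sum_mono mult_left_mono exp_quadratic_bounds incr_scaled_le trans_nonneg xs e) (use e in auto)
  finally have "exp (- z) * exp z \<le> exp (- z) * (\<Sum>v\<in>D. trans xs v * exp (t * (mart (xs @ [v]) - mart xs)))"
    by (intro mult_left_mono) auto
  then have "1 \<le> exp (- z) * (\<Sum>v\<in>D. trans xs v * exp (t * (mart (xs @ [v]) - mart xs)))"
    by (simp flip: exp_add)
  moreover have "- z = - ((1 - 2 * e) * t\<^sup>2 / 2) * cvar xs" by (simp add: z_def y_def)
  ultimately have "1 \<le> exp (- ((1 - 2 * e) * t\<^sup>2 / 2) * cvar xs) * (\<Sum>v\<in>D. trans xs v * exp (t * (mart (xs @ [v]) - mart xs)))"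
    by (simp only:)
  then have "exp (t * mart xs - (1 - 2 * e) * t\<^sup>2 / 2 * qvar xs) * 1 \<le> step (\<lambda>ys. exp (t * mart ys - (1 - 2 * e) * t\<^sup>2 / 2 * qvar ys)) xs"
    unfolding step_exp_mart[OF xs] by (rule mult_left_mono) simp
  then show ?thesis by simp
qed

end

section \<open>The law of the iterated logarithm\<close>

text \<open>\<open>t\<close> is the optimal exponential parameter for the level
  \<open>lil_scale u\<close> at variance \<open>u\<close>: at \<open>z = lil_scale u\<close> it
  maximises \<open>t * z - t^2 * u / 2\<close>, and the maximum is \<open>ln (ln u)\<close>. Along
  \<open>u = \<rho> ^ k\<close> the corresponding probabilities are therefore powers of
  \<open>k\<close>.\<close>

lemma lil_threshold:
  fixes u :: real
  assumes "u > 0" "ln (ln u) > 0"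
  defines "t \<equiv> sqrt (2 * ln (ln u) / u)"
  shows "t > 0" "t * u = lil_scale u" "ln (ln u) / t = lil_scale u / 2" "t\<^sup>2 * u = 2 * ln (ln u)"
proof -
  show t: "t > 0" using assms by (simp add: t_def)
  show sq: "t\<^sup>2 * u = 2 * ln (ln u)" using assms by (simp add: t_def)
  have "lil_scale u = sqrt ((t * u)\<^sup>2)"
    unfolding lil_scale_def using sq by (simp add: power_mult_distrib power2_eq_square mult_ac)
  then show tu: "t * u = lil_scale u" using t assms by simp
  have "ln (ln u) = t * (t * u) / 2" using sq by (simp add: power2_eq_square)
  then show "ln (ln u) / t = lil_scale u / 2" using t tu by simp
qed

lemma power_at_top: "filterlim (\<lambda>k. \<rho> ^ k) at_top sequentially" if "\<rho> > 1" for \<rho> :: real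
  using that by real_asymp

lemma lil_threshold_tendsto:
  fixes \<rho> :: real
  assumes "\<rho> > 1"
  shows "(\<lambda>k. sqrt (2 * ln (ln (\<rho> ^ k)) / \<rho> ^ k)) \<longlonglongrightarrow> 0"
    and "filterlim (\<lambda>k. ln (ln (\<rho> ^ k))) at_top sequentially"
proof -
  have p: "filterlim (\<lambda>k. \<rho> ^ k) at_top sequentially"
    using assms by (rule power_at_top)
  have "((\<lambda>u::real. sqrt (2 * ln (ln u) / u)) \<longlongrightarrow> 0) at_top" by real_asymp
  then show "(\<lambda>k. sqrt (2 * ln (ln (\<rho> ^ k)) / \<rho> ^ k)) \<longlonglongrightarrow> 0"
    using p by (rule filterlim_compose)
  have "filterlim (\<lambda>u::real. ln (ln u)) at_top at_top" by real_asymp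
  then show "filterlim (\<lambda>k. ln (ln (\<rho> ^ k))) at_top sequentially"
    using p by (rule filterlim_compose)
qed

section \<open>Upper half of the law of the iterated logarithm\<close>

context path_martingale
begin

lemma uminus_path_martingale: "path_martingale M X D trans (\<lambda>xs. - mart xs) qvar c"
proof
  show "\<bar>- mart (xs @ [v]) - - mart xs\<bar> \<le> c" if "set xs \<subseteq> D" "v \<in> D" for xs v
    using incr_bound[OF that] by (simp add: abs_minus_commute)
  show "(\<Sum>v\<in>D. trans xs v * (- mart (xs @ [v]) - - mart xs)) = 0" if "set xs \<subseteq> D" for xs
    using incr_mean[OF that] by (simp add: right_diff_distrib sum_subtractf)
  show "qvar (xs @ [v]) = qvar xs + (\<Sum>w\<in>D. trans xs w * (- mart (xs @ [w]) - - mart xs)\<^sup>2)"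
    if "set xs \<subseteq> D" "v \<in> D" for xs v
    using qvar_snoc[OF that] by (simp add: power2_commute)
qed (use c_nonneg mart_Nil qvar_Nil in auto)

text \<open>Blocks on which the predictable variance grows by a factor \<^term>\<open>1 + \<epsilon>\<close>: the maximal
  inequality for the exponential supermartingale needs no deterministic control of the variance.\<close>

lemma lil_upper:
  assumes qv: "AE x in M. filterlim (\<lambda>n. qvar (history n x)) at_top sequentially"
    and e: "0 < \<epsilon>" "\<epsilon> \<le> 1"
  shows "AE x in M. \<forall>\<^sub>F n in sequentially.
    mart (history n x) \<le> (1 + \<epsilon>)\<^sup>2 * lil_scale (qvar (history n x))"
proof -
  define \<rho> where "\<rho> = 1 + \<epsilon>"
  define L where "L k = ln (ln (\<rho> ^ k))" for k :: nat
  define t where "t k = sqrt (2 * L k / \<rho> ^ k)" for k :: nat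
  define G where "G k ys = exp (t k * mart ys - (1 + \<epsilon>) * (t k)\<^sup>2 / 2 * qvar ys)" for k ys
  \<comment> \<open>For \<open>k > 0\<close> the level equals
    \<open>(k * ln \<rho>) powr (1 + \<epsilon>)\<close>, whose reciprocals are summable.\<close>
  define E where "E k x \<longleftrightarrow> (\<exists>j. exp ((1 + \<epsilon>) * L k) \<le> G k (history j x))" for k x
  have \<rho>: "\<rho> > 1" using e by (simp add: \<rho>_def)
  have t0: "t \<longlonglongrightarrow> 0" and Linf: "filterlim L at_top sequentially"
    unfolding t_def L_def using lil_threshold_tendsto[OF \<rho>] by simp_all
  have "(\<lambda>k. \<bar>t k\<bar> * c) \<longlonglongrightarrow> 0" using t0 by (auto intro!: tendsto_eq_intros)
  then have tc: "\<forall>\<^sub>F k in sequentially. \<bar>t k\<bar> * c < \<epsilon>" using e by (intro order_tendstoD) auto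
  have Lpos: "\<forall>\<^sub>F k in sequentially. L k > 0"
    using Linf by (simp add: filterlim_at_top_dense)
  have Ek: "{x \<in> space M. E k x} \<in> events" for k
  proof -
    have "{x \<in> space M. E k x} = (\<Union>j. {x \<in> space M. exp ((1 + \<epsilon>) * L k) \<le> G k (history j x)})"
      by (auto simp: E_def)
    also have "\<dots> \<in> events" by (intro sets.countable_UN) (auto intro: event_of_history)
    finally show ?thesis .
  qed
  have bound: "prob {x \<in> space M. E k x} \<le> (real k * ln \<rho>) powr (- (1 + \<epsilon>))"
    if "\<bar>t k\<bar> * c < \<epsilon>" "L k > 0" "k > 0" for k
  proof -
    have "prob {x \<in> space M. E k x} \<le> G k [] / exp ((1 + \<epsilon>) * L k)"
      unfolding E_def
    proof (rule maximal_ineq)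
      fix ys assume "set ys \<subseteq> D"
      then show "step (G k) ys \<le> G k ys" unfolding G_def
        by (rule step_exp_upper) (use that e in auto)
    qed (simp_all add: G_def)
    also have "\<dots> = exp (- ((1 + \<epsilon>) * L k))"
      by (simp add: G_def mart_Nil qvar_Nil exp_minus inverse_eq_divide)
    also have "\<dots> = (real k * ln \<rho>) powr (- (1 + \<epsilon>))"
    proof -
      have "0 < real k * ln \<rho>" using that \<rho> by simp
      then show ?thesis using \<rho> that by (simp add: L_def powr_def ln_realpow minus_mult_left[symmetric] del: minus_add_distrib)
    qed
    finally show ?thesis .
  qed
  have "AE x in M. \<forall>\<^sub>F k in sequentially. \<not> E k x"
  proof (rule AE_eventually_not[OF Ek])
    show "summable (\<lambda>k. prob {x \<in> space M. E k x})"
    proof (rule summable_comparison_test_ev)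
      show "\<forall>\<^sub>F k in sequentially. norm (prob {x \<in> space M. E k x})
          \<le> (ln \<rho>) powr (- (1 + \<epsilon>)) * real k powr (- (1 + \<epsilon>))"
        using tc Lpos eventually_gt_at_top[of 0]
      proof eventually_elim
        case (elim k)
        then show ?case using bound[of k] \<rho> by (simp add: powr_mult mult.commute)
      qed
      show "summable (\<lambda>k. (ln \<rho>) powr (- (1 + \<epsilon>)) * real k powr (- (1 + \<epsilon>)))"
        using e by (intro summable_mult) (simp add: summable_real_powr_iff)
    qed
  qed
  then show ?thesis using qv
  proof (eventually_elim)
    case (elim x)
    have "\<forall>\<^sub>F k in sequentially. exp 1 \<le> \<rho> ^ k"
      using power_at_top[OF \<rho>] by (simp add: filterlim_at_top)
    then have "\<forall>\<^sub>F k in sequentially. \<not> E k x \<and> L k > 0 \<and> exp 1 \<le> \<rho> ^ k"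
      using elim(1) Lpos by eventually_elim auto
    then obtain K where K: "\<And>k. k \<ge> K \<Longrightarrow> \<not> E k x \<and> L k > 0 \<and> exp 1 \<le> \<rho> ^ k"
      unfolding eventually_sequentially by blast
    have "\<forall>\<^sub>F n in sequentially. \<rho> ^ K \<le> qvar (history n x)"
      using elim(2) by (simp add: filterlim_at_top)
    then show ?case
    proof eventually_elim
      case (elim n)
      define h where "h = history n x"
      obtain k where k: "k \<ge> K" "\<rho> ^ k \<le> qvar h" "qvar h < \<rho> ^ Suc k"
        using ex_power_between[OF \<rho> elim] unfolding h_def by blast
      have up: "\<rho> ^ k > 0" using \<rho> by simp
      note T = lil_threshold[of "\<rho> ^ k", folded L_def, folded t_def]
      have Lk: "L k > 0" using K k(1) by blast
      note T = T[OF up Lk]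
      have "G k h < exp ((1 + \<epsilon>) * L k)"
        using K[OF k(1)] unfolding E_def h_def not_ex not_le by blast
      \<comment> \<open>Outside \<open>E k\<close> the bound holds at every time; it is used while
        the variance is below \<open>\<rho> * \<rho> ^ k\<close>. The losses combine to
        \<open>(1 + \<epsilon>) * (\<rho> + 1) / 2\<close>, which is at most
        \<open>(1 + \<epsilon>)^2\<close>.\<close>
      then have "t k * mart h < (1 + \<epsilon>) * (t k)\<^sup>2 / 2 * qvar h + (1 + \<epsilon>) * L k"
        by (simp add: G_def)
      also have "\<dots> \<le> (1 + \<epsilon>) * (t k)\<^sup>2 / 2 * (\<rho> * \<rho> ^ k) + (1 + \<epsilon>) * L k"
        using k(3) e by (intro add_right_mono mult_left_mono) auto
      also have "\<dots> = (1 + \<epsilon>) / 2 * \<rho> * ((t k)\<^sup>2 * \<rho> ^ k) + (1 + \<epsilon>) * L k"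
        by (simp add: mult_ac)
      also have "\<dots> = (1 + \<epsilon>) * (\<rho> + 1) / 2 * (2 * L k)"
        unfolding T(4) by (simp add: algebra_simps)
      also have "\<dots> \<le> (1 + \<epsilon>) * (1 + \<epsilon>) * (2 * L k)"
        using Lk e by (intro mult_right_mono) (auto simp: \<rho>_def)
      also have "2 * L k = t k * lil_scale (\<rho> ^ k)"
        using T(3) T(1) by (simp add: field_simps)
      finally have "t k * mart h < t k * ((1 + \<epsilon>)\<^sup>2 * lil_scale (\<rho> ^ k))"
        by (simp add: power2_eq_square mult_ac)
      then have "mart h < (1 + \<epsilon>)\<^sup>2 * lil_scale (\<rho> ^ k)" using T(1) by simp
      also have "\<dots> \<le> (1 + \<epsilon>)\<^sup>2 * lil_scale (qvar h)"
        using K k by (intro mult_left_mono lil_scale_mono) auto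
      finally show ?case by (simp add: h_def)
    qed
  qed
qed

text \<open>Kolmogorov's lower exponential bound. For the increment \<open>d\<close> of the martingale up to the time its
  variance has grown by \<open>w\<close>, almost all of the mass of \<open>exp (t d)\<close> lies near \<open>d = t w\<close>, since the
  exponential moments at \<open>(1 - \<delta>) t\<close> and \<open>(1 + \<delta>) t\<close> bound the contribution of the rest.\<close>

lemma block_prob_lower:
  fixes \<delta> t u :: real and xs :: "real list"
  defines "e \<equiv> \<delta>\<^sup>2 / 28" and "w \<equiv> u - qvar xs"
  defines "H \<equiv> \<lambda>ys. u \<le> qvar ys \<and> qvar ys \<le> u + c\<^sup>2 \<and> (1 - \<delta>) * (t * w) \<le> mart ys - mart xs"
  assumes \<delta>: "0 < \<delta>" "\<delta> \<le> 1" and t: "t > 0" "2 * t * c \<le> e" and xs: "set xs \<subseteq> D"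
    and w: "0 < w" "c\<^sup>2 \<le> e * w" and y: "4 * exp (- (\<delta>\<^sup>2 / 4) * (t\<^sup>2 * w)) \<le> 1"
    and reach: "\<And>ys. set ys \<subseteq> D \<Longrightarrow> length ys = length xs + m \<Longrightarrow> u \<le> qvar ys"
  shows "exp (- (1 + 3 * \<delta>) * (t\<^sup>2 * w) / 2) / 2
    \<le> iterate m (\<lambda>ys. of_bool (\<exists>j\<le>length ys. length xs \<le> j \<and> H (take j ys))) xs"
proof -
  let ?S = "\<lambda>ys. u \<le> qvar ys"
  define E where "E = (\<lambda>h. stopped ?S m h xs :: real)"
  define Df where "Df ys = mart ys - mart xs" for ys
  define y where "y = t\<^sup>2 * w"
  have y0: "y \<ge> 0" using w by (simp add: y_def)
  have "\<delta>\<^sup>2 \<le> \<delta> * 1" unfolding power2_eq_square using \<delta> by (intro mult_left_mono) auto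
  \<comment> \<open>Origin of 28: the lower bound of the main term loses \<open>2 * e\<close>, and
    the tail bounds lose at most \<open>12 * e\<close>. Together this is
    \<open>14 * e = \<delta>^2 / 2\<close>, so half of the available gain \<open>\<delta>^2\<close>
    survives.\<close>
  then have e: "0 < e" "e \<le> 1/28" "28 * e = \<delta>\<^sup>2" "28 * e \<le> \<delta>" using \<delta> by (auto simp: e_def)
  \<comment> \<open>Before stopping, \<open>qvar\<close> is below \<open>u\<close>, and one step
    adds at most \<open>c^2\<close>; by \<open>reach\<close>, level \<open>u\<close> is also
    attained at the horizon. Integrands thus need comparing only where \<open>qvar\<close> lies
    between \<open>u\<close> and \<open>u + c^2\<close>.\<close>
  let ?I = "\<lambda>ys. set ys \<subseteq> D \<and> qvar ys \<le> u + c\<^sup>2"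
  have E_mono: "E h \<le> E h'" if "\<And>ys. u \<le> qvar ys \<Longrightarrow> qvar ys \<le> u + c\<^sup>2 \<Longrightarrow> h ys \<le> h' ys" for h h'
    unfolding E_def
  proof (rule stopped_mono[where I = ?I])
    show "?I xs" using xs w(1) by (simp add: w_def add_increasing2)
    show "?I (ys @ [v])" if "?I ys" "\<not> u \<le> qvar ys" "v \<in> D" for ys v
      using that qvar_snoc'[of ys v] cvar_bounds[of ys] by auto
    show "h ys \<le> h' ys" if "?I ys" "u \<le> qvar ys \<or> length ys = length xs + m" for ys
      using that reach[of ys] \<open>\<And>ys. u \<le> qvar ys \<Longrightarrow> qvar ys \<le> u + c\<^sup>2 \<Longrightarrow> h ys \<le> h' ys\<close> by auto
  qed auto
  have tce: "\<bar>t\<bar> * c \<le> e" using t c_nonneg e by simp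
  have lower: "exp ((1 - 2 * e) * y / 2) \<le> E (\<lambda>ys. exp (t * Df ys))"
  proof -
    define s where "s = (1 - 2 * e) * t\<^sup>2 / 2"
    have s0: "s \<ge> 0" using e by (simp add: s_def)
    have "exp (t * mart xs - s * qvar xs) \<le> E (\<lambda>ys. exp (t * mart ys - s * qvar ys))"
      unfolding E_def s_def by (rule stopped_submartingale[OF step_exp_lower]) (use tce e xs in auto)
    also have "\<dots> \<le> E (\<lambda>ys. exp (t * mart xs - s * u) * exp (t * Df ys))"
      by (rule E_mono) (use s0 in \<open>auto simp: Df_def right_diff_distrib intro: mult_left_mono simp flip: exp_add\<close>)
    also have "\<dots> = exp (t * mart xs - s * u) * E (\<lambda>ys. exp (t * Df ys))"
      unfolding E_def by (rule stopped_mult)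
    finally have "exp (- (t * mart xs - s * u)) * exp (t * mart xs - s * qvar xs)
      \<le> exp (- (t * mart xs - s * u)) * (exp (t * mart xs - s * u) * E (\<lambda>ys. exp (t * Df ys)))"
      by (intro mult_left_mono) auto
    also have "\<dots> = E (\<lambda>ys. exp (t * Df ys))"
      unfolding mult.assoc[symmetric] exp_add[symmetric] by simp
    also have "exp (- (t * mart xs - s * u)) * exp (t * mart xs - s * qvar xs) = exp (s * w)"
      unfolding exp_add[symmetric] by (simp add: w_def algebra_simps)
    also have "s * w = (1 - 2 * e) * y / 2" by (simp add: s_def y_def)
    finally show ?thesis .
  qed
  have upper: "E (\<lambda>ys. exp (r * t * Df ys)) \<le> exp ((1 + 3 * e) * r\<^sup>2 * y / 2)" if r: "0 \<le> r" "r \<le> 2" for r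
  proof -
    define s where "s = (1 + e) * (r * t)\<^sup>2 / 2"
    have s0: "s \<ge> 0" using e by (simp add: s_def)
    have "r * (t * c) \<le> 2 * (t * c)" using r t c_nonneg by (intro mult_right_mono mult_nonneg_nonneg) auto
    then have rtc: "\<bar>r * t\<bar> * c \<le> e" using t r by (simp only: abs_of_nonneg mult_nonneg_nonneg less_imp_le mult.assoc)
    have "E (\<lambda>ys. exp (r * t * Df ys)) \<le> E (\<lambda>ys. exp (s * (u + c\<^sup>2) - r * t * mart xs) * exp (r * t * mart ys - s * qvar ys))"
    proof (rule E_mono)
      fix ys assume "qvar ys \<le> u + c\<^sup>2"
      then have "s * qvar ys \<le> s * (u + c\<^sup>2)" using s0 by (rule mult_left_mono)
      then show "exp (r * t * Df ys) \<le> exp (s * (u + c\<^sup>2) - r * t * mart xs) * exp (r * t * mart ys - s * qvar ys)"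
        unfolding exp_add[symmetric] by (simp add: Df_def right_diff_distrib)
    qed
    also have "\<dots> = exp (s * (u + c\<^sup>2) - r * t * mart xs) * E (\<lambda>ys. exp (r * t * mart ys - s * qvar ys))"
      unfolding E_def by (rule stopped_mult)
    also have "\<dots> \<le> exp (s * (u + c\<^sup>2) - r * t * mart xs) * exp (r * t * mart xs - s * qvar xs)"
      unfolding E_def s_def
      by (intro mult_left_mono stopped_supermartingale[OF step_exp_upper]) (use rtc e xs in auto)
    also have "\<dots> = exp (s * (w + c\<^sup>2))" unfolding exp_add[symmetric] by (simp add: w_def algebra_simps)
    also have "\<dots> \<le> exp ((1 + 3 * e) * r\<^sup>2 * y / 2)"
    proof -
      have "s * (w + c\<^sup>2) \<le> s * ((1 + e) * w)" using w s0 by (intro mult_left_mono) (auto simp: algebra_simps)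
      also have "\<dots> = (1 + e) * (1 + e) * (r\<^sup>2 * y / 2)" by (simp add: s_def y_def power_mult_distrib)
      also have "\<dots> \<le> (1 + 3 * e) * (r\<^sup>2 * y / 2)"
      proof (rule mult_right_mono)
        show "(1 + e) * (1 + e) \<le> 1 + 3 * e" using e mult_left_mono[of e 1 e] by (simp add: algebra_simps)
      qed (use y0 in simp)
      finally show ?thesis by simp
    qed
    finally show ?thesis .
  qed
  \<comment> \<open>\<open>A\<close> and \<open>B\<close> are exponential Markov bounds, at the
    parameters \<open>(1 - \<delta>) * t\<close> and \<open>(1 + \<delta>) * t\<close>, for the
    parts where \<open>t * Df\<close> is below \<open>(1 - \<delta>) * y\<close> or above
    \<open>(1 + \<delta>) * y\<close>. \<open>C\<close> covers the window in between, where
    \<open>H\<close> holds.\<close>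
  define A where "A = (\<lambda>ys. exp (\<delta> * (1 - \<delta>) * y) * exp ((1 - \<delta>) * t * Df ys))"
  define B where "B = (\<lambda>ys. exp (- \<delta> * (1 + \<delta>) * y) * exp ((1 + \<delta>) * t * Df ys))"
  define C where "C = (\<lambda>ys. exp ((1 + \<delta>) * y) * of_bool (H ys))"
  have ptw: "exp (t * Df ys) \<le> (A ys + B ys) + C ys" if ys: "u \<le> qvar ys" "qvar ys \<le> u + c\<^sup>2" for ys
  proof -
    define d where "d = t * Df ys"
    have nn: "0 \<le> A ys" "0 \<le> B ys" "0 \<le> C ys" by (auto simp: A_def B_def C_def)
    have tt: "t * ((1 - \<delta>) * (t * w)) = (1 - \<delta>) * y" by (simp add: y_def power2_eq_square)
    consider "d < (1 - \<delta>) * y" | "(1 + \<delta>) * y < d" | "(1 - \<delta>) * y \<le> d" "d \<le> (1 + \<delta>) * y" by linarith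
    then show ?thesis
    proof cases
      case 1
      have "\<delta> * d \<le> \<delta> * ((1 - \<delta>) * y)" using 1 \<delta> by (intro mult_left_mono) auto
      then have "exp (t * Df ys) \<le> A ys"
        unfolding A_def exp_add[symmetric] by (simp add: d_def algebra_simps)
      then show ?thesis using nn by linarith
    next
      case 2
      have "\<delta> * ((1 + \<delta>) * y) \<le> \<delta> * d" using 2 \<delta> by (intro mult_left_mono) auto
      then have "exp (t * Df ys) \<le> B ys"
        unfolding B_def exp_add[symmetric] by (simp add: d_def algebra_simps)
      then show ?thesis using nn by linarith
    next
      case 3
      then have "t * ((1 - \<delta>) * (t * w)) \<le> t * Df ys" unfolding tt by (simp add: d_def)
      then have "H ys" using t ys by (simp add: H_def Df_def)
      then have "exp (t * Df ys) \<le> C ys" using 3 by (simp add: C_def d_def)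
      then show ?thesis using nn by linarith
    qed
  qed
  define Z where "Z = exp ((1 - 2 * e) * y / 2)"
  \<comment> \<open>The hypothesis \<open>y\<close> makes each of the two tails at most a quarter of
    the main term \<open>Z\<close>, so at least half of \<open>Z\<close> remains in the
    window.\<close>
  have quarter: "exp a \<le> Z / 4" if "a \<le> (1 - \<delta>\<^sup>2 + 12 * e) * y / 2" for a
  proof -
    have "(1 - \<delta>\<^sup>2 + 12 * e) * y / 2 = (1 - 2 * e) * y / 2 + (- (\<delta>\<^sup>2 / 4) * y)"
      unfolding e(3)[symmetric] by (simp add: field_simps)
    with that have "a \<le> (1 - 2 * e) * y / 2 + (- (\<delta>\<^sup>2 / 4) * y)" by linarith
    then have "exp a \<le> Z * exp (- (\<delta>\<^sup>2 / 4) * y)"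
      unfolding Z_def exp_add[symmetric] by (simp only: exp_le_cancel_iff)
    also have "\<dots> \<le> Z * (1/4)" using y unfolding y_def[symmetric] by (intro mult_left_mono) (auto simp: Z_def)
    finally show ?thesis by simp
  qed
  have EA: "E A \<le> Z / 4"
  proof -
    have "E A = exp (\<delta> * (1 - \<delta>) * y) * E (\<lambda>ys. exp ((1 - \<delta>) * t * Df ys))"
      unfolding A_def E_def by (rule stopped_mult)
    also have "\<dots> \<le> exp (\<delta> * (1 - \<delta>) * y) * exp ((1 + 3 * e) * (1 - \<delta>)\<^sup>2 * y / 2)"
      by (intro mult_left_mono upper) (use \<delta> in auto)
    also have "\<dots> = exp ((1 - \<delta>\<^sup>2 + 3 * e * (1 - \<delta>)\<^sup>2) * y / 2)"
      unfolding exp_add[symmetric] by (simp add: power2_eq_square field_simps)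
    also have "\<dots> \<le> Z / 4"
    proof (rule quarter)
      have "(1 - \<delta>)\<^sup>2 \<le> 1" using \<delta> by (simp add: power_le_one)
      then have "3 * e * (1 - \<delta>)\<^sup>2 \<le> 3 * e * 1" using e by (intro mult_left_mono) auto
      then have "1 - \<delta>\<^sup>2 + 3 * e * (1 - \<delta>)\<^sup>2 \<le> 1 - \<delta>\<^sup>2 + 12 * e" using e by linarith
      then show "(1 - \<delta>\<^sup>2 + 3 * e * (1 - \<delta>)\<^sup>2) * y / 2 \<le> (1 - \<delta>\<^sup>2 + 12 * e) * y / 2"
        using y0 by (intro divide_right_mono mult_right_mono) auto
    qed
    finally show ?thesis .
  qed
  have EB: "E B \<le> Z / 4"
  proof -
    have "E B = exp (- \<delta> * (1 + \<delta>) * y) * E (\<lambda>ys. exp ((1 + \<delta>) * t * Df ys))"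
      unfolding B_def E_def by (rule stopped_mult)
    also have "\<dots> \<le> exp (- \<delta> * (1 + \<delta>) * y) * exp ((1 + 3 * e) * (1 + \<delta>)\<^sup>2 * y / 2)"
      by (intro mult_left_mono upper) (use \<delta> in auto)
    also have "\<dots> = exp ((1 - \<delta>\<^sup>2 + 3 * e * (1 + \<delta>)\<^sup>2) * y / 2)"
      unfolding exp_add[symmetric] by (simp add: power2_eq_square field_simps)
    also have "\<dots> \<le> Z / 4"
    proof (rule quarter)
      have "(1 + \<delta>)\<^sup>2 \<le> 2\<^sup>2" using \<delta> by (intro power_mono) auto
      then have "3 * e * (1 + \<delta>)\<^sup>2 \<le> 3 * e * 4" using e by (intro mult_left_mono) auto
      then have "1 - \<delta>\<^sup>2 + 3 * e * (1 + \<delta>)\<^sup>2 \<le> 1 - \<delta>\<^sup>2 + 12 * e" by linarith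
      then show "(1 - \<delta>\<^sup>2 + 3 * e * (1 + \<delta>)\<^sup>2) * y / 2 \<le> (1 - \<delta>\<^sup>2 + 12 * e) * y / 2"
        using y0 by (intro divide_right_mono mult_right_mono) auto
    qed
    finally show ?thesis .
  qed
  have "Z \<le> E (\<lambda>ys. exp (t * Df ys))" using lower by (simp add: Z_def)
  also have "\<dots> \<le> E (\<lambda>ys. (A ys + B ys) + C ys)" by (rule E_mono) (rule ptw)
  also have "\<dots> = (E A + E B) + E C" unfolding E_def by (simp add: stopped_add)
  also have "\<dots> \<le> Z / 2 + E C" using EA EB by linarith
  finally have "Z / 2 \<le> E C" by linarith
  also have "E C = exp ((1 + \<delta>) * y) * E (\<lambda>ys. of_bool (H ys))"
    unfolding C_def E_def by (rule stopped_mult)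
  finally have "exp (- ((1 + \<delta>) * y)) * (Z / 2) \<le> exp (- ((1 + \<delta>) * y)) * (exp ((1 + \<delta>) * y) * E (\<lambda>ys. of_bool (H ys)))"
    by (intro mult_left_mono) auto
  also have "\<dots> = E (\<lambda>ys. of_bool (H ys))"
    unfolding mult.assoc[symmetric] exp_add[symmetric] by simp
  finally have 1: "exp (- ((1 + \<delta>) * y)) * Z / 2 \<le> E (\<lambda>ys. of_bool (H ys))" by simp
  \<comment> \<open>The exponent \<open>(1 + \<delta>) * y - (1 - 2 * e) * y / 2\<close> equals
    \<open>(1 + 2 * \<delta> + 2 * e) * y / 2\<close>, and
    \<open>2 * e \<le> \<delta>\<close>.\<close>
  have "(1 + 2 * \<delta> + 2 * e) * y / 2 \<le> (1 + 3 * \<delta>) * y / 2"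
    using e y0 by (intro divide_right_mono mult_right_mono) auto
  then have "exp (- (1 + 3 * \<delta>) * y / 2) \<le> exp (- ((1 + \<delta>) * y)) * Z"
  proof -
    have "- ((1 + \<delta>) * y) + (1 - 2 * e) * y / 2 = - ((1 + 2 * \<delta> + 2 * e) * y / 2)"
      by (simp add: field_simps)
    moreover have "- (1 + 3 * \<delta>) * y / 2 = - ((1 + 3 * \<delta>) * y / 2)" by (simp only: mult_minus_left minus_divide_left)
    ultimately show ?thesis
      using \<open>(1 + 2 * \<delta> + 2 * e) * y / 2 \<le> (1 + 3 * \<delta>) * y / 2\<close>
      unfolding Z_def exp_add[symmetric] by (simp only: exp_le_cancel_iff neg_le_iff_le)
  qed
  with 1 have "exp (- (1 + 3 * \<delta>) * y / 2) / 2 \<le> E (\<lambda>ys. of_bool (H ys))" by linarith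
  also have "\<dots> \<le> stopped H m (\<lambda>ys. of_bool (H ys)) xs"
    unfolding E_def by (rule stopped_le_hit[OF xs])
  also have "\<dots> = iterate m (\<lambda>ys. of_bool (\<exists>j\<le>length ys. length xs \<le> j \<and> H (take j ys))) xs"
    by (rule iterate_hit_eq_stopped[OF xs, symmetric])
  finally show ?thesis by (simp add: y_def)
qed

end

section \<open>Lower half of the law of the iterated logarithm\<close>

lemma ln_ln_scale_eventually:
  fixes \<eta> :: real
  assumes "\<eta> > 0"
  shows "\<forall>\<^sub>F u in at_top. ln (ln ((1 + \<eta>) * u)) \<le> (1 + \<eta>) * ln (ln u)"
  using assms by real_asymp

lemma not_summable_inverse_Suc:
  fixes a :: real
  assumes "a \<noteq> 0"
  shows "\<not> summable (\<lambda>k. 1 / (a * (real k + 1)))"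
proof
  assume "summable (\<lambda>k. 1 / (a * (real k + 1)))"
  then have "summable (\<lambda>k. a * (1 / (a * (real k + 1))))" by (rule summable_mult)
  moreover have "a * (1 / (a * (real k + 1))) = inverse (real (Suc k))" for k
    using assms by (simp add: inverse_eq_divide add.commute)
  ultimately have "summable (\<lambda>k. inverse (real (Suc k)))" by simp
  then have "summable (\<lambda>k. inverse (real k))" by (subst (asm) summable_Suc_iff)
  then show False using not_summable_harmonic[where 'a = real] by simp
qed

text \<open>\<open>A\<close> is a deterministic clock for the random variance. As the comparison
  holds on every path, a fixed time by which the variance has reached a given level can be chosen in
  advance; \<open>b\<close> bounds the jumps of the clock.\<close>

locale growing_martingale = path_martingale +
  fixes A :: "nat \<Rightarrow> real" and c\<^sub>0 b :: real
  assumes c0_pos: "c\<^sub>0 > 0" and mono_A: "mono A" and A_at_top: "filterlim A at_top sequentially"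
    and A_Suc: "\<And>n. A (Suc n) \<le> A n + b"
    and qvar_ge: "\<And>xs. set xs \<subseteq> D \<Longrightarrow> c\<^sub>0 * A (length xs) \<le> qvar xs"
    and qvar_le: "\<And>xs. set xs \<subseteq> D \<Longrightarrow> qvar xs \<le> A (length xs)"
begin

lemma qvar_at_top:
  assumes "x \<in> space M"
  shows "filterlim (\<lambda>n. qvar (history n x)) at_top sequentially"
proof (rule filterlim_at_top_mono)
  show "filterlim (\<lambda>n. c\<^sub>0 * A n) at_top sequentially"
    using A_at_top c0_pos by (intro filterlim_tendsto_pos_mult_at_top[OF tendsto_const]) auto
  show "\<forall>\<^sub>F n in sequentially. c\<^sub>0 * A n \<le> qvar (history n x)"
    using qvar_ge[OF set_history[OF assms]] by simp
qed

lemma uminus_growing_martingale: "growing_martingale M X D trans (\<lambda>xs. - mart xs) qvar c A c\<^sub>0 b"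
proof -
  interpret neg: path_martingale M X D trans "\<lambda>xs. - mart xs" qvar c
    by (rule uminus_path_martingale)
  show ?thesis
    by unfold_locales (use c0_pos mono_A A_at_top A_Suc qvar_ge qvar_le in auto)
qed

text \<open>In block \<open>k\<close> the martingale gains nearly \<open>lil_scale (u k)\<close>
  with conditional probability at least a constant times \<open>1 / (k + 1)\<close>, whatever the
  past. The value at the start of the block is harmless: its variance is at most
  \<open>\<eta> * u k\<close>, and the upper half applied to \<open>- mart\<close> limits how
  negative it can be.\<close>

lemma lil_lower:
  assumes eps: "0 < \<epsilon>" "\<epsilon> < 1"
  shows "AE x in M. \<exists>\<^sub>F n in sequentially.
    (1 - \<epsilon>) * lil_scale (qvar (history n x)) \<le> mart (history n x)"
proof -
  \<comment> \<open>The total loss \<open>3 * \<delta> + \<epsilon> / 6 + 2 * \<eta>\<close> stays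
    below \<epsilon>. The term \<open>\<epsilon> / 6\<close> is \<open>4 * sqrt \<eta>\<close>: the
    past of a block has variance at most \<open>\<eta> * u k\<close>, and 4 is the constant of a
    crude upper half.\<close>
  define \<delta> where "\<delta> = \<epsilon> / 12"
  define \<eta> where "\<eta> = (\<epsilon> / 24)\<^sup>2"
  define e where "e = \<delta>\<^sup>2 / 28"
  \<comment> \<open>Blocks must be long enough to beat the uncertainty \<open>1 / c\<^sub>0\<close>
    of the clock: for large \<open>k\<close> the variance at time \<open>n k\<close> is at most
    \<open>2 * \<rho> ^ k / c\<^sub>0\<close>, and this should not exceed
    \<open>\<eta> * \<rho> ^ Suc k\<close>.\<close>
  define \<rho> where "\<rho> = 2 / (c\<^sub>0 * \<eta>) + 2"
  have \<delta>: "0 < \<delta>" "\<delta> \<le> 1 / 12" using eps by (auto simp: \<delta>_def)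
  have \<eta>0: "0 < \<eta>" using eps by (simp add: \<eta>_def)
  have "\<epsilon> * \<epsilon> \<le> \<epsilon> * 1" using eps by (intro mult_left_mono) auto
  then have \<eta>: "0 < \<eta>" "\<eta> \<le> \<epsilon> / 576" using eps by (auto simp: \<eta>_def power2_eq_square)
  have e: "e > 0" using \<delta> by (simp add: e_def)
  have \<rho>: "\<rho> > 1" using c0_pos \<eta> by (simp add: \<rho>_def add_pos_pos add_strict_increasing2)
  \<comment> \<open>By time \<open>n k\<close> the variance has reached \<open>\<rho> ^ k\<close> on
    every path, so \<open>n (Suc k)\<close> suffices for the target \<open>u k\<close> of block
    \<open>k\<close>.\<close>
  define n where "n k = (LEAST n. \<rho> ^ k \<le> c\<^sub>0 * A n)" for k
  have cA_top: "filterlim (\<lambda>n. c\<^sub>0 * A n) at_top sequentially"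
    using A_at_top c0_pos by (intro filterlim_tendsto_pos_mult_at_top[OF tendsto_const]) auto
  have ex: "\<exists>n. \<rho> ^ k \<le> c\<^sub>0 * A n" for k
    using cA_top unfolding filterlim_at_top by (meson eventually_sequentially order_refl)
  have n_ge: "\<rho> ^ k \<le> c\<^sub>0 * A (n k)" for k
    unfolding n_def using ex by (rule LeastI_ex)
  have mono_n: "mono n"
  proof (rule monoI)
    fix i j :: nat assume "i \<le> j"
    then have "\<rho> ^ i \<le> \<rho> ^ j" using \<rho> by (intro power_increasing) auto
    then have "\<rho> ^ i \<le> c\<^sub>0 * A (n j)" using n_ge[of j] by linarith
    then show "n i \<le> n j" unfolding n_def[of i] by (rule Least_le)
  qed
  have n_top: "filterlim n at_top sequentially"
    unfolding filterlim_at_top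
  proof
    fix N
    have "\<forall>\<^sub>F k in sequentially. c\<^sub>0 * A N + 1 \<le> \<rho> ^ k"
      using power_at_top[OF \<rho>] by (simp add: filterlim_at_top)
    then show "\<forall>\<^sub>F k in sequentially. N \<le> n k"
    proof eventually_elim
      case (elim k)
      show ?case
      proof (rule ccontr)
        assume "\<not> N \<le> n k"
        then have "A (n k) \<le> A N" using mono_A by (intro monoD[OF mono_A]) auto
        then have "c\<^sub>0 * A (n k) \<le> c\<^sub>0 * A N" using c0_pos by simp
        then show False using n_ge[of k] elim by linarith
      qed
    qed
  qed
  have A_n: "c\<^sub>0 * A (n k) \<le> \<rho> ^ k + c\<^sub>0 * b" for k
  proof -
    have "c\<^sub>0 * A 0 \<le> 0" using qvar_ge[of "[]"] qvar_Nil by simp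
    moreover have "0 < \<rho> ^ k" using \<rho> by simp
    ultimately have "n k \<noteq> 0" using n_ge[of k] by (cases "n k = 0") auto
    then obtain j where j: "n k = Suc j" by (cases "n k") auto
    have "\<not> \<rho> ^ k \<le> c\<^sub>0 * A j" using not_less_Least[of j "\<lambda>n. \<rho> ^ k \<le> c\<^sub>0 * A n"] j by (simp add: n_def)
    moreover have "c\<^sub>0 * A (Suc j) \<le> c\<^sub>0 * (A j + b)" using A_Suc[of j] c0_pos by (intro mult_left_mono) auto
    ultimately show ?thesis by (simp add: j distrib_left)
  qed
  define u where "u k = \<rho> ^ Suc k" for k
  define L where "L k = ln (ln (u k))" for k
  define \<tau> where "\<tau> k = sqrt (2 * L k / u k)" for k
  \<comment> \<open>The factor \<open>1 - 2 * \<delta>\<close> offsets the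
    \<open>1 + 3 * \<delta>\<close> in the exponent of the block estimate. The probability is then
    at least \<open>exp (- L k) / 2\<close>, whose sum diverges; the unshrunk parameter would give a
    convergent series of bounds.\<close>
  define t where "t k = (1 - 2 * \<delta>) * \<tau> k" for k
  define H where "H k xs ys \<longleftrightarrow> u k \<le> qvar ys \<and> qvar ys \<le> u k + c\<^sup>2 \<and>
    (1 - \<delta>) * (t k * (u k - qvar xs)) \<le> mart ys - mart xs" for k xs ys
  define R where "R k ys \<longleftrightarrow> (\<exists>j\<le>length ys. n k \<le> j \<and> H k (take (n k) ys) (take j ys))" for k ys
  have u_top: "filterlim u at_top sequentially"
    unfolding u_def using power_at_top[OF \<rho>] by (subst filterlim_sequentially_Suc)
  have \<tau>0: "\<tau> \<longlonglongrightarrow> 0" and L_top: "filterlim L at_top sequentially"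
    unfolding \<tau>_def L_def u_def
    using lil_threshold_tendsto(1)[OF \<rho>, THEN LIMSEQ_Suc]
      lil_threshold_tendsto(2)[OF \<rho>, unfolded filterlim_sequentially_Suc[of "\<lambda>k. ln (ln (\<rho> ^ k))", symmetric]]
    by blast+
  have "\<forall>\<^sub>F k in sequentially. 2 * t k * c < e"
  proof (rule order_tendstoD)
    show "(\<lambda>k. 2 * t k * c) \<longlonglongrightarrow> 0" unfolding t_def using \<tau>0 by (auto intro!: tendsto_eq_intros)
  qed (use e in auto)
  moreover have "\<forall>\<^sub>F k in sequentially. max 1 (4 * ln 4 / (\<delta>\<^sup>2 * (1 - 2 * \<delta>)\<^sup>2 * (1 - \<eta>) * 2)) \<le> L k"
    using L_top by (simp only: filterlim_at_top)
  moreover have "\<forall>\<^sub>F k in sequentially. max (exp 1 / \<eta>) (max (b * c\<^sub>0 * \<rho>) (c\<^sup>2 / (e * \<eta> * (1 - \<eta>)))) \<le> u k"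
    using u_top by (simp only: filterlim_at_top)
  moreover have "\<forall>\<^sub>F k in sequentially. ln (ln ((1 + \<eta>) * u k)) \<le> (1 + \<eta>) * ln (ln (u k))"
    by (rule eventually_compose_filterlim[OF ln_ln_scale_eventually[OF \<eta>0] u_top])
  ultimately have "\<forall>\<^sub>F k in sequentially. 2 * t k * c < e
    \<and> max 1 (4 * ln 4 / (\<delta>\<^sup>2 * (1 - 2 * \<delta>)\<^sup>2 * (1 - \<eta>) * 2)) \<le> L k
    \<and> max (exp 1 / \<eta>) (max (b * c\<^sub>0 * \<rho>) (c\<^sup>2 / (e * \<eta> * (1 - \<eta>)))) \<le> u k
    \<and> ln (ln ((1 + \<eta>) * u k)) \<le> (1 + \<eta>) * ln (ln (u k))"
    by eventually_elim auto
  then obtain K where K: "\<And>k. k \<ge> K \<Longrightarrow> 2 * t k * c < e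
    \<and> max 1 (4 * ln 4 / (\<delta>\<^sup>2 * (1 - 2 * \<delta>)\<^sup>2 * (1 - \<eta>) * 2)) \<le> L k
    \<and> max (exp 1 / \<eta>) (max (b * c\<^sub>0 * \<rho>) (c\<^sup>2 / (e * \<eta> * (1 - \<eta>)))) \<le> u k
    \<and> ln (ln ((1 + \<eta>) * u k)) \<le> (1 + \<eta>) * ln (ln (u k))"
    unfolding eventually_sequentially by blast
  have \<eta>1: "\<eta> \<le> 1 / 576" using \<eta> eps by linarith
  have facts: "2 * t k * c \<le> e" "L k \<ge> 1" "4 * ln 4 / (\<delta>\<^sup>2 * (1 - 2 * \<delta>)\<^sup>2 * (1 - \<eta>) * 2) \<le> L k"
    "exp 1 \<le> \<eta> * u k" "b * c\<^sub>0 \<le> \<rho> ^ k" "c\<^sup>2 \<le> e * ((1 - \<eta>) * u k)" "c\<^sup>2 \<le> \<eta> * u k"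
    "ln (ln ((1 + \<eta>) * u k)) \<le> (1 + \<eta>) * ln (ln (u k))" "u k > 0"
    "\<tau> k > 0" "\<tau> k * u k = lil_scale (u k)" "(\<tau> k)\<^sup>2 * u k = 2 * L k"
    if "k \<ge> K" for k
  proof -
    note Kk = K[OF that]
    show up: "u k > 0" using \<rho> by (simp add: u_def)
    show "2 * t k * c \<le> e" "4 * ln 4 / (\<delta>\<^sup>2 * (1 - 2 * \<delta>)\<^sup>2 * (1 - \<eta>) * 2) \<le> L k"
      "ln (ln ((1 + \<eta>) * u k)) \<le> (1 + \<eta>) * ln (ln (u k))" and L1: "L k \<ge> 1"
      using Kk by auto
    show "exp 1 \<le> \<eta> * u k" using Kk \<eta> by (simp add: pos_divide_le_eq mult.commute)
    have "b * c\<^sub>0 * \<rho> \<le> \<rho> ^ k * \<rho>" using Kk by (simp add: u_def mult.commute)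
    then show "b * c\<^sub>0 \<le> \<rho> ^ k" using \<rho> by simp
    have ce: "c\<^sup>2 \<le> u k * (e * \<eta> * (1 - \<eta>))" using Kk e \<eta> \<eta>1 by (simp add: pos_divide_le_eq)
    have "\<delta>\<^sup>2 \<le> 1" using \<delta> by (simp add: power_le_one)
    then have e1: "e \<le> 1" by (simp add: e_def)
    have "u k * (e * \<eta> * (1 - \<eta>)) = \<eta> * (e * ((1 - \<eta>) * u k))" by simp
    also have "\<dots> \<le> 1 * (e * ((1 - \<eta>) * u k))" using \<eta>1 up e by (intro mult_right_mono) auto
    finally show "c\<^sup>2 \<le> e * ((1 - \<eta>) * u k)" using ce by simp
    have "u k * (e * \<eta> * (1 - \<eta>)) = (e * (1 - \<eta>)) * (\<eta> * u k)" by simp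
    also have "\<dots> \<le> 1 * (\<eta> * u k)" using \<eta>1 \<eta> up e e1 by (intro mult_right_mono mult_le_one) auto
    finally show "c\<^sup>2 \<le> \<eta> * u k" using ce by simp
    have "ln (ln (u k)) > 0" using L1 by (simp add: L_def)
    from lil_threshold[OF up this, folded L_def, folded \<tau>_def]
    show "\<tau> k > 0" "\<tau> k * u k = lil_scale (u k)" "(\<tau> k)\<^sup>2 * u k = 2 * L k" by auto
  qed
  have qvar_n: "qvar xs \<le> \<eta> * u k" if "k \<ge> K" "set xs \<subseteq> D" "length xs = n k" for k xs
  proof -
    have "c\<^sub>0 * qvar xs \<le> c\<^sub>0 * A (n k)" using qvar_le[of xs] that c0_pos by simp
    also have "\<dots> \<le> 2 * \<rho> ^ k" using A_n[of k] facts(5)[OF that(1)] by (simp add: mult.commute)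
    also have "\<dots> \<le> c\<^sub>0 * (\<eta> * u k)"
    proof -
      have "2 \<le> c\<^sub>0 * \<eta> * \<rho>" using c0_pos \<eta> by (simp add: \<rho>_def distrib_left)
      then have "2 * \<rho> ^ k \<le> (c\<^sub>0 * \<eta> * \<rho>) * \<rho> ^ k" using \<rho> by (intro mult_right_mono) auto
      then show ?thesis by (simp add: u_def mult_ac)
    qed
    finally show ?thesis using c0_pos by simp
  qed
  have "AE x in M. \<exists>\<^sub>F k in sequentially. R k (history (n (Suc k)) x)"
  proof (rule AE_frequently_block[OF mono_n])
    show "\<not> summable (\<lambda>k. 1 / ((2 * ln \<rho>) * (real k + 1)))"
      by (rule not_summable_inverse_Suc) (use \<rho> in auto)
    show "0 \<le> 1 / ((2 * ln \<rho>) * (real k + 1))" for k using \<rho> by simp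
    fix k xs assume k: "k \<ge> K" and xs: "set xs \<subseteq> D" "length xs = n k"
    note F = facts[OF k]
    define w where "w = u k - qvar xs"
    have wl: "(1 - \<eta>) * u k \<le> w" using qvar_n[OF k xs] by (simp add: w_def algebra_simps)
    have "0 \<le> qvar xs"
    proof -
      have "0 \<le> \<rho> ^ k" using \<rho> by simp
      then show ?thesis using qvar_ge[OF xs(1)] n_ge[of k] xs(2) by simp
    qed
    then have wu: "w \<le> u k" by (simp add: w_def)
    have "0 < (1 - \<eta>) * u k" using F(9) \<eta>1 by (intro mult_pos_pos) auto
    then have w0: "0 < w" using wl by linarith
    have tk: "t k > 0" using F(10) \<delta> by (simp add: t_def)
    have "exp (- (1 + 3 * \<delta>) * ((t k)\<^sup>2 * w) / 2) / 2
      \<le> iterate (n (Suc k) - n k) (\<lambda>ys. of_bool (\<exists>j\<le>length ys. length xs \<le> j \<and>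
          (u k \<le> qvar (take j ys) \<and> qvar (take j ys) \<le> u k + c\<^sup>2 \<and>
           (1 - \<delta>) * (t k * (u k - qvar xs)) \<le> mart (take j ys) - mart xs))) xs"
      unfolding w_def
    proof (rule block_prob_lower)
      show "2 * t k * c \<le> \<delta>\<^sup>2 / 28" using F(1) by (simp add: e_def)
      show "c\<^sup>2 \<le> \<delta>\<^sup>2 / 28 * (u k - qvar xs)"
      proof -
        have "e * ((1 - \<eta>) * u k) \<le> e * w" using wl e by (intro mult_left_mono) auto
        then show ?thesis using F(6) by (simp add: e_def w_def)
      qed
      show "4 * exp (- (\<delta>\<^sup>2 / 4) * ((t k)\<^sup>2 * (u k - qvar xs))) \<le> 1"
      proof -
        have pos: "\<delta>\<^sup>2 * (1 - 2 * \<delta>)\<^sup>2 * (1 - \<eta>) * 2 > 0" using \<delta> \<eta>1 by simp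
        have "ln 4 \<le> \<delta>\<^sup>2 / 4 * ((1 - 2 * \<delta>)\<^sup>2 * (1 - \<eta>) * (2 * L k))"
          using F(3) pos by (simp add: pos_divide_le_eq mult_ac)
        also have "\<dots> = \<delta>\<^sup>2 / 4 * ((t k)\<^sup>2 * ((1 - \<eta>) * u k))"
          unfolding F(12)[symmetric] by (simp add: t_def power_mult_distrib)
        also have "\<dots> \<le> \<delta>\<^sup>2 / 4 * ((t k)\<^sup>2 * w)" using wl by (intro mult_left_mono) auto
        finally have "exp (ln 4 + - (\<delta>\<^sup>2 / 4) * ((t k)\<^sup>2 * w)) \<le> exp 0" by (subst exp_le_cancel_iff) linarith
        then show ?thesis unfolding exp_add by (simp add: w_def)
      qed
      show "u k \<le> qvar ys" if "set ys \<subseteq> D" "length ys = length xs + (n (Suc k) - n k)" for ys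
      proof -
        have "length ys = n (Suc k)" using that xs monoD[OF mono_n, of k "Suc k"] by simp
        then show ?thesis using qvar_ge[of ys] that n_ge[of "Suc k"] by (simp add: u_def)
      qed
    qed (use \<delta> tk xs w0 in \<open>auto simp: w_def\<close>)
    also have "\<dots> = iterate (n (Suc k) - n k) (\<lambda>ys. of_bool (R k ys)) xs"
    proof (rule stopped_cong[where I = "\<lambda>ys. set ys \<subseteq> D \<and> n k \<le> length ys \<and> take (n k) ys = xs"])
      fix ys assume "set ys \<subseteq> D \<and> n k \<le> length ys \<and> take (n k) ys = xs"
      then have "take (n k) ys = xs" by blast
      then show "of_bool (\<exists>j\<le>length ys. length xs \<le> j \<and>
          (u k \<le> qvar (take j ys) \<and> qvar (take j ys) \<le> u k + c\<^sup>2 \<and>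
           (1 - \<delta>) * (t k * (u k - qvar xs)) \<le> mart (take j ys) - mart xs)) = (of_bool (R k ys) :: real)"
        unfolding R_def H_def xs(2) by simp
    qed (use xs in auto)
    finally have main: "exp (- (1 + 3 * \<delta>) * ((t k)\<^sup>2 * w) / 2) / 2
        \<le> iterate (n (Suc k) - n k) (\<lambda>ys. of_bool (R k ys)) xs" .
    have "(1 + 3 * \<delta>) * ((t k)\<^sup>2 * w) / 2 \<le> (1 + 3 * \<delta>) * ((t k)\<^sup>2 * u k) / 2"
      using wu \<delta> by (intro divide_right_mono mult_left_mono) auto
    also have "\<dots> = (1 + 3 * \<delta>) * (1 - 2 * \<delta>)\<^sup>2 * ((\<tau> k)\<^sup>2 * u k) / 2"
      by (simp add: t_def power_mult_distrib)
    also have "\<dots> = (1 + 3 * \<delta>) * (1 - 2 * \<delta>)\<^sup>2 * L k" unfolding F(12) by simp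
    also have "\<dots> \<le> 1 * L k"
    proof (rule mult_right_mono)
      have "\<delta>\<^sup>2 * \<delta> \<le> \<delta>\<^sup>2 * (1/12)" using \<delta> by (intro mult_left_mono) auto
      moreover have "(1 + 3 * \<delta>) * (1 - 2 * \<delta>)\<^sup>2 = 1 - \<delta> - 8 * \<delta>\<^sup>2 + 12 * (\<delta>\<^sup>2 * \<delta>)"
        by (simp add: power2_eq_square algebra_simps)
      moreover have "0 \<le> \<delta>\<^sup>2" by simp
      ultimately show "(1 + 3 * \<delta>) * (1 - 2 * \<delta>)\<^sup>2 \<le> 1" using \<delta> by linarith
    qed (use F(2) in simp)
    finally have "- L k \<le> - (1 + 3 * \<delta>) * ((t k)\<^sup>2 * w) / 2" by (simp add: field_simps)
    then have "exp (- L k) / 2 \<le> exp (- (1 + 3 * \<delta>) * ((t k)\<^sup>2 * w) / 2) / 2" by simp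
    moreover have "exp (- L k) / 2 = 1 / ((2 * ln \<rho>) * (real k + 1))"
    proof -
      have "ln (u k) = (real k + 1) * ln \<rho>" using \<rho> by (simp only: u_def ln_realpow) (simp add: add.commute)
      moreover have "(real k + 1) * ln \<rho> > 0" using \<rho> by simp
      ultimately show ?thesis by (simp add: L_def exp_minus field_simps)
    qed
    ultimately show "1 / ((2 * ln \<rho>) * (real k + 1)) \<le> iterate (n (Suc k) - n k) (\<lambda>ys. of_bool (R k ys)) xs"
      using main by linarith
  qed
  \<comment> \<open>The upper half for \<open>- mart\<close> at tolerance 1, with constant
    \<open>(1 + 1)^2 = 4\<close>, controls the past of each block.\<close>
  moreover have "AE x in M. \<forall>\<^sub>F n in sequentially. - mart (history n x) \<le> (1 + 1)\<^sup>2 * lil_scale (qvar (history n x))"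
    by (rule path_martingale.lil_upper[OF uminus_path_martingale]) (auto intro!: AE_I2 qvar_at_top)
  ultimately show ?thesis using AE_space
  proof eventually_elim
    case (elim x)
    have "\<forall>\<^sub>F k in sequentially. - mart (history (n k) x) \<le> (1 + 1)\<^sup>2 * lil_scale (qvar (history (n k) x))"
      by (rule eventually_compose_filterlim[OF elim(2) n_top])
    moreover have "\<forall>\<^sub>F k in sequentially. exp 1 \<le> \<rho> ^ k"
      using power_at_top[OF \<rho>] by (simp add: filterlim_at_top)
    ultimately have good: "\<forall>\<^sub>F k in sequentially. - mart (history (n k) x) \<le> 4 * lil_scale (qvar (history (n k) x))
      \<and> exp 1 \<le> \<rho> ^ k \<and> K \<le> k"
      using eventually_ge_at_top[of K] by eventually_elim simp
    \<comment> \<open>The hit lies inside the block, at some \<open>j \<ge> n k\<close>; since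
      \<open>n k\<close> tends to infinity, successes in infinitely many blocks occur at arbitrarily
      late times.\<close>
    have hit: "\<exists>j\<ge>n k. (1 - \<epsilon>) * lil_scale (qvar (history j x)) \<le> mart (history j x)"
      if R: "R k (history (n (Suc k)) x)" and g: "- mart (history (n k) x) \<le> 4 * lil_scale (qvar (history (n k) x))"
        "exp 1 \<le> \<rho> ^ k" "K \<le> k" for k
    proof -
      note F = facts[OF g(3)]
      define q where "q = lil_scale (u k)"
      define xs where "xs = history (n k) x"
      have xs: "set xs \<subseteq> D" "length xs = n k" using set_history elim(3) by (auto simp: xs_def)
      from R obtain j where j: "j \<le> n (Suc k)" "n k \<le> j"
        "H k (take (n k) (history (n (Suc k)) x)) (take j (history (n (Suc k)) x))"
        unfolding R_def length_history by blast
      define h where "h = history j x"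
      have "H k xs h" using j monoD[OF mono_n, of k "Suc k"] by (simp add: take_history xs_def h_def)
      then have h: "u k \<le> qvar h" "qvar h \<le> u k + c\<^sup>2"
        "(1 - \<delta>) * (t k * (u k - qvar xs)) \<le> mart h - mart xs" by (auto simp: H_def)
      have q0: "q > 0" using F(9,10) unfolding q_def F(11)[symmetric] by simp
      have qx: "qvar xs \<le> \<eta> * u k" by (rule qvar_n[OF g(3) xs])
      have "exp 1 \<le> qvar xs" using g(2) n_ge[of k] qvar_ge[OF xs(1)] unfolding xs(2) by linarith
      then have "lil_scale (qvar xs) \<le> lil_scale (\<eta> * u k)" using qx by (rule lil_scale_mono)
      also have "\<dots> \<le> sqrt (\<eta> * (2 * u k * ln (ln (u k))))"
      proof -
        have "\<eta> * u k \<le> u k" using \<eta>1 F(9) by simp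
        then have "ln (ln (\<eta> * u k)) \<le> ln (ln (u k))" using F(4) ln_ln_mono by blast
        then have "(2 * (\<eta> * u k)) * ln (ln (\<eta> * u k)) \<le> (2 * (\<eta> * u k)) * ln (ln (u k))"
          using \<eta> F(9) by (intro mult_left_mono) auto
        then show ?thesis unfolding lil_scale_def by (simp add: mult_ac)
      qed
      also have "\<dots> = \<epsilon> / 24 * q"
        unfolding real_sqrt_mult q_def lil_scale_def \<eta>_def using eps by simp
      finally have "- mart xs \<le> \<epsilon> / 6 * q" using g(1) by (simp add: xs_def)
      moreover have "(1 - \<delta>) * (1 - 2 * \<delta>) * (1 - \<eta>) * q \<le> (1 - \<delta>) * (t k * (u k - qvar xs))"
      proof -
        have "(1 - \<eta>) * u k \<le> u k - qvar xs" using qx by (simp add: algebra_simps)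
        then have "(1 - \<delta>) * (t k * ((1 - \<eta>) * u k)) \<le> (1 - \<delta>) * (t k * (u k - qvar xs))"
          using \<delta> F(10) by (intro mult_left_mono) (auto simp: t_def)
        moreover have "(1 - \<delta>) * (t k * ((1 - \<eta>) * u k)) = (1 - \<delta>) * (1 - 2 * \<delta>) * (1 - \<eta>) * q"
          unfolding q_def F(11)[symmetric] by (simp add: t_def)
        ultimately show ?thesis by simp
      qed
      ultimately have m: "((1 - \<delta>) * (1 - 2 * \<delta>) * (1 - \<eta>) - \<epsilon> / 6) * q \<le> mart h"
        using h(3) by (simp add: algebra_simps)
      \<comment> \<open>The overshoot \<open>c^2\<close> is at most \<open>\<eta> * u k\<close>, so
        the scale at the hitting time exceeds \<open>lil_scale (u k)\<close> by a factor of at most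
        \<open>1 + \<eta>\<close>.\<close>
      have "(1 - \<epsilon>) * lil_scale (qvar h) \<le> (1 - \<epsilon>) * ((1 + \<eta>) * q)"
      proof (rule mult_left_mono)
        have eu: "exp 1 \<le> u k" using F(4) \<eta>1 F(9) mult_right_mono[of \<eta> 1 "u k"] by linarith
        have "qvar h \<le> (1 + \<eta>) * u k" using h(2) F(7) by (simp add: algebra_simps)
        then have "lil_scale (qvar h) \<le> lil_scale ((1 + \<eta>) * u k)"
          using eu h(1) by (intro lil_scale_mono) auto
        also have "\<dots> \<le> sqrt ((1 + \<eta>)\<^sup>2 * (2 * u k * ln (ln (u k))))"
        proof -
          have "(2 * ((1 + \<eta>) * u k)) * ln (ln ((1 + \<eta>) * u k)) \<le> (2 * ((1 + \<eta>) * u k)) * ((1 + \<eta>) * ln (ln (u k)))"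
            using \<eta> F(9) F(8) by (intro mult_left_mono) auto
          then show ?thesis unfolding lil_scale_def by (simp only: power2_eq_square mult_ac real_sqrt_le_iff)
        qed
        also have "\<dots> = (1 + \<eta>) * q"
          unfolding real_sqrt_mult q_def lil_scale_def using \<eta> by simp
        finally show "lil_scale (qvar h) \<le> (1 + \<eta>) * q" .
      qed (use eps in simp)
      also have "\<dots> \<le> ((1 - \<delta>) * (1 - 2 * \<delta>) * (1 - \<eta>) - \<epsilon> / 6) * q"
        unfolding mult.assoc[symmetric]
      proof (rule mult_right_mono)
        have "1 - 3 * \<delta> \<le> (1 - \<delta>) * (1 - 2 * \<delta>)" by (simp add: algebra_simps)
        then have "(1 - 3 * \<delta>) * (1 - \<eta>) \<le> (1 - \<delta>) * (1 - 2 * \<delta>) * (1 - \<eta>)"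
          using \<eta>1 by (intro mult_right_mono) auto
        moreover have "1 - 3 * \<delta> - \<eta> \<le> (1 - 3 * \<delta>) * (1 - \<eta>)" using \<delta> \<eta> by (simp add: algebra_simps)
        moreover have "(1 - \<epsilon>) * (1 + \<eta>) \<le> 1 - \<epsilon> + \<eta>" using eps \<eta> by (simp add: algebra_simps)
        ultimately show "(1 - \<epsilon>) * (1 + \<eta>) \<le> (1 - \<delta>) * (1 - 2 * \<delta>) * (1 - \<eta>) - \<epsilon> / 6"
          using \<eta>(2) eps unfolding \<delta>_def by linarith
      qed (use q0 in simp)
      finally show ?thesis using m j(2) unfolding h_def by (intro exI[of _ j]) simp
    qed
    show ?case
      unfolding frequently_sequentially
    proof
      fix N
      have "\<forall>\<^sub>F k in sequentially. N \<le> n k" using n_top by (simp add: filterlim_at_top)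
      with good have "\<forall>\<^sub>F k in sequentially. N \<le> n k \<and> - mart (history (n k) x) \<le> 4 * lil_scale (qvar (history (n k) x))
          \<and> exp 1 \<le> \<rho> ^ k \<and> K \<le> k"
        by eventually_elim auto
      from frequently_eventually_frequently[OF elim(1) this]
      obtain k where "R k (history (n (Suc k)) x)" "N \<le> n k"
        "- mart (history (n k) x) \<le> 4 * lil_scale (qvar (history (n k) x))" "exp 1 \<le> \<rho> ^ k" "K \<le> k"
        by (auto dest: frequently_ex)
      with hit show "\<exists>j\<ge>N. (1 - \<epsilon>) * lil_scale (qvar (history j x)) \<le> mart (history j x)"
        by (meson order.trans)
    qed
  qed
qed

end

section \<open>The central limit theorem\<close>

context path_martingale
begin

text \<open>Nearly a martingale: compensating by the predictable variance, instead of the exact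
  conditional characteristic function, leaves a relative one-step drift of third order in
  \<open>x\<close>.\<close>

definition cmart :: "real \<Rightarrow> real list \<Rightarrow> complex" where
  "cmart x ys = complex_of_real (exp (x\<^sup>2 / 2 * qvar ys)) * iexp (x * mart ys)"

lemma norm_cmart: "norm (cmart x ys) = exp (x\<^sup>2 / 2 * qvar ys)"
  by (simp add: cmart_def norm_mult)

text \<open>Centred increments cancel the linear Taylor term. Of the cubic remainder, one factor is
  bounded by \<open>\<bar>x\<bar> * c\<close> and the other two average to
  \<open>cvar\<close>.\<close>

lemma norm_sum_trans_iexp_le:
  assumes xs: "set xs \<subseteq> D"
  shows "norm ((\<Sum>v\<in>D. trans xs v *\<^sub>R iexp (x * (mart (xs @ [v]) - mart xs)))
    - complex_of_real (1 - x\<^sup>2 / 2 * cvar xs)) \<le> \<bar>x\<bar> * c * (x\<^sup>2 / 4 * cvar xs)"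
proof -
  define d where "d v = mart (xs @ [v]) - mart xs" for v
  have q: "(\<Sum>v\<in>D. trans xs v *\<^sub>R (1 + \<i> * complex_of_real (x * d v) - complex_of_real ((x * d v)\<^sup>2 / 2)))
      = complex_of_real (1 - x\<^sup>2 / 2 * cvar xs)"
  proof -
    have "(\<Sum>v\<in>D. trans xs v *\<^sub>R (1 + \<i> * complex_of_real (x * d v) - complex_of_real ((x * d v)\<^sup>2 / 2)))
      = complex_of_real (\<Sum>v\<in>D. trans xs v) + \<i> * complex_of_real (x * (\<Sum>v\<in>D. trans xs v * d v))
        - complex_of_real (x\<^sup>2 / 2 * (\<Sum>v\<in>D. trans xs v * (d v)\<^sup>2))"
      unfolding of_real_sum sum_distrib_left sum.distrib[symmetric] sum_subtractf[symmetric]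
      by (intro sum.cong refl) (simp add: scaleR_conv_of_real power_mult_distrib algebra_simps)
    then show ?thesis using trans_sum[OF xs] incr_mean[OF xs] by (simp add: d_def cvar_def)
  qed
  have "norm ((\<Sum>v\<in>D. trans xs v *\<^sub>R iexp (x * d v)) - complex_of_real (1 - x\<^sup>2 / 2 * cvar xs))
      = norm (\<Sum>v\<in>D. trans xs v *\<^sub>R (iexp (x * d v)
          - (1 + \<i> * complex_of_real (x * d v) - complex_of_real ((x * d v)\<^sup>2 / 2))))"
    unfolding q[symmetric] sum_subtractf[symmetric] scaleR_diff_right[symmetric] ..
  also have "\<dots> \<le> (\<Sum>v\<in>D. \<bar>x\<bar> * c * (x\<^sup>2 / 4) * (trans xs v * (d v)\<^sup>2))"
  proof (rule sum_norm_le)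
    fix v assume v: "v \<in> D"
    have poly: "(\<Sum>k\<le>2. w ^ k / fact k) = 1 + w + w\<^sup>2 / 2" for w :: complex
      by (simp add: numeral_2_eq_2)
    have "(\<Sum>k\<le>2. (\<i> * complex_of_real (x * d v)) ^ k / fact k)
        = 1 + \<i> * complex_of_real (x * d v) - complex_of_real ((x * d v)\<^sup>2 / 2)"
      unfolding poly by (simp add: power_mult_distrib)
    then have nrm: "norm (iexp (x * d v) - (1 + \<i> * complex_of_real (x * d v) - complex_of_real ((x * d v)\<^sup>2 / 2)))
        \<le> \<bar>x * d v\<bar> ^ 3 / 6"
      using iexp_approx1[of "x * d v" 2] by (simp add: eval_nat_numeral)
    \<comment> \<open>Relaxing 1/6 to 1/4 gives the bound the shape \<open>\<bar>x\<bar> * c\<close>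
      times half of \<open>x^2 / 2 * cvar xs\<close>, the exponent of the compensator.\<close>
    have "\<bar>x * d v\<bar> ^ 3 / 6 \<le> \<bar>x * d v\<bar> ^ 3 / 4" by simp
    also have "\<dots> = \<bar>x\<bar> * \<bar>d v\<bar> * (x\<^sup>2 / 4 * (d v)\<^sup>2)"
    proof -
      have "\<bar>x * d v\<bar> ^ 3 = \<bar>x * d v\<bar> * (x * d v)\<^sup>2"
        unfolding power2_abs[of "x * d v", symmetric] by (simp only: power3_eq_cube power2_eq_square mult.assoc)
      then show ?thesis by (simp add: abs_mult power_mult_distrib)
    qed
    also have "\<dots> \<le> \<bar>x\<bar> * c * (x\<^sup>2 / 4 * (d v)\<^sup>2)"
      using incr_bound[OF xs v] by (intro mult_right_mono mult_left_mono) (auto simp: d_def)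
    finally have "trans xs v * norm (iexp (x * d v) - (1 + \<i> * complex_of_real (x * d v) - complex_of_real ((x * d v)\<^sup>2 / 2)))
        \<le> trans xs v * (\<bar>x\<bar> * c * (x\<^sup>2 / 4 * (d v)\<^sup>2))"
      using nrm trans_nonneg[OF xs v] by (intro mult_left_mono) linarith+
    then show "norm (trans xs v *\<^sub>R (iexp (x * d v)
          - (1 + \<i> * complex_of_real (x * d v) - complex_of_real ((x * d v)\<^sup>2 / 2))))
        \<le> \<bar>x\<bar> * c * (x\<^sup>2 / 4) * (trans xs v * (d v)\<^sup>2)"
      unfolding norm_scaleR abs_of_nonneg[OF trans_nonneg[OF xs v]] by (simp only: mult_ac)
  qed
  also have "\<dots> = \<bar>x\<bar> * c * (x\<^sup>2 / 4 * cvar xs)"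
    by (simp add: cvar_def d_def sum_distrib_left mult_ac)
  finally show ?thesis by (simp add: d_def)
qed

text \<open>\<open>exp y * (1 - y)\<close> differs from 1 by at most \<open>y * y\<close>, and
  \<open>y \<le> \<bar>x\<bar> * c / 2\<close> trades one factor for another order of
  \<open>x\<close>. Keeping \<open>cvar xs\<close> as a factor allows the drifts to be summed
  against \<open>qvar\<close>.\<close>

lemma norm_step_cmart_diff_le:
  assumes xs: "set xs \<subseteq> D" and x: "\<bar>x\<bar> * c \<le> 1"
  shows "norm (step (cmart x) xs - cmart x xs) \<le> norm (cmart x xs) * (\<bar>x\<bar> ^ 3 * c * cvar xs)"
proof -
  define y where "y = x\<^sup>2 / 2 * cvar xs"
  define \<Sigma> where "\<Sigma> = (\<Sum>v\<in>D. trans xs v *\<^sub>R iexp (x * (mart (xs @ [v]) - mart xs)))"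
  have y0: "0 \<le> y" using cvar_bounds[OF xs] by (simp add: y_def)
  have "y \<le> x\<^sup>2 / 2 * c\<^sup>2" unfolding y_def using cvar_bounds[OF xs] by (intro mult_left_mono) auto
  also have "\<dots> = (\<bar>x\<bar> * c) * (\<bar>x\<bar> * c) / 2" by (simp add: power2_eq_square)
  also have "\<dots> \<le> (\<bar>x\<bar> * c) * 1 / 2" using x c_nonneg by (intro divide_right_mono mult_left_mono) auto
  finally have yx: "y \<le> \<bar>x\<bar> * c / 2" by simp
  then have y1: "y \<le> 1" using x by linarith
  have st: "step (cmart x) xs = cmart x xs * (complex_of_real (exp y) * \<Sigma>)"
    unfolding step_def \<Sigma>_def sum_distrib_left
  proof (rule sum.cong[OF refl])
    fix v assume v: "v \<in> D"
    have 1: "x\<^sup>2 / 2 * qvar (xs @ [v]) = x\<^sup>2 / 2 * qvar xs + y"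
      using qvar_snoc'[OF xs v] by (simp add: y_def algebra_simps)
    have "x * mart (xs @ [v]) = x * mart xs + x * (mart (xs @ [v]) - mart xs)" by (simp add: algebra_simps)
    then have 2: "iexp (x * mart (xs @ [v])) = iexp (x * mart xs) * iexp (x * (mart (xs @ [v]) - mart xs))"
      by (simp only: of_real_add distrib_left exp_add)
    have 3: "complex_of_real (exp (x\<^sup>2 / 2 * qvar (xs @ [v]))) = complex_of_real (exp (x\<^sup>2 / 2 * qvar xs)) * complex_of_real (exp y)"
      unfolding 1 exp_add of_real_mult ..
    show "trans xs v *\<^sub>R cmart x (xs @ [v])
        = cmart x xs * (complex_of_real (exp y) * (trans xs v *\<^sub>R iexp (x * (mart (xs @ [v]) - mart xs))))"
      unfolding cmart_def 2 3 scaleR_conv_of_real by (simp only: mult_ac)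
  qed
  have R: "norm (\<Sigma> - complex_of_real (1 - y)) \<le> \<bar>x\<bar> * c * (y / 2)"
    using norm_sum_trans_iexp_le[OF xs, of x] by (simp add: \<Sigma>_def y_def)
  have "norm (complex_of_real (exp y) * \<Sigma> - 1)
      = norm (complex_of_real (exp y) * (\<Sigma> - complex_of_real (1 - y)) + complex_of_real (exp y * (1 - y) - 1))"
    by (simp add: algebra_simps)
  also have "\<dots> \<le> exp y * norm (\<Sigma> - complex_of_real (1 - y)) + \<bar>exp y * (1 - y) - 1\<bar>"
    by (rule order.trans[OF norm_triangle_ineq]) (simp only: norm_mult norm_of_real abs_exp_cancel order_refl)
  also have "\<dots> \<le> \<bar>x\<bar> * c * y + y * y"
  proof (rule add_mono)
    have "y \<le> 1/2" using yx x by linarith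
    then have "exp y \<le> 1 + y + y\<^sup>2" using y0 by (intro exp_bound) auto
    moreover have "y\<^sup>2 \<le> (1/2)\<^sup>2" using y0 \<open>y \<le> 1/2\<close> by (intro power_mono) auto
    ultimately have "exp y \<le> 7/4" using \<open>y \<le> 1/2\<close> by (simp add: power2_eq_square)
    then have e2: "exp y \<le> 2" by simp
    show "exp y * norm (\<Sigma> - complex_of_real (1 - y)) \<le> \<bar>x\<bar> * c * y"
    proof -
      have "exp y * norm (\<Sigma> - complex_of_real (1 - y)) \<le> 2 * (\<bar>x\<bar> * c * (y / 2))"
        using R e2 by (intro mult_mono) auto
      then show ?thesis by simp
    qed
    have "exp y * (1 - y) \<le> exp y * exp (- y)" using exp_ge_add_one_self[of "-y"] by (intro mult_left_mono) auto
    then have u: "exp y * (1 - y) \<le> 1" by (simp flip: exp_add)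
    have "(1 + y) * (1 - y) \<le> exp y * (1 - y)" using y1 by (intro mult_right_mono) auto
    moreover have "(1 + y) * (1 - y) = 1 - y * y" by (simp add: algebra_simps)
    ultimately have "1 - y * y \<le> exp y * (1 - y)" by (simp only:)
    with u show "\<bar>exp y * (1 - y) - 1\<bar> \<le> y * y" by linarith
  qed
  also have "\<dots> \<le> \<bar>x\<bar> * c * y + \<bar>x\<bar> * c / 2 * y"
    using yx y0 by (intro add_left_mono mult_right_mono) auto
  also have "\<dots> \<le> 2 * (\<bar>x\<bar> * c * y)" using y0 c_nonneg by simp
  also have "\<dots> = \<bar>x\<bar> ^ 3 * c * cvar xs"
    by (simp add: y_def eval_nat_numeral)
  finally have "norm (cmart x xs) * norm (complex_of_real (exp y) * \<Sigma> - 1)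
      \<le> norm (cmart x xs) * (\<bar>x\<bar> ^ 3 * c * cvar xs)"
    by (intro mult_left_mono) auto
  moreover have "step (cmart x) xs - cmart x xs = cmart x xs * (complex_of_real (exp y) * \<Sigma> - 1)"
    unfolding st by (simp add: algebra_simps)
  ultimately show ?thesis by (simp only: norm_mult)
qed

text \<open>Consecutive integrals differ by the mean drift, whose bound is a multiple of
  \<open>cvar\<close>; summed over time, \<open>cvar\<close> telescopes to
  \<open>qvar\<close>.\<close>

lemma norm_integral_cmart_le:
  assumes x: "\<bar>x\<bar> * c \<le> 1" and B: "\<And>ys. set ys \<subseteq> D \<Longrightarrow> length ys < n \<Longrightarrow> exp (x\<^sup>2 / 2 * qvar ys) \<le> B"
  shows "norm ((\<integral>\<omega>. cmart x (history n \<omega>) \<partial>M) - 1) \<le> B * (\<bar>x\<bar> ^ 3 * c) * (\<integral>\<omega>. qvar (history n \<omega>) \<partial>M)"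
  using B
proof (induction n)
  case 0
  show ?case by (simp add: prob_space cmart_def mart_Nil qvar_Nil)
next
  case (Suc n)
  let ?I = "\<lambda>n. (\<integral>\<omega>. cmart x (history n \<omega>) \<partial>M)"
  let ?C = "B * (\<bar>x\<bar> ^ 3 * c)"
  let ?J = "(\<integral>\<omega>. step (cmart x) (history n \<omega>) - cmart x (history n \<omega>) \<partial>M)"
  have J: "?I (Suc n) - ?I n = ?J"
    unfolding integral_step[of "cmart x" n]
    by (rule Bochner_Integration.integral_diff[symmetric])
      (rule integrable_history[of "step (cmart x)"] integrable_history[of "cmart x"])+
  have 1: "norm ?J \<le> (\<integral>\<omega>. norm (step (cmart x) (history n \<omega>) - cmart x (history n \<omega>)) \<partial>M)"
    by (rule integral_norm_bound)
  have 2: "(\<integral>\<omega>. norm (step (cmart x) (history n \<omega>) - cmart x (history n \<omega>)) \<partial>M)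
      \<le> (\<integral>\<omega>. ?C * cvar (history n \<omega>) \<partial>M)"
  proof (rule integral_history_mono[of n "\<lambda>ys. norm (step (cmart x) ys - cmart x ys)" "\<lambda>ys. ?C * cvar ys"])
    fix xs assume xs: "set xs \<subseteq> D" "length xs = n"
    have "norm (cmart x xs) * (\<bar>x\<bar> ^ 3 * c * cvar xs) \<le> B * (\<bar>x\<bar> ^ 3 * c * cvar xs)"
      unfolding norm_cmart using Suc.prems[of xs] xs cvar_bounds[OF xs(1)] c_nonneg
      by (intro mult_right_mono) auto
    then show "norm (step (cmart x) xs - cmart x xs) \<le> ?C * cvar xs"
      using norm_step_cmart_diff_le[OF xs(1) x] by (simp only: mult.assoc)
  qed
  have 3: "(\<integral>\<omega>. ?C * cvar (history n \<omega>) \<partial>M) = ?C * (\<integral>\<omega>. cvar (history n \<omega>) \<partial>M)"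
    by (rule integral_mult_right_zero)
  have "(\<integral>\<omega>. cvar (history n \<omega>) \<partial>M) = (\<integral>\<omega>. qvar (history (Suc n) \<omega>) - qvar (history n \<omega>) \<partial>M)"
    by (rule Bochner_Integration.integral_cong[OF refl])
      (simp add: history_Suc qvar_snoc' set_history X_in_D)
  then have 4: "(\<integral>\<omega>. cvar (history n \<omega>) \<partial>M)
      = (\<integral>\<omega>. qvar (history (Suc n) \<omega>) \<partial>M) - (\<integral>\<omega>. qvar (history n \<omega>) \<partial>M)"
    using Bochner_Integration.integral_diff[OF integrable_history[of qvar "Suc n"] integrable_history[of qvar n]]
    by (simp only:)
  have d: "norm (?I (Suc n) - ?I n) \<le> ?C * ((\<integral>\<omega>. qvar (history (Suc n) \<omega>) \<partial>M) - (\<integral>\<omega>. qvar (history n \<omega>) \<partial>M))"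
    using 1 2 unfolding J 3 4 by (rule order.trans)
  have "norm (?I (Suc n) - 1) \<le> norm (?I (Suc n) - ?I n) + norm (?I n - 1)"
    using norm_triangle_ineq[of "?I (Suc n) - ?I n" "?I n - 1"] by (simp only: diff_add_eq_diff_diff_swap diff_add_cancel add_diff_eq)
  also have "\<dots> \<le> ?C * (\<integral>\<omega>. qvar (history (Suc n) \<omega>) \<partial>M)"
  proof -
    have "norm (?I n - 1) \<le> ?C * (\<integral>\<omega>. qvar (history n \<omega>) \<partial>M)"
      by (rule Suc.IH) (use Suc.prems in auto)
    then show ?thesis using d unfolding right_diff_distrib by linarith
  qed
  finally show ?case .
qed

text \<open>The exponential is \<open>exp (- t^2 / 2)\<close> times \<open>cmart\<close>, plus an
  error with factor \<open>1 - r\<close>, where \<open>r\<close> measures how far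
  \<open>qvar / s^2\<close> is from 1. The error vanishes by dominated convergence, with a
  dominating constant supplied by the deterministic bound on \<open>qvar\<close>; the same bound
  makes the total drift of \<open>cmart\<close> of order \<open>1 / s n\<close>.\<close>

lemma clt:
  fixes s :: "nat \<Rightarrow> real"
  assumes s_top: "filterlim s at_top sequentially"
    and bound: "\<forall>\<^sub>F n in sequentially. \<forall>ys. set ys \<subseteq> D \<and> length ys \<le> n \<longrightarrow> qvar ys \<le> C * (s n)\<^sup>2"
    and conv: "AE x in M. (\<lambda>n. qvar (history n x) / (s n)\<^sup>2) \<longlonglongrightarrow> 1"
  shows "weak_conv_m (\<lambda>n. distr M borel (\<lambda>x. mart (history n x) / s n)) std_normal_distribution"
proof (rule levy_continuity)
  have meas: "(\<lambda>x. mart (history n x) / s n) \<in> borel_measurable M" for n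
    by (rule borel_measurable_of_history)
  show "real_distribution (distr M borel (\<lambda>x. mart (history n x) / s n))" for n
    using meas by (rule real_distribution_distr)
  show "real_distribution std_normal_distribution" by (rule real_dist_normal_dist)
  fix t :: real
  have char: "char (distr M borel (\<lambda>x. mart (history n x) / s n)) t = (\<integral>x. iexp (t / s n * mart (history n x)) \<partial>M)" for n
    unfolding char_def using meas by (subst integral_distr) auto
  define r where "r n ys = exp (t\<^sup>2 / 2 * (qvar ys / (s n)\<^sup>2 - 1))" for n ys
  define C' where "C' = exp (t\<^sup>2 / 2 * (C - 1))"
  have "\<forall>\<^sub>F n in sequentially. max 1 (\<bar>t\<bar> * c) \<le> s n" using s_top by (simp only: filterlim_at_top)
  then have "\<forall>\<^sub>F n in sequentially. s n \<ge> 1 \<and> \<bar>t\<bar> * c \<le> s n \<and>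
      (\<forall>ys. set ys \<subseteq> D \<and> length ys \<le> n \<longrightarrow> qvar ys \<le> C * (s n)\<^sup>2)"
    using bound by eventually_elim simp
  then obtain N where N: "\<And>n. n \<ge> N \<Longrightarrow> s n \<ge> 1 \<and> \<bar>t\<bar> * c \<le> s n \<and>
      (\<forall>ys. set ys \<subseteq> D \<and> length ys \<le> n \<longrightarrow> qvar ys \<le> C * (s n)\<^sup>2)"
    unfolding eventually_sequentially by blast
  have r_le: "r n ys \<le> C'" if "n \<ge> N" "set ys \<subseteq> D" "length ys \<le> n" for n ys
  proof -
    have "s n > 0" using N[OF that(1)] by linarith
    then have "qvar ys / (s n)\<^sup>2 \<le> C" using N[OF that(1)] that by (simp add: pos_divide_le_eq)
    then show ?thesis unfolding r_def C'_def by (simp add: mult_left_mono)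
  qed
  have dec: "(\<integral>x. iexp (t / s n * mart (history n x)) \<partial>M)
      = (\<integral>x. iexp (t / s n * mart (history n x)) * complex_of_real (1 - r n (history n x)) \<partial>M)
        + complex_of_real (exp (- (t\<^sup>2 / 2))) * (\<integral>x. cmart (t / s n) (history n x) \<partial>M)" for n
  proof -
    have "iexp (t / s n * mart ys) = iexp (t / s n * mart ys) * complex_of_real (1 - r n ys)
        + complex_of_real (exp (- (t\<^sup>2 / 2))) * cmart (t / s n) ys" for ys
    proof -
      have "r n ys = exp (- (t\<^sup>2 / 2)) * exp ((t / s n)\<^sup>2 / 2 * qvar ys)"
        unfolding r_def exp_add[symmetric] by (simp add: power_divide right_diff_distrib)
      then show ?thesis by (simp add: cmart_def algebra_simps)
    qed
    then have "(\<integral>x. iexp (t / s n * mart (history n x)) \<partial>M) = (\<integral>x. iexp (t / s n * mart (history n x)) * complex_of_real (1 - r n (history n x))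
        + complex_of_real (exp (- (t\<^sup>2 / 2))) * cmart (t / s n) (history n x) \<partial>M)"
      by (intro Bochner_Integration.integral_cong refl)
    also have "\<dots> = (\<integral>x. iexp (t / s n * mart (history n x)) * complex_of_real (1 - r n (history n x)) \<partial>M)
        + (\<integral>x. complex_of_real (exp (- (t\<^sup>2 / 2))) * cmart (t / s n) (history n x) \<partial>M)"
      by (rule Bochner_Integration.integral_add) (rule integrable_history)+
    finally show ?thesis by simp
  qed
  \<comment> \<open>The index is shifted by \<open>N\<close> because the dominating constant is
    valid from \<open>N\<close> on.\<close>
  have "(\<lambda>n. (\<integral>x. iexp (t / s (n + N) * mart (history (n + N) x)) * complex_of_real (1 - r (n + N) (history (n + N) x)) \<partial>M))
      \<longlonglongrightarrow> (\<integral>x. 0 \<partial>M)"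
  proof (rule integral_dominated_convergence[where w = "\<lambda>_. 1 + C'"])
    show "(\<lambda>x. iexp (t / s (n + N) * mart (history (n + N) x)) * complex_of_real (1 - r (n + N) (history (n + N) x))) \<in> borel_measurable M" for n
      by (rule borel_measurable_of_history[of "\<lambda>ys. iexp (t / s (n + N) * mart ys) * complex_of_real (1 - r (n + N) ys)"])
    show "AE x in M. norm (iexp (t / s (n + N) * mart (history (n + N) x)) * complex_of_real (1 - r (n + N) (history (n + N) x))) \<le> 1 + C'" for n
    proof (rule AE_I2)
      fix x assume "x \<in> space M"
      then have "r (n + N) (history (n + N) x) \<le> C'" by (intro r_le set_history) auto
      moreover have "0 \<le> r (n + N) (history (n + N) x)" by (simp add: r_def)
      ultimately have "\<bar>1 - r (n + N) (history (n + N) x)\<bar> \<le> 1 + C'" by linarith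
      then show "norm (iexp (t / s (n + N) * mart (history (n + N) x)) * complex_of_real (1 - r (n + N) (history (n + N) x))) \<le> 1 + C'"
        by (simp only: norm_mult norm_exp_i_times norm_of_real mult_1)
    qed
    show "AE x in M. (\<lambda>n. iexp (t / s (n + N) * mart (history (n + N) x)) * complex_of_real (1 - r (n + N) (history (n + N) x))) \<longlonglongrightarrow> 0"
      using conv
    proof eventually_elim
      case (elim x)
      have "(\<lambda>n. r n (history n x)) \<longlonglongrightarrow> exp (t\<^sup>2 / 2 * (1 - 1))"
        unfolding r_def by (intro tendsto_intros elim)
      then have "(\<lambda>n. 1 - r n (history n x)) \<longlonglongrightarrow> 1 - 1" by (intro tendsto_diff tendsto_const) simp
      then have "(\<lambda>n. \<bar>1 - r n (history n x)\<bar>) \<longlonglongrightarrow> 0" by (simp add: tendsto_rabs_zero)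
      then have "(\<lambda>n. norm (iexp (t / s n * mart (history n x)) * complex_of_real (1 - r n (history n x)))) \<longlonglongrightarrow> 0"
        by (simp only: norm_mult norm_exp_i_times norm_of_real mult_1)
      then have "(\<lambda>n. iexp (t / s n * mart (history n x)) * complex_of_real (1 - r n (history n x))) \<longlonglongrightarrow> 0"
        by (rule tendsto_norm_zero_cancel)
      then show ?case by (rule LIMSEQ_ignore_initial_segment)
    qed
  qed auto
  then have "(\<lambda>n. (\<integral>x. iexp (t / s (n + N) * mart (history (n + N) x)) * complex_of_real (1 - r (n + N) (history (n + N) x)) \<partial>M))
      \<longlonglongrightarrow> 0" by (simp only: Bochner_Integration.integral_zero)
  then have 1: "(\<lambda>n. (\<integral>x. iexp (t / s n * mart (history n x)) * complex_of_real (1 - r n (history n x)) \<partial>M)) \<longlonglongrightarrow> 0"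
    by (rule LIMSEQ_offset)
  have "(\<lambda>n. (\<integral>x. cmart (t / s n) (history n x) \<partial>M) - 1) \<longlonglongrightarrow> 0"
  proof (rule Lim_null_comparison)
    define B where "B = exp (t\<^sup>2 / 2 * C)"
    show "\<forall>\<^sub>F n in sequentially. norm ((\<integral>x. cmart (t / s n) (history n x) \<partial>M) - 1) \<le> B * (\<bar>t\<bar> ^ 3 * c) * C * (1 / s n)"
      using eventually_ge_at_top[of N]
    proof eventually_elim
      case (elim n)
      note Nn = N[OF elim]
      then have s: "s n > 0" by linarith
      have "norm ((\<integral>x. cmart (t / s n) (history n x) \<partial>M) - 1)
          \<le> B * (\<bar>t / s n\<bar> ^ 3 * c) * (\<integral>x. qvar (history n x) \<partial>M)"
      proof (rule norm_integral_cmart_le)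
        show "\<bar>t / s n\<bar> * c \<le> 1" using Nn s by (simp add: field_simps)
        fix ys assume "set ys \<subseteq> D" "length ys < n"
        then have "qvar ys / (s n)\<^sup>2 \<le> C" using Nn s by (simp add: pos_divide_le_eq)
        then have "t\<^sup>2 / 2 * (qvar ys / (s n)\<^sup>2) \<le> t\<^sup>2 / 2 * C" by (rule mult_left_mono) simp
        then show "exp ((t / s n)\<^sup>2 / 2 * qvar ys) \<le> B" by (simp add: B_def power_divide)
      qed
      also have "\<dots> \<le> B * (\<bar>t / s n\<bar> ^ 3 * c) * (\<integral>x. C * (s n)\<^sup>2 \<partial>M)"
        using Nn c_nonneg
        by (intro mult_left_mono integral_history_mono[where h' = "\<lambda>_. C * (s n)\<^sup>2"]) (auto simp: B_def)
      also have "\<dots> = B * (\<bar>t\<bar> ^ 3 * c) * C * (1 / s n)"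
        using s by (simp add: prob_space power_divide eval_nat_numeral)
      finally show ?case .
    qed
    have "(\<lambda>n. 1 / s n) \<longlonglongrightarrow> 0"
      using s_top by (intro tendsto_divide_0[OF tendsto_const]) (rule filterlim_at_top_imp_at_infinity)
    then show "(\<lambda>n. B * (\<bar>t\<bar> ^ 3 * c) * C * (1 / s n)) \<longlonglongrightarrow> 0" by (rule tendsto_mult_right_zero)
  qed
  then have "(\<lambda>n. (\<integral>x. cmart (t / s n) (history n x) \<partial>M)) \<longlonglongrightarrow> 1" by (simp add: LIM_zero_iff)
  then have "(\<lambda>n. (\<integral>x. iexp (t / s n * mart (history n x)) * complex_of_real (1 - r n (history n x)) \<partial>M)
        + complex_of_real (exp (- (t\<^sup>2 / 2))) * (\<integral>x. cmart (t / s n) (history n x) \<partial>M))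
      \<longlonglongrightarrow> 0 + complex_of_real (exp (- (t\<^sup>2 / 2))) * 1"
    using 1 by (intro tendsto_intros)
  then show "(\<lambda>n. char (distr M borel (\<lambda>x. mart (history n x) / s n)) t) \<longlonglongrightarrow> char std_normal_distribution t"
    unfolding char dec[symmetric] by (simp add: char_std_normal_distribution)
qed

end

section \<open>Asymptotics\<close>

text \<open>Toeplitz averaging. It serves twice: for the sums of squared coefficients, and for the
  variance, whose summands are those squares times convergent conditional variances.\<close>

lemma weighted_cesaro:
  fixes w x :: "nat \<Rightarrow> real"
  assumes w: "\<And>i. 0 \<le> w i" and W: "filterlim (\<lambda>n. \<Sum>i<n. w i) at_top sequentially"
    and x: "x \<longlonglongrightarrow> l"
  shows "(\<lambda>n. (\<Sum>i<n. w i * x i) / (\<Sum>i<n. w i)) \<longlonglongrightarrow> l"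
proof (rule LIMSEQ_I)
  fix e :: real assume e: "e > 0"
  define W where "W n = (\<Sum>i<n. w i)" for n
  obtain N where N: "\<And>i. i \<ge> N \<Longrightarrow> \<bar>x i - l\<bar> < e / 2"
    using LIMSEQ_D[OF x, of "e / 2"] e by auto
  define K where "K = (\<Sum>i<N. w i * \<bar>x i - l\<bar>)"
  have "\<forall>\<^sub>F n in sequentially. 2 * K / e + 1 \<le> W n"
    using W unfolding W_def by (simp only: filterlim_at_top)
  then obtain N' where N': "\<And>n. n \<ge> N' \<Longrightarrow> 2 * K / e + 1 \<le> W n"
    unfolding eventually_sequentially by blast
  have K0: "K \<ge> 0" unfolding K_def using w by (auto intro!: sum_nonneg)
  show "\<exists>no. \<forall>n\<ge>no. norm ((\<Sum>i<n. w i * x i) / (\<Sum>i<n. w i) - l) < e"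
  proof (intro exI allI impI)
    fix n assume n: "n \<ge> max N N'"
    have W1: "2 * K / e + 1 \<le> W n" using N' n by simp
    have "0 \<le> 2 * K / e" using K0 e by simp
    then have Wpos: "W n > 0" using W1 by linarith
    have "2 * K / e < W n" using W1 by linarith
    then have KW: "K < e / 2 * W n" using e by (simp add: pos_divide_less_eq mult_ac)
    have "(\<Sum>i<n. w i * x i) / W n - l = (\<Sum>i<n. w i * (x i - l)) / W n"
      using Wpos by (simp add: W_def right_diff_distrib sum_subtractf diff_divide_distrib flip: sum_distrib_right)
    moreover have "\<bar>\<Sum>i<n. w i * (x i - l)\<bar> < e * W n"
    proof -
      have "\<bar>\<Sum>i<n. w i * (x i - l)\<bar> \<le> (\<Sum>i<n. w i * \<bar>x i - l\<bar>)"
        by (rule order.trans[OF sum_abs]) (simp add: abs_mult w)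
      also have "\<dots> = K + (\<Sum>i=N..<n. w i * \<bar>x i - l\<bar>)"
        unfolding K_def using n by (simp add: sum.atLeastLessThan_concat lessThan_atLeast0)
      also have "(\<Sum>i=N..<n. w i * \<bar>x i - l\<bar>) \<le> (\<Sum>i=N..<n. w i * (e / 2))"
        using N w by (intro sum_mono mult_left_mono) (auto intro: less_imp_le)
      also have "\<dots> \<le> (\<Sum>i<n. w i * (e / 2))"
        using w e by (intro sum_mono2) auto
      also have "\<dots> = e / 2 * W n" by (simp add: W_def sum_distrib_left mult.commute)
      finally show ?thesis using KW by simp
    qed
    ultimately show "norm ((\<Sum>i<n. w i * x i) / (\<Sum>i<n. w i) - l) < e"
      using Wpos by (simp add: W_def[symmetric] pos_divide_less_eq)
  qed
qed

text \<open>Each factor cancels the expected growth \<open>1 + \<alpha> / k\<close> of the centred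
  sum. The product stops before \<open>n\<close>, so the values at 0 and at 1 are both 1.\<close>

definition erw_coeff :: "real \<Rightarrow> nat \<Rightarrow> real" where
  "erw_coeff \<alpha> n = (\<Prod>k=1..<n. real k / (real k + \<alpha>))"

lemma erw_coeff_1 [simp]: "erw_coeff \<alpha> (Suc 0) = 1"
  by (simp add: erw_coeff_def)

lemma erw_coeff_0 [simp]: "erw_coeff \<alpha> 0 = 1"
  by (simp add: erw_coeff_def)

lemma erw_coeff_Suc: "n \<ge> 1 \<Longrightarrow> erw_coeff \<alpha> (Suc n) = erw_coeff \<alpha> n * (real n / (real n + \<alpha>))"
  by (simp add: erw_coeff_def)

lemma erw_coeff_bounds:
  assumes "0 \<le> \<alpha>"
  shows "0 < erw_coeff \<alpha> n" "erw_coeff \<alpha> n \<le> 1"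
  unfolding erw_coeff_def using assms by (auto intro!: prod_pos prod_le_1)

lemma erw_coeff_eq_pochhammer:
  assumes "0 \<le> \<alpha>"
  shows "erw_coeff \<alpha> (Suc n) = fact n / pochhammer (\<alpha> + 1) n"
proof (induction n)
  case (Suc n)
  have "real n + 1 + \<alpha> \<noteq> 0" using assms by linarith
  then show ?case
    using Suc erw_coeff_Suc[of "Suc n" \<alpha>] by (simp add: pochhammer_Suc field_simps)
qed simp

text \<open>The Pochhammer form is Gauss's product for \<open>Gamma (\<alpha> + 1)\<close> up to one
  missing factor in the denominator and a shift from \<open>n\<close> to \<open>n + 1\<close>; both
  corrections tend to 1.\<close>

lemma erw_coeff_asymp:
  assumes "0 \<le> \<alpha>"
  shows "(\<lambda>n. erw_coeff \<alpha> (Suc n) * real (Suc n) powr \<alpha>) \<longlonglongrightarrow> Gamma (\<alpha> + 1)"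
proof -
  have "(\<lambda>n. Gamma_series (\<alpha> + 1) n * ((real n + \<alpha> + 1) / real n) * ((real n + 1) / real n) powr \<alpha>)
      \<longlonglongrightarrow> Gamma (\<alpha> + 1) * 1 * 1"
  proof (intro tendsto_mult Gamma_series_LIMSEQ)
    show "(\<lambda>n. (real n + \<alpha> + 1) / real n) \<longlonglongrightarrow> 1" by real_asymp
    show "(\<lambda>n. ((real n + 1) / real n) powr \<alpha>) \<longlonglongrightarrow> 1" by real_asymp
  qed
  moreover have "\<forall>\<^sub>F n in sequentially.
      Gamma_series (\<alpha> + 1) n * ((real n + \<alpha> + 1) / real n) * ((real n + 1) / real n) powr \<alpha>
        = erw_coeff \<alpha> (Suc n) * real (Suc n) powr \<alpha>"
    using eventually_gt_at_top[of 0]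
  proof eventually_elim
    case (elim n)
    have pos: "pochhammer (\<alpha> + 1) n > 0" using assms by (intro pochhammer_pos) auto
    have "Gamma_series (\<alpha> + 1) n = fact n * (real n * real n powr \<alpha>) / (pochhammer (\<alpha> + 1) n * (\<alpha> + 1 + real n))"
      using elim by (simp add: Gamma_series_def pochhammer_Suc powr_def distrib_right exp_add)
    then have "Gamma_series (\<alpha> + 1) n * ((real n + \<alpha> + 1) / real n) = fact n / pochhammer (\<alpha> + 1) n * real n powr \<alpha>"
    proof -
      have "f * (m * q) / (P * A) * (A / m) = f / P * q" if "P \<noteq> 0" "A \<noteq> 0" "m \<noteq> 0" for f m q P A :: real
        using that by (simp add: field_simps)
      moreover have "real n + \<alpha> + 1 = \<alpha> + 1 + real n" by simp
      ultimately show ?thesis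
        using \<open>Gamma_series (\<alpha> + 1) n = _\<close> elim assms pos by (simp only:)
    qed
    moreover have "real n powr \<alpha> * ((real n + 1) / real n) powr \<alpha> = real (Suc n) powr \<alpha>"
      using elim by (simp add: add.commute flip: powr_mult)
    ultimately show ?case
      unfolding erw_coeff_eq_pochhammer[OF assms] by (simp add: mult.assoc)
  qed
  ultimately show ?thesis by (simp add: Lim_transform_eventually)
qed

text \<open>The weights are the increments of \<open>n powr (1 - 2 * \<alpha>)\<close>, so their
  sums telescope, and \<open>\<alpha> < 1/2\<close> makes them diverge. The quotients of squared
  coefficient and weight converge, and averaging finishes.\<close>

lemma erw_coeff_square_sum_asymp:
  assumes "0 \<le> \<alpha>" "\<alpha> < 1/2"
  shows "(\<lambda>n. (\<Sum>i<n. (erw_coeff \<alpha> (Suc i))\<^sup>2) / real n powr (1 - 2 * \<alpha>))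
    \<longlonglongrightarrow> (Gamma (\<alpha> + 1))\<^sup>2 / (1 - 2 * \<alpha>)"
proof -
  define s where "s = 1 - 2 * \<alpha>"
  have s: "0 < s" "s \<le> 1" using assms by (auto simp: s_def)
  define w where "w i = (real (Suc i)) powr s - (real i) powr s" for i
  define x where "x i = (erw_coeff \<alpha> (Suc i))\<^sup>2 / w i" for i
  have wpos: "w i > 0" for i using s by (simp add: w_def powr_less_mono2)
  have W: "(\<Sum>i<n. w i) = real n powr s" for n
    unfolding w_def using s by (subst sum_lessThan_telescope) simp
  have "(\<lambda>i. (erw_coeff \<alpha> (Suc i) * real (Suc i) powr \<alpha>)\<^sup>2 / (w i * (real (Suc i)) powr (2 * \<alpha>)))
      \<longlonglongrightarrow> (Gamma (\<alpha> + 1))\<^sup>2 / s"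
  proof (intro tendsto_divide tendsto_power erw_coeff_asymp assms)
    have "(\<lambda>i. ((real i + 1) powr s - (real i) powr s) * (real i + 1) powr (1 - s)) \<longlonglongrightarrow> s"
      using s by real_asymp
    then show "(\<lambda>i. w i * real (Suc i) powr (2 * \<alpha>)) \<longlonglongrightarrow> s"
      by (simp add: w_def s_def add.commute)
  qed (use s in auto)
  moreover have "(erw_coeff \<alpha> (Suc i) * real (Suc i) powr \<alpha>)\<^sup>2 / (w i * (real (Suc i)) powr (2 * \<alpha>)) = x i" for i
  proof -
    have "(real (Suc i) powr \<alpha>)\<^sup>2 = real (Suc i) powr (2 * \<alpha>)" by (simp add: power2_eq_square flip: powr_add)
    then show ?thesis by (simp add: x_def power_mult_distrib)
  qed
  ultimately have x: "x \<longlonglongrightarrow> (Gamma (\<alpha> + 1))\<^sup>2 / s" by simp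
  have "filterlim (\<lambda>n. real n powr s) at_top sequentially" using s by real_asymp
  then have "(\<lambda>n. (\<Sum>i<n. w i * x i) / (\<Sum>i<n. w i)) \<longlonglongrightarrow> (Gamma (\<alpha> + 1))\<^sup>2 / s"
    using wpos by (intro weighted_cesaro x) (auto simp: W less_imp_le)
  moreover have "w i * x i = (erw_coeff \<alpha> (Suc i))\<^sup>2" for i
    using wpos[of i] by (simp add: x_def)
  ultimately show ?thesis by (simp add: W s_def)
qed

section \<open>Replacing the random variance in the iterated-logarithm scale\<close>

lemma tendsto_ln_ratio:
  fixes f g :: "nat \<Rightarrow> real"
  assumes fg: "(\<lambda>n. f n / g n) \<longlonglongrightarrow> 1" and g: "filterlim g at_top sequentially"
  shows "(\<lambda>n. ln (f n) / ln (g n)) \<longlonglongrightarrow> 1" "filterlim (\<lambda>n. ln (g n)) at_top sequentially"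
proof -
  show lg: "filterlim (\<lambda>n. ln (g n)) at_top sequentially"
    using ln_at_top g by (rule filterlim_compose)
  have "(\<lambda>n. ln (f n / g n)) \<longlonglongrightarrow> ln 1" by (intro tendsto_ln fg) simp
  then have "(\<lambda>n. ln (f n / g n) / ln (g n)) \<longlonglongrightarrow> 0"
    by (intro real_tendsto_divide_at_top[OF _ lg]) simp
  then have "(\<lambda>n. 1 + ln (f n / g n) / ln (g n)) \<longlonglongrightarrow> 1 + 0" by (intro tendsto_add tendsto_const)
  moreover have "\<forall>\<^sub>F n in sequentially. f n / g n > 0"
    using fg by (rule order_tendstoD) simp
  then have "\<forall>\<^sub>F n in sequentially. 1 + ln (f n / g n) / ln (g n) = ln (f n) / ln (g n)"
    using filterlim_at_top_dense[THEN iffD1, OF g, rule_format, of 1]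
  proof eventually_elim
    case (elim n)
    then have "f n > 0" "ln (g n) > 0" by (auto simp: zero_less_divide_iff)
    then show ?case using elim by (simp add: ln_div diff_divide_distrib)
  qed
  ultimately show "(\<lambda>n. ln (f n) / ln (g n)) \<longlonglongrightarrow> 1"
    by (auto elim: Lim_transform_eventually)
qed

text \<open>Asymptotic equivalence to a divergent sequence survives a logarithm, hence also two.
  Here \<open>v\<close> is the random variance, \<open>B\<close> its deterministic equivalent inside
  the double logarithm, and \<open>d\<close> the squared normaliser outside it.\<close>

lemma lil_scale_ratio:
  fixes v B d :: "nat \<Rightarrow> real"
  assumes vB: "(\<lambda>n. v n / B n) \<longlonglongrightarrow> 1" and dB: "(\<lambda>n. d n / B n) \<longlonglongrightarrow> 1"
    and B: "filterlim B at_top sequentially"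
  shows "(\<lambda>n. lil_scale (v n) / sqrt (2 * d n * ln (ln (B n)))) \<longlonglongrightarrow> 1"
proof -
  note l1 = tendsto_ln_ratio[OF vB B]
  note l2 = tendsto_ln_ratio[OF l1]
  have "(\<lambda>n. v n / B n / (d n / B n) * (ln (ln (v n)) / ln (ln (B n)))) \<longlonglongrightarrow> 1 / 1 * 1"
    by (intro tendsto_mult tendsto_divide vB dB l2) simp
  then have "(\<lambda>n. sqrt (v n / B n / (d n / B n) * (ln (ln (v n)) / ln (ln (B n))))) \<longlonglongrightarrow> 1"
    using tendsto_real_sqrt by fastforce
  moreover have "\<forall>\<^sub>F n in sequentially. B n > 0" using B by (simp add: filterlim_at_top_dense)
  then have "\<forall>\<^sub>F n in sequentially. sqrt (v n / B n / (d n / B n) * (ln (ln (v n)) / ln (ln (B n))))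
      = lil_scale (v n) / sqrt (2 * d n * ln (ln (B n)))"
    by eventually_elim (simp add: lil_scale_def flip: real_sqrt_divide)
  ultimately show ?thesis by (rule Lim_transform_eventually)
qed

text \<open>Tolerances run through reciprocals of integers, so that the almost sure statements for
  all of them can be intersected. \<open>Suc (Suc k)\<close> keeps the lower tolerance strictly
  below 1, as the lower half requires.\<close>

lemma limsup_eq_one_of_lil_scale:
  fixes m v d :: "nat \<Rightarrow> real"
  assumes upper: "\<And>k. \<forall>\<^sub>F n in sequentially. m n \<le> (1 + inverse (real (Suc k)))\<^sup>2 * lil_scale (v n)"
    and lower: "\<And>k. \<exists>\<^sub>F n in sequentially. (1 - inverse (real (Suc (Suc k)))) * lil_scale (v n) \<le> m n"
    and ratio: "(\<lambda>n. lil_scale (v n) / d n) \<longlonglongrightarrow> 1" and d: "\<forall>\<^sub>F n in sequentially. d n > 0"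
  shows "limsup (\<lambda>n. ereal (m n / d n)) = 1"
proof (rule antisym)
  show "limsup (\<lambda>n. ereal (m n / d n)) \<le> 1"
    unfolding Limsup_le_iff
  proof (intro allI impI)
    fix y :: ereal assume "y > 1"
    then obtain z where z: "1 < z" "ereal z < y" using ereal_dense2[of 1 y] by (auto simp: one_ereal_def)
    have "0 < min 1 ((z - 1) / 4)" using z by simp
    then obtain k where k: "inverse (real (Suc k)) < min 1 ((z - 1) / 4)" using reals_Archimedean by blast
    define \<epsilon> where "\<epsilon> = inverse (real (Suc k))"
    have e: "0 < \<epsilon>" "\<epsilon> \<le> 1" using k by (auto simp: \<epsilon>_def)
    have e4: "\<epsilon> \<le> (z - 1) / 4" using k unfolding \<epsilon>_def by (auto simp only: min_less_iff_conj)
    have "\<epsilon> * \<epsilon> \<le> 1 * \<epsilon>" using e by (intro mult_right_mono) auto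
    moreover have "(1 + \<epsilon>)\<^sup>2 = 1 + 2 * \<epsilon> + \<epsilon> * \<epsilon>" by (simp add: power2_eq_square algebra_simps)
    ultimately have "(1 + \<epsilon>)\<^sup>2 < z" using e e4 by argo
    moreover have "(\<lambda>n. (1 + \<epsilon>)\<^sup>2 * (lil_scale (v n) / d n)) \<longlonglongrightarrow> (1 + \<epsilon>)\<^sup>2 * 1"
      by (intro tendsto_mult tendsto_const ratio)
    ultimately have "\<forall>\<^sub>F n in sequentially. (1 + \<epsilon>)\<^sup>2 * (lil_scale (v n) / d n) < z"
      by (intro order_tendstoD(2)) auto
    then show "\<forall>\<^sub>F n in sequentially. ereal (m n / d n) < y"
      using upper[of k, folded \<epsilon>_def] d
    proof eventually_elim
      case (elim n)
      then have "m n / d n \<le> (1 + \<epsilon>)\<^sup>2 * (lil_scale (v n) / d n)"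
        by (simp add: divide_right_mono)
      then have "m n / d n < z" using elim by linarith
      then show ?case using z(2) by (metis ereal_less_eq(3) less_imp_le order.strict_trans1)
    qed
  qed
  show "1 \<le> limsup (\<lambda>n. ereal (m n / d n))"
  proof (rule ccontr)
    assume "\<not> 1 \<le> limsup (\<lambda>n. ereal (m n / d n))"
    then have "limsup (\<lambda>n. ereal (m n / d n)) < 1" by simp
    then obtain z where z: "limsup (\<lambda>n. ereal (m n / d n)) < ereal z" "z < 1"
      using ereal_dense2[of _ 1] by (auto simp: one_ereal_def)
    have "0 < (1 - z) / 2" using z by simp
    then obtain k where k: "inverse (real (Suc k)) < (1 - z) / 2" using reals_Archimedean by blast
    define \<epsilon> where "\<epsilon> = inverse (real (Suc (Suc k)))"
    have "\<epsilon> \<le> inverse (real (Suc k))" unfolding \<epsilon>_def by (rule le_imp_inverse_le) auto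
    then have e2: "\<epsilon> \<le> (1 - z) / 2" using k by linarith
    have "\<forall>\<^sub>F n in sequentially. ereal (m n / d n) < ereal z" using z(1) by (rule Limsup_lessD)
    moreover have "\<forall>\<^sub>F n in sequentially. z < (1 - \<epsilon>) * (lil_scale (v n) / d n)"
    proof (rule order_tendstoD(1))
      show "(\<lambda>n. (1 - \<epsilon>) * (lil_scale (v n) / d n)) \<longlonglongrightarrow> (1 - \<epsilon>) * 1"
        by (intro tendsto_mult tendsto_const ratio)
      show "z < (1 - \<epsilon>) * 1" using e2 z(2) by argo
    qed
    ultimately have "\<forall>\<^sub>F n in sequentially. \<not> (1 - \<epsilon>) * lil_scale (v n) \<le> m n"
      using d
    proof eventually_elim
      case (elim n)
      show ?case
      proof
        assume "(1 - \<epsilon>) * lil_scale (v n) \<le> m n"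
        then have "(1 - \<epsilon>) * lil_scale (v n) / d n \<le> m n / d n" using elim by (intro divide_right_mono) auto
        then show False using elim by simp
      qed
    qed
    then show False using lower[of k, folded \<epsilon>_def] by (simp add: frequently_def)
  qed
qed

section \<open>The elephant random walk\<close>

lemma cnt_simps [simp]:
  "cnt [] v = 0" "cnt (x # xs) v = (if x = v then 1 else 0) + cnt xs v"
  by (auto simp: cnt_def)

lemma cnt_nonneg: "0 \<le> cnt xs v"
  by (simp add: cnt_def)

lemma cnt_sums:
  assumes "set xs \<subseteq> {-1, 0, 1::real}"
  shows "cnt xs 1 + cnt xs (-1) + cnt xs 0 = length xs"
    and "cnt xs 1 - cnt xs (-1) = sum_list xs"
    and "cnt xs 1 + cnt xs (-1) = (\<Sum>v\<leftarrow>xs. v\<^sup>2)"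
  using assms by (induction xs) auto

definition erw_trans :: "real \<Rightarrow> real \<Rightarrow> real \<Rightarrow> real \<Rightarrow> real list \<Rightarrow> real \<Rightarrow> real" where
  "erw_trans p q r \<theta> xs v =
    (let n = real (length xs); np = cnt xs 1; nm = cnt xs (-1); nz = cnt xs 0 in
     if xs = [] then (if v = 1 then p else if v = -1 then q else r)
     else if v = 1 then \<theta> * (np / n * p + nm / n * q) + (1 - \<theta>) * p
     else if v = -1 then \<theta> * (nm / n * p + np / n * q) + (1 - \<theta>) * q
     else \<theta> * (p + q) * (nz / n) + r)"

locale elephant_walk = prob_space M for M :: "'a measure" +
  fixes X :: "nat \<Rightarrow> 'a \<Rightarrow> real" and p q r \<theta> :: real
  assumes pqr: "p \<ge> 0" "q \<ge> 0" "r \<ge> 0" "p + q + r = 1"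
    and th: "0 \<le> \<theta>" "\<theta> < 1"
    and X_meas: "\<And>i. X i \<in> borel_measurable M"
    and X_vals: "\<And>i x. x \<in> space M \<Longrightarrow> X (Suc i) x \<in> {-1, 0, 1}"
    and X_trans: "\<And>xs v. set xs \<subseteq> {-1, 0, 1} \<Longrightarrow> v \<in> {-1, 0, 1} \<Longrightarrow>
      prob (path_event M X xs \<inter> {x \<in> space M. X (Suc (length xs)) x = v})
        = prob (path_event M X xs) * erw_trans p q r \<theta> xs v"
begin

abbreviation \<alpha> where "\<alpha> \<equiv> (p - q) * \<theta>"
abbreviation \<omega> where "\<omega> \<equiv> (p - q) * (1 - \<theta>)"
abbreviation \<tau> where "\<tau> \<equiv> (1 - \<theta>) * (p + q)"
abbreviation \<gamma> where "\<gamma> \<equiv> (p + q) * \<theta>"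
abbreviation \<phi> where "\<phi> \<equiv> \<tau> / (1 - \<gamma>) - (\<omega> / (1 - \<alpha>))\<^sup>2"
abbreviation tr where "tr \<equiv> erw_trans p q r \<theta>"
abbreviation D where "D \<equiv> {-1, 0, 1::real}"

section \<open>Transition probabilities and their moments\<close>

lemma tr_Nil: "tr [] 1 = p" "tr [] (-1) = q" "tr [] 0 = r"
  by (simp_all add: erw_trans_def)

lemma tr_Cons:
  assumes "xs \<noteq> []"
  shows "tr xs 1 = \<theta> * (cnt xs 1 / length xs * p + cnt xs (-1) / length xs * q) + (1 - \<theta>) * p"
    and "tr xs (-1) = \<theta> * (cnt xs (-1) / length xs * p + cnt xs 1 / length xs * q) + (1 - \<theta>) * q"
    and "tr xs 0 = \<theta> * (p + q) * (cnt xs 0 / length xs) + r"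
  using assms by (simp_all add: erw_trans_def Let_def)

text \<open>With weight 1 - \<theta> a step is a fresh copy of the first one, whatever the memory;
  for the value 0 this part is contained in the summand \<open>r\<close>.\<close>

lemma tr_ge:
  assumes "v \<in> D"
  shows "(1 - \<theta>) * tr [] v \<le> tr xs v"
proof (cases "xs = []")
  case True
  have "0 \<le> tr [] v" using pqr by (auto simp: erw_trans_def)
  then show ?thesis using True th by (simp add: mult_left_le_one_le)
next
  case False
  have nn: "0 \<le> cnt xs u / length xs" for u by (simp add: cnt_nonneg)
  have "\<theta> * r \<ge> 0" using pqr th by simp
  moreover have "0 \<le> \<theta> * (p + q) * (cnt xs 0 / length xs)"
    using pqr th nn by (intro mult_nonneg_nonneg) auto
  moreover have "0 \<le> \<theta> * (cnt xs a / length xs * p + cnt xs b / length xs * q)" for a b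
    using pqr th nn by (intro mult_nonneg_nonneg add_nonneg_nonneg) auto
  moreover have "(1 - \<theta>) * r \<le> r" using \<open>\<theta> * r \<ge> 0\<close> by (simp add: left_diff_distrib)
  moreover have "v = 1 \<or> v = -1 \<or> v = 0" using assms by auto
  ultimately show ?thesis
    by (elim disjE; hypsubst) (simp_all only: tr_Nil tr_Cons[OF False] le_add_same_cancel2 add_increasing)
qed

lemma tr_nonneg: "v \<in> D \<Longrightarrow> 0 \<le> tr xs v"
proof -
  assume v: "v \<in> D"
  then have "0 \<le> tr [] v" using pqr tr_Nil by auto
  then have "0 \<le> (1 - \<theta>) * tr [] v" using th by simp
  then show ?thesis using tr_ge[OF v, of xs] by linarith
qed

lemma cnt_fractions:
  assumes "set xs \<subseteq> D" "xs \<noteq> []"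
  shows "cnt xs 0 / length xs = 1 - (cnt xs 1 / length xs + cnt xs (-1) / length xs)"
    and "cnt xs 1 / length xs - cnt xs (-1) / length xs = sum_list xs / length xs"
    and "cnt xs 1 / length xs + cnt xs (-1) / length xs = (\<Sum>v\<leftarrow>xs. v\<^sup>2) / length xs"
proof -
  have "real (length xs) > 0" using assms by simp
  then show "cnt xs 0 / length xs = 1 - (cnt xs 1 / length xs + cnt xs (-1) / length xs)"
    using cnt_sums(1)[OF assms(1)] by (simp add: field_simps)
  show "cnt xs 1 / length xs - cnt xs (-1) / length xs = sum_list xs / length xs"
    unfolding cnt_sums(2)[OF assms(1), symmetric] by (rule diff_divide_distrib[symmetric])
  show "cnt xs 1 / length xs + cnt xs (-1) / length xs = (\<Sum>v\<leftarrow>xs. v\<^sup>2) / length xs"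
    unfolding cnt_sums(3)[OF assms(1), symmetric] by (rule add_divide_distrib[symmetric])
qed

lemma sum_D: "(\<Sum>v\<in>D. f v) = f (-1) + f 0 + f 1" for f :: "real \<Rightarrow> real"
  by simp

text \<open>Only the proportions of the three values matter. The mean is affine in the average step
  and the second moment in the proportion of nonzero steps, which is the form that the law of large
  numbers expects, with slopes \<alpha>, \<gamma> and intercepts \<omega>, \<tau>.\<close>

lemma tr_sums:
  assumes xs: "set xs \<subseteq> D"
  shows "(\<Sum>v\<in>D. tr xs v) = 1"
    and "xs \<noteq> [] \<Longrightarrow> (\<Sum>v\<in>D. tr xs v * v) = \<alpha> * sum_list xs / length xs + \<omega>"
    and "xs \<noteq> [] \<Longrightarrow> (\<Sum>v\<in>D. tr xs v * v\<^sup>2) = \<gamma> * (\<Sum>v\<leftarrow>xs. v\<^sup>2) / length xs + \<tau>"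
proof -
  define a b z where "a = cnt xs 1 / length xs" and "b = cnt xs (-1) / length xs" and "z = cnt xs 0 / length xs"
  have t: "tr xs 1 = \<theta> * (a * p + b * q) + (1 - \<theta>) * p" "tr xs (-1) = \<theta> * (b * p + a * q) + (1 - \<theta>) * q"
    "tr xs 0 = \<theta> * (p + q) * z + r" if "xs \<noteq> []"
    unfolding a_def b_def z_def by (rule tr_Cons[OF that])+
  note fr = cnt_fractions[OF xs, folded a_def b_def z_def]
  show "(\<Sum>v\<in>D. tr xs v) = 1"
  proof (cases "xs = []")
    case True
    then show ?thesis using pqr by (simp add: erw_trans_def)
  next
    case False
    have "(\<Sum>v\<in>D. tr xs v) = \<theta> * (p + q) * (a + b + z) + (1 - \<theta>) * (p + q) + r"
      unfolding sum_D t[OF False] by (simp add: algebra_simps)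
    also have "\<dots> = p + q + r" unfolding fr(1)[OF False] by (simp add: algebra_simps)
    finally show ?thesis using pqr by simp
  qed
  show "(\<Sum>v\<in>D. tr xs v * v) = \<alpha> * sum_list xs / length xs + \<omega>" if ne: "xs \<noteq> []"
  proof -
    have "\<alpha> * sum_list xs / length xs = \<alpha> * (a - b)" unfolding fr(2)[OF ne] by simp
    then show ?thesis unfolding sum_D t[OF ne] by (simp add: algebra_simps)
  qed
  show "(\<Sum>v\<in>D. tr xs v * v\<^sup>2) = \<gamma> * (\<Sum>v\<leftarrow>xs. v\<^sup>2) / length xs + \<tau>" if ne: "xs \<noteq> []"
  proof -
    have "\<gamma> * (\<Sum>v\<leftarrow>xs. v\<^sup>2) / length xs = \<gamma> * (a + b)" unfolding fr(3)[OF ne] by simp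
    then show ?thesis unfolding sum_D t[OF ne] by (simp add: algebra_simps)
  qed
qed

sublocale path_process M X D tr
  by unfold_locales (use X_meas X_vals X_trans tr_nonneg tr_sums(1) in auto)

section \<open>Conditional mean and variance of a step\<close>

definition step_mean :: "real list \<Rightarrow> real" where
  "step_mean xs = (\<Sum>v\<in>D. tr xs v * v)"

definition step_var :: "real list \<Rightarrow> real" where
  "step_var xs = (\<Sum>v\<in>D. tr xs v * (v - step_mean xs)\<^sup>2)"

lemma step_var_eq: "set xs \<subseteq> D \<Longrightarrow> step_var xs = (\<Sum>v\<in>D. tr xs v * v\<^sup>2) - (step_mean xs)\<^sup>2"
proof -
  assume xs: "set xs \<subseteq> D"
  have "step_var xs = (\<Sum>v\<in>D. tr xs v * v\<^sup>2) - 2 * step_mean xs * (\<Sum>v\<in>D. tr xs v * v) + (step_mean xs)\<^sup>2 * (\<Sum>v\<in>D. tr xs v)"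
    unfolding step_var_def sum_D by (simp add: power2_eq_square algebra_simps)
  then show ?thesis using tr_sums(1)[OF xs] by (simp add: step_mean_def[symmetric] power2_eq_square)
qed

lemma abs_mean_le: "set xs \<subseteq> D \<Longrightarrow> \<bar>step_mean xs\<bar> \<le> 1"
  using tr_sums(1)[of xs] tr_nonneg[of "-1" xs] tr_nonneg[of 0 xs] tr_nonneg[of 1 xs]
  unfolding step_mean_def sum_D by (auto simp: abs_le_iff)

text \<open>By \<open>tr_ge\<close> the variance is at least 1 - \<theta> times the mean square of
  the first step about \<open>step_mean xs\<close>. A mean square is smallest about the true mean,
  where it is the variance \<open>p + q - (p - q)^2\<close> of the first step.\<close>

lemma step_var_bounds:
  assumes xs: "set xs \<subseteq> D"
  shows "(1 - \<theta>) * (p + q - (p - q)\<^sup>2) \<le> step_var xs" "step_var xs \<le> 1" "0 \<le> step_var xs"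
proof -
  let ?m = "step_mean xs"
  have "(1 - \<theta>) * (p + q - (p - q)\<^sup>2) \<le> (1 - \<theta>) * (q * (-1 - ?m)\<^sup>2 + r * (0 - ?m)\<^sup>2 + p * (1 - ?m)\<^sup>2)"
  proof (rule mult_left_mono)
    have "q * (-1 - ?m)\<^sup>2 + r * (0 - ?m)\<^sup>2 + p * (1 - ?m)\<^sup>2 = (p + q) - 2 * ?m * (p - q) + ?m\<^sup>2 * (p + q + r)"
      by (simp add: power2_eq_square algebra_simps)
    also have "\<dots> = (p + q - (p - q)\<^sup>2) + ((p - q) - ?m)\<^sup>2"
      unfolding pqr(4) by (simp add: power2_eq_square algebra_simps)
    finally show "p + q - (p - q)\<^sup>2 \<le> q * (-1 - ?m)\<^sup>2 + r * (0 - ?m)\<^sup>2 + p * (1 - ?m)\<^sup>2" by simp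
  qed (use th in simp)
  also have "\<dots> = (\<Sum>v\<in>D. ((1 - \<theta>) * tr [] v) * (v - ?m)\<^sup>2)"
    unfolding sum_D by (simp add: erw_trans_def algebra_simps)
  also have "\<dots> \<le> step_var xs" unfolding step_var_def by (intro sum_mono mult_right_mono tr_ge) auto
  finally show "(1 - \<theta>) * (p + q - (p - q)\<^sup>2) \<le> step_var xs" .
  show "0 \<le> step_var xs" unfolding step_var_def by (intro sum_nonneg mult_nonneg_nonneg tr_nonneg) auto
  have "(\<Sum>v\<in>D. tr xs v * v\<^sup>2) \<le> (\<Sum>v\<in>D. tr xs v)" using tr_nonneg[of 0 xs] by simp
  then show "step_var xs \<le> 1" unfolding step_var_eq[OF xs] tr_sums(1)[OF xs] using zero_le_power2[of ?m] by linarith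
qed

lemma gamma_bounds: "0 \<le> \<gamma>" "\<gamma> < 1"
proof -
  show "0 \<le> \<gamma>" using pqr th by simp
  have "\<gamma> \<le> 1 * \<theta>" using pqr th by (intro mult_right_mono) auto
  then show "\<gamma> < 1" using th by linarith
qed

text \<open>The limits of the two averages are fixed points of the affine maps giving the
  conditional moments, so these moments converge to the same limits, and \<phi> is the resulting
  variance.\<close>

lemma step_var_tendsto:
  assumes "0 \<le> \<alpha>" "\<alpha> < 1"
  shows "AE x in M. (\<lambda>n. step_var (history n x)) \<longlonglongrightarrow> \<phi>"
proof -
  have 1: "AE x in M. (\<lambda>n. sum_list (history n x) / n) \<longlonglongrightarrow> \<omega> / (1 - \<alpha>)"
    by (rule reinforced_lln[where f = "\<lambda>v. v"]) (use assms tr_sums(2) in auto)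
  have 2: "AE x in M. (\<lambda>n. (\<Sum>v\<leftarrow>history n x. v\<^sup>2) / n) \<longlonglongrightarrow> \<tau> / (1 - \<gamma>)"
    by (rule reinforced_lln[where f = "\<lambda>v. v\<^sup>2"]) (use gamma_bounds tr_sums(3) in auto)
  from 1 2 AE_space show ?thesis
  proof eventually_elim
    case (elim x)
    have "(\<lambda>n. \<gamma> * ((\<Sum>v\<leftarrow>history n x. v\<^sup>2) / n) + \<tau> - (\<alpha> * (sum_list (history n x) / n) + \<omega>)\<^sup>2)
      \<longlonglongrightarrow> \<gamma> * (\<tau> / (1 - \<gamma>)) + \<tau> - (\<alpha> * (\<omega> / (1 - \<alpha>)) + \<omega>)\<^sup>2"
      by (intro tendsto_intros elim)
    moreover have "g * (t / (1 - g)) + t = t / (1 - g)" if "g < 1" for g t :: real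
      using that by (simp add: divide_simps) (simp add: algebra_simps)
    then have "\<gamma> * (\<tau> / (1 - \<gamma>)) + \<tau> = \<tau> / (1 - \<gamma>)" "\<alpha> * (\<omega> / (1 - \<alpha>)) + \<omega> = \<omega> / (1 - \<alpha>)"
      using gamma_bounds assms by blast+
    ultimately have lim: "(\<lambda>n. \<gamma> * ((\<Sum>v\<leftarrow>history n x. v\<^sup>2) / n) + \<tau> - (\<alpha> * (sum_list (history n x) / n) + \<omega>)\<^sup>2) \<longlonglongrightarrow> \<phi>"
      by (simp only:)
    have "\<forall>\<^sub>F n in sequentially. \<gamma> * ((\<Sum>v\<leftarrow>history n x. v\<^sup>2) / n) + \<tau> - (\<alpha> * (sum_list (history n x) / n) + \<omega>)\<^sup>2
        = step_var (history n x)"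
      using eventually_gt_at_top[of 0]
    proof eventually_elim
      case (elim n)
      have s: "set (history n x) \<subseteq> D" using \<open>x \<in> space M\<close> by (rule set_history)
      have ne: "history n x \<noteq> []" using elim length_history[of n x] by (metis length_0_conv less_irrefl)
      show ?case unfolding step_var_eq[OF s] step_mean_def tr_sums(2)[OF s ne] tr_sums(3)[OF s ne] by simp
    qed
    then show ?case by (rule Lim_transform_eventually[OF lim])
  qed
qed

section \<open>Centring and the martingale\<close>

definition center :: "nat \<Rightarrow> real" where
  "center n = expectation (psum X n)"

lemma psum_eq: "psum X n x = sum_list (history n x)"
  by (induction n) (simp_all add: psum_def history_Suc)

lemma center_0: "center 0 = 0"
  by (simp add: center_def psum_def[abs_def])

lemma center_1: "center 1 = step_mean []"
proof -
  have "center 1 = (\<integral>x. sum_list (history (Suc 0) x) \<partial>M)" by (simp add: center_def psum_eq[abs_def])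
  also have "\<dots> = (\<integral>x. step sum_list (history 0 x) \<partial>M)" by (rule integral_step)
  also have "\<dots> = step_mean []" by (simp add: prob_space step_def step_mean_def)
  finally show ?thesis .
qed

lemma center_Suc:
  assumes "n \<ge> 1"
  shows "center (Suc n) = (1 + \<alpha> / n) * center n + \<omega>"
proof -
  have "center (Suc n) = (\<integral>x. sum_list (history (Suc n) x) \<partial>M)" by (simp add: center_def psum_eq[abs_def])
  also have "\<dots> = (\<integral>x. step sum_list (history n x) \<partial>M)" by (rule integral_step)
  also have "\<dots> = (\<integral>x. (1 + \<alpha> / n) * sum_list (history n x) + \<omega> \<partial>M)"
  proof (rule Bochner_Integration.integral_cong[OF refl])
    fix x assume "x \<in> space M"
    then have s: "set (history n x) \<subseteq> D" by (rule set_history)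
    have ne: "history n x \<noteq> []" using assms length_history[of n x] by (metis length_0_conv not_one_le_zero)
    have "step sum_list (history n x) = (\<Sum>v\<in>D. tr (history n x) v) * sum_list (history n x) + (\<Sum>v\<in>D. tr (history n x) v * v)"
      unfolding step_def sum_distrib_right sum.distrib[symmetric] by (intro sum.cong) (auto simp: algebra_simps)
    also have "\<dots> = (1 + \<alpha> / n) * sum_list (history n x) + \<omega>"
      unfolding tr_sums(1)[OF s] tr_sums(2)[OF s ne] by (simp add: algebra_simps)
    finally show "step sum_list (history n x) = (1 + \<alpha> / n) * sum_list (history n x) + \<omega>" .
  qed
  also have "\<dots> = (1 + \<alpha> / n) * (\<integral>x. sum_list (history n x) \<partial>M) + \<omega>"
    using integrable_history[of sum_list n] by (simp add: prob_space)
  finally show ?thesis by (simp add: center_def psum_eq[abs_def])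
qed

definition mart :: "real list \<Rightarrow> real" where
  "mart xs = erw_coeff \<alpha> (length xs) * (sum_list xs - center (length xs))"

text \<open>\<open>i\<close> counts the steps already taken: step \<open>i + 1\<close> carries the
  coefficient with index \<open>Suc i\<close> and a variance fixed by the first \<open>i\<close>
  steps.\<close>

definition qvar :: "real list \<Rightarrow> real" where
  "qvar xs = (\<Sum>i<length xs. (erw_coeff \<alpha> (Suc i))\<^sup>2 * step_var (take i xs))"

definition A :: "nat \<Rightarrow> real" where
  "A n = (\<Sum>i<n. (erw_coeff \<alpha> (Suc i))\<^sup>2)"

text \<open>The coefficient at \<open>n\<close> is the one at \<open>n + 1\<close> times
  \<open>1 + \<alpha> / n\<close>, so the reinforcement of the past cancels and only the centred
  step remains. The first step has no memory to follow and is treated apart.\<close>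

lemma mart_snoc:
  assumes "0 \<le> \<alpha>" "set xs \<subseteq> D"
  shows "mart (xs @ [v]) - mart xs = erw_coeff \<alpha> (Suc (length xs)) * (v - step_mean xs)"
proof (cases "xs = []")
  case True
  then show ?thesis by (simp add: mart_def center_0 center_1[simplified])
next
  case False
  then have n: "length xs \<ge> 1" by (cases xs) simp_all
  define n where "n = real (length xs)"
  have n0: "n > 0" using False by (simp add: n_def)
  have "e = e * (n / (n + a)) * (1 + a / n)" if "a \<ge> 0" for a e
  proof -
    have "1 + a / n = (n + a) / n" using n0 by (simp add: add_divide_distrib)
    then show ?thesis using n0 that by simp
  qed
  then have c: "erw_coeff \<alpha> (length xs) = erw_coeff \<alpha> (Suc (length xs)) * (1 + \<alpha> / n)"
    unfolding erw_coeff_Suc[OF n] n_def[symmetric] using assms(1) by blast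
  have gen: "e * (y + v - ((1 + a) * z + w)) - e * (1 + a) * (y - z) = e * (v - (a * y + w))" for e y a z w
    by (simp add: algebra_simps)
  have m: "step_mean xs = \<alpha> / n * sum_list xs + \<omega>"
    unfolding step_mean_def tr_sums(2)[OF assms(2) False] n_def by simp
  show ?thesis
    unfolding mart_def c m length_append_singleton center_Suc[OF n] n_def[symmetric] sum_list_append
    using gen by simp
qed

text \<open>The increment bound 2 comes from steps and conditional means of size at most 1, with
  coefficients at most 1. The lower constant is the uniform bound on the variance of a step; its
  positivity is where \<phi> > 0 enters.\<close>

lemma growing:
  assumes a: "0 \<le> \<alpha>" "\<alpha> < 1/2" and phi: "\<phi> > 0"
  shows "growing_martingale M X D tr mart qvar 2 A ((1 - \<theta>) * (p + q - (p - q)\<^sup>2)) 1"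
proof
  note cb = erw_coeff_bounds[OF a(1)]
  have a2: "(erw_coeff \<alpha> n)\<^sup>2 \<le> 1" for n using cb[of n] by (simp add: power_le_one)
  show "(0::real) \<le> 2" by simp
  show "mart [] = 0" by (simp add: mart_def center_0)
  show "qvar [] = 0" by (simp add: qvar_def)
  fix xs assume xs: "set xs \<subseteq> D"
  show "\<bar>mart (xs @ [v]) - mart xs\<bar> \<le> 2" if "v \<in> D" for v
  proof -
    have "\<bar>v - step_mean xs\<bar> \<le> 2" using that abs_mean_le[OF xs] by auto
    then have "erw_coeff \<alpha> (Suc (length xs)) * \<bar>v - step_mean xs\<bar> \<le> 1 * 2"
      using cb[of "Suc (length xs)"] by (intro mult_mono) auto
    then show ?thesis unfolding mart_snoc[OF a(1) xs] using cb(1)[of "Suc (length xs)"] by (simp add: abs_mult)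
  qed
  show "(\<Sum>v\<in>D. tr xs v * (mart (xs @ [v]) - mart xs)) = 0"
  proof -
    have "(\<Sum>v\<in>D. tr xs v * (mart (xs @ [v]) - mart xs))
      = erw_coeff \<alpha> (Suc (length xs)) * ((\<Sum>v\<in>D. tr xs v * v) - step_mean xs * (\<Sum>v\<in>D. tr xs v))"
      unfolding mart_snoc[OF a(1) xs] sum_D by (simp add: algebra_simps)
    then show ?thesis unfolding tr_sums(1)[OF xs] step_mean_def[symmetric] by simp
  qed
  show "qvar (xs @ [v]) = qvar xs + (\<Sum>w\<in>D. tr xs w * (mart (xs @ [w]) - mart xs)\<^sup>2)" if "v \<in> D" for v
  proof -
    have "(\<Sum>w\<in>D. tr xs w * (mart (xs @ [w]) - mart xs)\<^sup>2) = (erw_coeff \<alpha> (Suc (length xs)))\<^sup>2 * step_var xs"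
      unfolding mart_snoc[OF a(1) xs] step_var_def sum_D by (simp add: power_mult_distrib distrib_left mult_ac)
    then show ?thesis by (simp add: qvar_def)
  qed
  have st: "set (take i xs) \<subseteq> D" for i using xs set_take_subset by fast
  show "(1 - \<theta>) * (p + q - (p - q)\<^sup>2) * A (length xs) \<le> qvar xs"
    unfolding A_def qvar_def sum_distrib_left
    using mult_left_mono[OF step_var_bounds(1)[OF st]]
    by (intro sum_mono) (simp only: mult.commute[of "(1 - \<theta>) * (p + q - (p - q)\<^sup>2)"] zero_le_power2)
  show "qvar xs \<le> A (length xs)"
    unfolding A_def qvar_def using step_var_bounds(2)[OF st]
    by (intro sum_mono) (simp add: mult_left_le)
next
  note cb = erw_coeff_bounds[OF a(1)]
  show "mono A" unfolding A_def by (intro monoI sum_mono2) auto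
  show "A (Suc n) \<le> A n + 1" for n using cb[of "Suc n"] by (simp add: A_def power_le_one)
  have g: "(Gamma (\<alpha> + 1))\<^sup>2 / (1 - 2 * \<alpha>) > 0"
  proof (rule divide_pos_pos)
    show "(Gamma (\<alpha> + 1))\<^sup>2 > 0" using a(1) by (intro zero_less_power Gamma_real_pos) simp
    show "1 - 2 * \<alpha> > 0" using a(2) by simp
  qed
  have "filterlim (\<lambda>n. real n powr (1 - 2 * \<alpha>)) at_top sequentially"
  proof -
    have "filterlim (\<lambda>n. real n powr s) at_top sequentially" if "s > 0" for s :: real using that by real_asymp
    then show ?thesis using a by simp
  qed
  then have "filterlim (\<lambda>n. A n / real n powr (1 - 2 * \<alpha>) * real n powr (1 - 2 * \<alpha>)) at_top sequentially"
    using erw_coeff_square_sum_asymp[OF a, folded A_def] g by (intro filterlim_tendsto_pos_mult_at_top)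
  moreover have "\<forall>\<^sub>F n in sequentially. A n / real n powr (1 - 2 * \<alpha>) * real n powr (1 - 2 * \<alpha>) = A n"
    using eventually_gt_at_top[of 0] by eventually_elim simp
  ultimately show "filterlim A at_top sequentially" by (simp add: filterlim_cong[OF refl refl])
  show "0 < (1 - \<theta>) * (p + q - (p - q)\<^sup>2)"
  proof -
    \<comment> \<open>\<open>(p - q)^2 \<le> (p + q)^2 \<le> p + q\<close>, with equality throughout
      only for a deterministic first step: \<open>p + q = 0\<close>, \<open>p = 1\<close> or
      \<open>q = 1\<close>. Each case gives \<phi> = 0; for \<open>q = 1\<close>, \<alpha> \<ge> 0
      first forces \<theta> = 0.\<close>
    have s4: "(p + q)\<^sup>2 = (p - q)\<^sup>2 + 4 * (p * q)" by (simp add: power2_eq_square algebra_simps)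
    have sq1: "(p - q)\<^sup>2 \<le> (p + q)\<^sup>2" unfolding s4 using pqr by simp
    have sq2: "(p + q)\<^sup>2 \<le> p + q"
      unfolding power2_eq_square using pqr by (intro mult_left_le) auto
    have ne: "(p - q)\<^sup>2 \<noteq> p + q"
    proof
      assume eq: "(p - q)\<^sup>2 = p + q"
      then have sP: "(p + q)\<^sup>2 = p + q" using sq1 sq2 by (intro antisym) simp_all
      then have "4 * (p * q) = 0" using s4 unfolding eq by (simp only: add_cancel_right_right)
      then have "p * q = 0" by simp
      moreover have "(p + q) * (p + q - 1) = 0"
        using sP by (simp add: power2_eq_square right_diff_distrib)
      ultimately consider "p + q = 0" | "p = 1" "q = 0" | "p = 0" "q = 1" by auto
      then show False
      proof cases
        case 1
        then have "p = 0" "q = 0" using pqr by auto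
        then show False using phi by simp
      next
        case 2
        then show False using phi th by simp
      next
        case 3
        then show False using phi th a by simp
      qed
    qed
    have "(p - q)\<^sup>2 < p + q" using order.trans[OF sq1 sq2] ne by (rule le_neq_trans)
    then have "0 < p + q - (p - q)\<^sup>2" by simp
    then show ?thesis using th by simp
  qed
qed

end

section \<open>Limit theorems for the walk\<close>

context elephant_walk
begin

lemma qvar_history: "qvar (history n x) = (\<Sum>i<n. (erw_coeff \<alpha> (Suc i))\<^sup>2 * step_var (history i x))"
  unfolding qvar_def length_history by (intro sum.cong refl) (simp add: take_history)

context
  assumes a: "0 \<le> \<alpha>" "\<alpha> < 1/2" and phi: "\<phi> > 0"
begin

definition B :: "nat \<Rightarrow> real" where
  "B n = \<phi> * (Gamma (\<alpha> + 1))\<^sup>2 / (1 - 2 * \<alpha>) * real n powr (1 - 2 * \<alpha>)"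

text \<open>The squared normaliser of the central limit theorem, carried over to
  \<open>mart\<close>. It is equivalent to \<open>B\<close>, but with \<open>s2\<close> the
  normalised martingale and the normalised walk agree exactly for every \<open>n\<close>.\<close>

definition s2 :: "nat \<Rightarrow> real" where
  "s2 n = (erw_coeff \<alpha> n)\<^sup>2 * (\<phi> / (1 - 2 * \<alpha>) * real n)"

lemma Gamma_pos: "(Gamma (\<alpha> + 1))\<^sup>2 > 0"
  using a(1) by (intro zero_less_power Gamma_real_pos) simp

lemma A_at_top: "filterlim A at_top sequentially"
proof -
  interpret growing_martingale M X D tr mart qvar 2 A "(1 - \<theta>) * (p + q - (p - q)\<^sup>2)" 1
    by (rule growing[OF a phi])
  show ?thesis by (rule A_at_top)
qed

lemma A_over_B: "(\<lambda>n. A n / B n) \<longlonglongrightarrow> 1 / \<phi>"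
proof -
  define g where "g = (Gamma (\<alpha> + 1))\<^sup>2 / (1 - 2 * \<alpha>)"
  have g: "g > 0" unfolding g_def using Gamma_pos a(2) by (intro divide_pos_pos) simp_all
  have "(\<lambda>n. A n / real n powr (1 - 2 * \<alpha>)) \<longlonglongrightarrow> g"
    using erw_coeff_square_sum_asymp[OF a] by (simp only: A_def g_def)
  then have "(\<lambda>n. A n / real n powr (1 - 2 * \<alpha>) / (\<phi> * g)) \<longlonglongrightarrow> g / (\<phi> * g)"
    using g phi by (intro tendsto_divide tendsto_const) simp_all
  moreover have "A n / real n powr (1 - 2 * \<alpha>) / (\<phi> * g) = A n / B n" for n
  proof -
    have "y / w / (f * (G / h)) = y / (f * G / h * w)" for y w f G h :: real by simp
    then show ?thesis unfolding B_def g_def .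
  qed
  moreover have "g / (\<phi> * g) = 1 / \<phi>"
    using g by (intro nonzero_divide_mult_cancel_right) simp
  ultimately show ?thesis by (simp only:)
qed

lemma s2_over_B: "(\<lambda>n. s2 n / B n) \<longlonglongrightarrow> 1"
proof -
  have "(\<lambda>n. (erw_coeff \<alpha> n * real n powr \<alpha>)\<^sup>2 / (Gamma (\<alpha> + 1))\<^sup>2) \<longlonglongrightarrow> (Gamma (\<alpha> + 1))\<^sup>2 / (Gamma (\<alpha> + 1))\<^sup>2"
    using Gamma_pos
    by (intro tendsto_divide tendsto_power tendsto_const LIMSEQ_imp_Suc[of "\<lambda>n. erw_coeff \<alpha> n * real n powr \<alpha>"] erw_coeff_asymp[OF a(1)]) simp
  moreover have "(Gamma (\<alpha> + 1))\<^sup>2 / (Gamma (\<alpha> + 1))\<^sup>2 = 1" using Gamma_pos by simp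
  moreover have "\<forall>\<^sub>F n in sequentially. (erw_coeff \<alpha> n * real n powr \<alpha>)\<^sup>2 / (Gamma (\<alpha> + 1))\<^sup>2 = s2 n / B n"
    using eventually_gt_at_top[of 0]
  proof eventually_elim
    case (elim n)
    have gen: "(e * y)\<^sup>2 / G = e\<^sup>2 * (f / h * m) / (f * G / h * w)"
      if "m = y\<^sup>2 * w" "w > 0" "f > 0" "h > 0" "G > 0" for e y G f h m w :: real
      using that by (simp add: power_mult_distrib)
    have "(real n powr \<alpha>)\<^sup>2 * real n powr (1 - 2 * \<alpha>) = real n powr (\<alpha> + \<alpha> + (1 - 2 * \<alpha>))"
      by (simp only: power2_eq_square powr_add)
    also have "\<alpha> + \<alpha> + (1 - 2 * \<alpha>) = 1" by simp
    finally have "real n = (real n powr \<alpha>)\<^sup>2 * real n powr (1 - 2 * \<alpha>)" using elim by simp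
    then show ?case unfolding s2_def B_def
    proof (rule gen)
      show "real n powr (1 - 2 * \<alpha>) > 0" using elim by simp
      show "1 - 2 * \<alpha> > 0" using a(2) by simp
    qed (rule phi Gamma_pos)+
  qed
  ultimately show ?thesis by (auto elim: Lim_transform_eventually)
qed

lemma B_at_top: "filterlim B at_top sequentially"
proof -
  have "0 < 1 - 2 * \<alpha>" using a(2) by simp
  moreover have "filterlim (\<lambda>n. real n powr s) at_top sequentially" if "s > 0" for s :: real
    using that by real_asymp
  ultimately have "filterlim (\<lambda>n. real n powr (1 - 2 * \<alpha>)) at_top sequentially" by blast
  moreover have "\<phi> * (Gamma (\<alpha> + 1))\<^sup>2 / (1 - 2 * \<alpha>) > 0"
    using \<open>0 < 1 - 2 * \<alpha>\<close> phi Gamma_pos by (intro divide_pos_pos mult_pos_pos)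
  ultimately show ?thesis
    unfolding B_def by (intro filterlim_tendsto_pos_mult_at_top[OF tendsto_const])
qed

lemma qvar_over_B: "AE x in M. (\<lambda>n. qvar (history n x) / B n) \<longlonglongrightarrow> 1"
proof -
  have "AE x in M. (\<lambda>n. step_var (history n x)) \<longlonglongrightarrow> \<phi>"
    by (rule step_var_tendsto) (use a in simp_all)
  then show ?thesis
  proof eventually_elim
    case (elim x)
    have "(\<lambda>n. qvar (history n x) / A n) \<longlonglongrightarrow> \<phi>"
      unfolding qvar_history A_def
      by (rule weighted_cesaro[OF _ A_at_top[unfolded A_def] elim]) simp
    then have "(\<lambda>n. qvar (history n x) / A n * (A n / B n)) \<longlonglongrightarrow> \<phi> * (1 / \<phi>)"
      by (intro tendsto_mult A_over_B)
    moreover have "\<forall>\<^sub>F n in sequentially. qvar (history n x) / A n * (A n / B n) = qvar (history n x) / B n"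
      using A_at_top[unfolded filterlim_at_top_dense, rule_format, of 0] by eventually_elim simp
    moreover have "\<phi> * (1 / \<phi>) = 1" 
      using phi nonzero_mult_div_cancel_left[of \<phi> 1] by (simp only: times_divide_eq_right)
    ultimately show ?case by (auto elim: Lim_transform_eventually)
  qed
qed

lemma mart_history: "mart (history n x) = erw_coeff \<alpha> n * (psum X n x - center n)"
  by (simp add: mart_def psum_eq)

lemma erw_clt:
  "weak_conv_m (\<lambda>n. distr M borel (\<lambda>x. (psum X n x - center n) / sqrt (\<phi> / (1 - 2 * \<alpha>) * real n)))
    std_normal_distribution"
proof -
  interpret growing_martingale M X D tr mart qvar 2 A "(1 - \<theta>) * (p + q - (p - q)\<^sup>2)" 1
    by (rule growing[OF a phi])
  define s where "s n = sqrt (s2 n)" for n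
  have k: "\<phi> / (1 - 2 * \<alpha>) > 0" using phi a(2) by (intro divide_pos_pos) simp_all
  have s2_nonneg: "s2 n \<ge> 0" for n unfolding s2_def using k by (intro mult_nonneg_nonneg) simp_all
  have s_sq: "(s n)\<^sup>2 = s2 n" for n using s2_nonneg by (simp add: s_def)
  have "filterlim (\<lambda>n. s2 n / B n * B n) at_top sequentially"
    using s2_over_B by (rule filterlim_tendsto_pos_mult_at_top) (simp_all add: B_at_top)
  moreover have "\<forall>\<^sub>F n in sequentially. s2 n / B n * B n = s2 n"
    using B_at_top[unfolded filterlim_at_top_dense, rule_format, of 0] by eventually_elim simp
  ultimately have s2_top: "filterlim s2 at_top sequentially" by (simp add: filterlim_cong[OF refl refl])
  have Bs2: "(\<lambda>n. y n / s2 n) \<longlonglongrightarrow> l" if "(\<lambda>n. y n / B n) \<longlonglongrightarrow> l" for y l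
  proof -
    have "(\<lambda>n. y n / B n / (s2 n / B n)) \<longlonglongrightarrow> l / 1"
      by (intro tendsto_divide that s2_over_B) simp
    moreover have "\<forall>\<^sub>F n in sequentially. y n / B n / (s2 n / B n) = y n / s2 n"
      using B_at_top[unfolded filterlim_at_top_dense, rule_format, of 0] by eventually_elim simp
    ultimately show ?thesis by (auto elim: Lim_transform_eventually)
  qed
  have "weak_conv_m (\<lambda>n. distr M borel (\<lambda>x. mart (history n x) / s n)) std_normal_distribution"
  proof (rule clt)
    show "filterlim s at_top sequentially"
      unfolding s_def by (rule filterlim_compose[OF sqrt_at_top s2_top])
    \<comment> \<open>The clock \<open>A\<close> dominates the variance on every path, and
      \<open>A n / s2 n\<close> tends to \<open>1 / \<phi>\<close>.\<close>
    have "\<forall>\<^sub>F n in sequentially. A n / s2 n < 1 / \<phi> + 1"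
      by (rule order_tendstoD(2)[OF Bs2[OF A_over_B]]) simp
    then show "\<forall>\<^sub>F n in sequentially. \<forall>ys. set ys \<subseteq> D \<and> length ys \<le> n \<longrightarrow> qvar ys \<le> (1 / \<phi> + 1) * (s n)\<^sup>2"
      using s2_top[unfolded filterlim_at_top_dense, rule_format, of 0]
    proof eventually_elim
      case (elim n)
      have "A n \<le> (1 / \<phi> + 1) * s2 n" using elim by (simp only: pos_divide_less_eq less_imp_le)
      then show ?case unfolding s_sq
        using qvar_le monoD[OF mono_A] by (meson order.trans)
    qed
    show "AE x in M. (\<lambda>n. qvar (history n x) / (s n)\<^sup>2) \<longlonglongrightarrow> 1"
      using qvar_over_B unfolding s_sq by eventually_elim (rule Bs2)
  qed
  moreover have "mart (history n x) / s n = (psum X n x - center n) / sqrt (\<phi> / (1 - 2 * \<alpha>) * real n)" for n x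
  proof -
    have "erw_coeff \<alpha> n > 0" by (rule erw_coeff_bounds[OF a(1)])
    then show ?thesis unfolding s_def s2_def real_sqrt_mult[of "(erw_coeff \<alpha> n)\<^sup>2"] mart_history by simp
  qed
  ultimately show ?thesis by (simp only:)
qed

text \<open>Stated for any martingale \<open>m\<close> with variance \<open>qvar\<close>, so that
  \<open>mart\<close> and \<open>- mart\<close> yield the two signs. The coefficient is absorbed
  into the normaliser, where its square turns the factor \<open>n\<close> into
  \<open>s2 n\<close>.\<close>

lemma erw_lil:
  assumes gm: "growing_martingale M X D tr m qvar 2 A c\<^sub>0 1"
    and m: "\<And>n x. m (history n x) = erw_coeff \<alpha> n * y n x"
  shows "AE x in M. limsup (\<lambda>n. ereal (y n x / sqrt (2 * (\<phi> / (1 - 2 * \<alpha>)) * real n * ln (ln (B n))))) = 1"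
proof -
  interpret G: growing_martingale M X D tr m qvar 2 A c\<^sub>0 1 by (rule gm)
  have "AE x in M. \<forall>k. \<forall>\<^sub>F n in sequentially.
      m (history n x) \<le> (1 + inverse (real (Suc k)))\<^sup>2 * lil_scale (qvar (history n x))"
    unfolding AE_all_countable
    by (intro allI G.lil_upper AE_I2 G.qvar_at_top) (simp_all add: divide_simps)
  moreover have "AE x in M. \<forall>k. \<exists>\<^sub>F n in sequentially.
      (1 - inverse (real (Suc (Suc k)))) * lil_scale (qvar (history n x)) \<le> m (history n x)"
    unfolding AE_all_countable by (intro allI G.lil_lower) (simp_all add: divide_simps)
  ultimately show ?thesis using qvar_over_B
  proof eventually_elim
    case (elim x)
    define d where "d n = erw_coeff \<alpha> n * sqrt (2 * (\<phi> / (1 - 2 * \<alpha>)) * real n * ln (ln (B n)))" for n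
    have d_eq: "d n = sqrt (2 * s2 n * ln (ln (B n)))" for n
    proof -
      have "2 * s2 n * ln (ln (B n)) = (erw_coeff \<alpha> n)\<^sup>2 * (2 * (\<phi> / (1 - 2 * \<alpha>)) * real n * ln (ln (B n)))"
        unfolding s2_def by (simp only: mult_ac)
      then show ?thesis unfolding d_def
        using erw_coeff_bounds(1)[OF a(1), of n] by (simp only: real_sqrt_mult[of "(erw_coeff \<alpha> n)\<^sup>2"] real_sqrt_abs abs_of_pos)
    qed
    have k: "\<phi> / (1 - 2 * \<alpha>) > 0" using phi a(2) by (intro divide_pos_pos) simp_all
    have "limsup (\<lambda>n. ereal (m (history n x) / d n)) = 1"
    proof (rule limsup_eq_one_of_lil_scale[where v = "\<lambda>n. qvar (history n x)"])
      show "(\<lambda>n. lil_scale (qvar (history n x)) / d n) \<longlonglongrightarrow> 1"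
        unfolding d_eq by (rule lil_scale_ratio[OF elim(3) s2_over_B B_at_top])
      have "filterlim (\<lambda>u::real. ln (ln u)) at_top at_top" by real_asymp
      then have "filterlim (\<lambda>n. ln (ln (B n))) at_top sequentially" using B_at_top by (rule filterlim_compose)
      then have "\<forall>\<^sub>F n in sequentially. ln (ln (B n)) > 0" by (simp only: filterlim_at_top_dense)
      then show "\<forall>\<^sub>F n in sequentially. d n > 0"
        using eventually_gt_at_top[of 0]
      proof eventually_elim
        case (elim n)
        have "2 * (\<phi> / (1 - 2 * \<alpha>)) * real n * ln (ln (B n)) > 0"
          using elim k by (intro mult_pos_pos) simp_all
        then show ?case unfolding d_def by (intro mult_pos_pos erw_coeff_bounds a) (simp only: real_sqrt_gt_0_iff)
      qed
    qed (use elim in blast)+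
    moreover have "m (history n x) / d n = y n x / sqrt (2 * (\<phi> / (1 - 2 * \<alpha>)) * real n * ln (ln (B n)))" for n
      unfolding m d_def using erw_coeff_bounds(1)[OF a(1), of n] by simp
    ultimately show ?case by (simp only:)
  qed
qed

lemma erw_lil_upper:
  "AE x in M. limsup (\<lambda>n. ereal ((psum X n x - center n)
    / sqrt (2 * (\<phi> / (1 - 2 * \<alpha>)) * real n * ln (ln (B n))))) = 1"
  by (rule erw_lil[OF growing[OF a phi] mart_history])

lemma erw_lil_lower:
  "AE x in M. limsup (\<lambda>n. ereal (- (psum X n x - center n)
    / sqrt (2 * (\<phi> / (1 - 2 * \<alpha>)) * real n * ln (ln (B n))))) = 1"
  by (rule erw_lil[OF growing_martingale.uminus_growing_martingale[OF growing[OF a phi]]])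
    (simp only: mart_history mult_minus_right)

end

end

theorem theorem2:
  fixes M :: "'a measure" and X :: "nat \<Rightarrow> 'a \<Rightarrow> real"
    and p q r \<theta> \<alpha> \<omega> \<tau> \<gamma> \<phi> :: real
  assumes M: "prob_space M"
    and pqr: "p \<ge> 0" "q \<ge> 0" "r \<ge> 0" "p + q + r = 1"
    and th: "0 \<le> \<theta>" "\<theta> < 1"
    and meas: "\<And>i. X i \<in> borel_measurable M"
    and vals: "\<And>i \<omega>. i \<ge> 1 \<Longrightarrow> \<omega> \<in> space M \<Longrightarrow> X i \<omega> \<in> {-1, 0, 1}"
    and init: "measure M {\<omega>\<in>space M. X 1 \<omega> = 1} = p"
              "measure M {\<omega>\<in>space M. X 1 \<omega> = -1} = q"
              "measure M {\<omega>\<in>space M. X 1 \<omega> = 0} = r"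
    and cond: "\<And>xs. xs \<noteq> [] \<Longrightarrow> set xs \<subseteq> {-1, 0, 1} \<Longrightarrow>
       (let n = real (length xs); A = path_event M X xs;
            np = cnt xs 1; nm = cnt xs (-1); nz = cnt xs 0 in
        measure M (A \<inter> {\<omega>\<in>space M. X (Suc (length xs)) \<omega> = 1})
          = measure M A * (\<theta> * (np / n * p + nm / n * q) + (1 - \<theta>) * p)
      \<and> measure M (A \<inter> {\<omega>\<in>space M. X (Suc (length xs)) \<omega> = -1})
          = measure M A * (\<theta> * (nm / n * p + np / n * q) + (1 - \<theta>) * q)
      \<and> measure M (A \<inter> {\<omega>\<in>space M. X (Suc (length xs)) \<omega> = 0})
          = measure M A * (\<theta> * (p + q) * (nz / n) + r))"
    and defs: "\<alpha> = (p - q) * \<theta>" "\<omega> = (p - q) * (1 - \<theta>)"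
              "\<tau> = (1 - \<theta>) * (p + q)" "\<gamma> = (p + q) * \<theta>"
              "\<phi> = \<tau> / (1 - \<gamma>) - (\<omega> / (1 - \<alpha>))\<^sup>2"
    and alpha: "0 \<le> \<alpha>" "\<alpha> < 1/2"
    and phi: "\<phi> > 0"
  shows "weak_conv_m
           (\<lambda>n. distr M borel (\<lambda>x. (psum X n x - prob_space.expectation M (psum X n))
                                    / sqrt (\<phi> / (1 - 2 * \<alpha>) * real n)))
           std_normal_distribution
       \<and> (AE x in M. limsup (\<lambda>n. ereal ((psum X n x - prob_space.expectation M (psum X n))
            / sqrt (2 * (\<phi> / (1 - 2 * \<alpha>)) * real n
                * ln (ln (\<phi> * (Gamma (\<alpha> + 1))\<^sup>2 / (1 - 2 * \<alpha>) * real n powr (1 - 2 * \<alpha>)))))) = 1)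
       \<and> (AE x in M. limsup (\<lambda>n. ereal (- (psum X n x - prob_space.expectation M (psum X n))
            / sqrt (2 * (\<phi> / (1 - 2 * \<alpha>)) * real n
                * ln (ln (\<phi> * (Gamma (\<alpha> + 1))\<^sup>2 / (1 - 2 * \<alpha>) * real n powr (1 - 2 * \<alpha>)))))) = 1)"
proof -
  interpret P: prob_space M by (rule M)
  interpret elephant_walk M X p q r \<theta>
  proof
    show "X (Suc i) x \<in> {-1, 0, 1}" if "x \<in> space M" for i x using vals[of "Suc i" x] that by simp
    fix xs :: "real list" and v :: real
    assume xs: "set xs \<subseteq> {-1, 0, 1}" and v: "v \<in> {-1, 0, 1}"
    show "P.prob (path_event M X xs \<inter> {x \<in> space M. X (Suc (length xs)) x = v})
        = P.prob (path_event M X xs) * erw_trans p q r \<theta> xs v"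
    \<comment> \<open>The empty path is the whole space, so the law of the first step is the
      transition rule at \<open>[]\<close>.\<close>
    proof (cases "xs = []")
      case True
      have "path_event M X [] = space M" by (simp add: path_event_def)
      moreover have "space M \<inter> {x \<in> space M. X (Suc 0) x = v} = {x \<in> space M. X 1 x = v}" by auto
      ultimately show ?thesis using True v init by (auto simp: erw_trans_def P.prob_space)
    next
      case False
      then show ?thesis using v cond[OF False xs] by (auto simp: erw_trans_def Let_def)
    qed
  qed (use pqr th meas in auto)
  note hyps = alpha[unfolded defs] phi[unfolded defs]
  show ?thesis
    using erw_clt[OF hyps] erw_lil_upper[OF hyps] erw_lil_lower[OF hyps]
    unfolding center_def B_def[OF hyps] defs by blast
qed

end
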